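(* Let $\lambda\in\mathrm{Part}_{r,n}$ and let $\alpha\in\mathrm{Comp}_{r,n}$ be the composition with $\lambda_\alpha=\lambda$. Let $\nu\subset\eta$ be the partitions in $\mathrm{Part}_{r,n}$ such that $\eta/\nu$ is the ribbon (connected skew shape with no $2\times2$ square) with $\eta_i-\nu_i=\alpha_i$ for $1\le i\le\ell(\alpha)$ and whose extreme boxes lie in the first column and in the first row (so $\eta$ has exactly $\ell(\alpha)$ nonzero rows). Let $w\in S_n$ be the permutation with one-line notation $$1\,2\cdots(r-\ell(\alpha))\ \ r\,(r-1)\cdots(r-\ell(\alpha)+1)\ \ (r+1)(r+2)\cdots n,$$ let $w_\nu\in S_n$ be the $r$-Grassmannian permutation associated with $\nu$, and set $x=w_\nu w$. Then $$X^\lambda_{\mathrm{NC}}=x^{-1}X^\eta_\nu ,$$ i.e. the quasisymmetric Grassmannian Schubert cycle $X^\lambda_{\mathrm{NC}}$ is the translate by the permutation matrix of $x^{-1}$ of the Grassmannian Richardson variety $X^\eta_\nu\subset\mathrm{Gr}(r;n)$.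
   Context: **Subsets, partitions.** $[n]=\{1,\dots,n\}$. $\mathrm{Part}_{r,n}$ is the set of partitions contained in an $r\times(n-r)$ rectangle (English notation, row 1 on top). For $A=\{i_1<\cdots<i_r\}\in\binom{[n]}{r}$, $\lambda_A=(i_r-r,\dots,i_2-2,i_1-1)$, giving a bijection $\binom{[n]}{r}\to\mathrm{Part}_{r,n}$. The $r$-Grassmannian permutation $w_\lambda$ associated with $\lambda=\lambda_A$ is the one with $w_\lambda(1)<\cdots<w_\lambda(r)$ the elements of $A$ and $w_\lambda(r+1)<\cdots<w_\lambda(n)$ the elements of $[n]\setminus A$. **Compositions.** $\mathrm{Comp}_{r,n}$: the empty composition together with the nonempty compositions $\alpha$ with $\ell(\alpha)\le r$ and $|\alpha|-\ell(\alpha)+1\le n-r$. The bijection $\mathrm{Comp}_{r,n}\to\mathrm{Part}_{r,n}$, $\alpha\mapsto\lambda_\alpha$: write nonempty $\alpha$ uniquely as the concatenation $d_1\,1^{e_1-1}\,(d_2+1)\,1^{e_2-1}\cdots(d_k+1)\,1^{e_k-1}$ with all $d_i,e_i\ge1$; then $\lambda_\alpha$ is the partition whose $j$-th main diagonal box ($1\le j\le k$) has arm $(\sum_{i\ge j}d_i)-1$ and leg $(\sum_{i\ge j}e_i)-1$ (Frobenius notation); $\lambda_\emptyset=\emptyset$. **Quasisymmetric cells.** $\mathrm{NC}_n\subset S_n$ is the set of permutations obtained from noncrossing set partitions of $[n]$ by turning each block $\{b_1<\cdots<b_s\}$ into the cycle $(b_s\,b_{s-1}\,\cdots\,b_1)$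 and multiplying these cycles. Elements $u,w\in\mathrm{NC}_n$ are Kreweras-adjacent if $w=\tau u$ for some transposition $\tau$. $\mathrm{Inv}(A)=\{(i,j)\mid i<j,\ j\in A,\ i\notin A\}$. The quasisymmetric Johnson graph $QJ_{r,n}$ has vertex set $\binom{[n]}{r}$ and edges $AB$ with $B=(A\setminus j)\cup i$ for some $j\in A$, $i\notin A$, such that $A=w\cdot[r]$, $B=u\cdot[r]$ for some Kreweras-adjacent $w,u\in\mathrm{NC}_n$ (where $w\cdot[r]=\{w(1),\dots,w(r)\}$). $\mathrm{Inv}^Q(A)=\{(i,j)\in\mathrm{Inv}(A)\mid A\,B\in E(QJ_{r,n})\text{ for }B=(A\setminus j)\cup i\}$. For $A=\{a_1<\cdots<a_r\}$, $\mathring X^{\lambda_A}_{\mathrm{NC}}\subset\mathrm{Gr}(r;n)$ is the set of column spans of $n\times r$ matrices $M$ with $M_{a_j,j}=1$, $M_{i,j}$ arbitrary for $(i,a_j)\in\mathrm{Inv}^Q(A)$, and all other entries $0$; $X^\lambda_{\mathrm{NC}}$ is its closure. **Richardson varieties.** $\mathring X^{\lambda_A}$ is the set of column spans of $n\times r$ matrices $M$ with $M_{a_j,j}=1$, $M_{i,j}$ arbitrary for $(i,a_j)\in\mathrm{Inv}(A)$, other entries $0$ (the orbit of the coordinate plane $\langle e_a: a\in A\rangle$ under upper triangular matrices), and $X^{\lambda_A}$ is its closure. $X_{\lambda_A}$ is the closure of the orbit of $\langle e_a:a\in A\rangle$ under lower triangular matrices. For $\nu\subset\eta$, $X^\eta_\nu=X^\eta\cap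 X_\nu$. $S_n$ acts on $\mathrm{Gr}(r;n)$ by permutation matrices, $u\cdot e_i=e_{u(i)}$. *)

theory Defs
  imports
    "HOL-Analysis.Abstract_Topology"
    "HOL-Combinatorics.Cycles"
    "HOL-Library.Disjoint_Sets"
    "Jordan_Normal_Form.DL_Rank"
begin

text \<open>
  Conventions. The ground field is the complex numbers. Elements of \<open>[n] = {1..n}\<close>, the letters
  permuted by \<open>S_n\<close>, and the rows and columns of Young diagrams are numbered from 1, whereas vectors,
  matrices and lists are numbered from 0; this is the reason for the shifts below.
  Permutations are functions on \<open>nat\<close> fixing everything outside \<open>{1..n}\<close>, and products of
  permutations are compositions of functions.
\<close>


section \<open>Subsets and partitions\<close>

definition rsubsets :: "nat \<Rightarrow> nat \<Rightarrow> nat set set" where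
  "rsubsets r n = {A. A \<subseteq> {1..n} \<and> card A = r}"

text \<open>Partitions in an \<open>r \<times> (n - r)\<close> rectangle, as lists of exactly \<open>r\<close> parts (padded with zeros).\<close>

definition Part :: "nat \<Rightarrow> nat \<Rightarrow> nat list set" where
  "Part r n = {lam. length lam = r \<and> sorted_wrt (\<ge>) lam \<and> (\<forall>x\<in>set lam. x \<le> n - r)}"

definition part_row :: "nat list \<Rightarrow> nat \<Rightarrow> nat" where
  "part_row lam i = (if 1 \<le> i \<and> i \<le> length lam then lam ! (i - 1) else 0)"

definition diagram :: "nat list \<Rightarrow> (nat \<times> nat) set" where
  "diagram lam = {(i, j). 1 \<le> i \<and> 1 \<le> j \<and> j \<le> part_row lam i}"

text \<open>\<open>\<lambda>_A = (i_r - r, \<dots>, i_1 - 1)\<close> for \<open>A = {i_1 < \<cdots> < i_r}\<close>.\<close>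

definition part_of_subset :: "nat set \<Rightarrow> nat list" where
  "part_of_subset A = rev (map (\<lambda>k. sorted_list_of_set A ! k - (k + 1)) [0..<card A])"

definition subset_of_part :: "nat \<Rightarrow> nat \<Rightarrow> nat list \<Rightarrow> nat set" where
  "subset_of_part r n = the_inv_into (rsubsets r n) part_of_subset"

lemma bij_betw_part_of_subset:
  assumes "r \<le> n"
  shows "bij_betw part_of_subset (rsubsets r n) (Part r n)"
proof (rule bij_betw_imageI)
  let ?s = "sorted_list_of_set :: nat set \<Rightarrow> nat list"
  have props: "finite A" "length (?s A) = r" "set (?s A) = A" "sorted_wrt (<) (?s A)"
    "\<And>k. k < r \<Longrightarrow> 1 \<le> ?s A ! k \<and> ?s A ! k \<le> n"
    if "A \<in> rsubsets r n" for A
  proof -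
    show fin: "finite A" and len: "length (?s A) = r" and set: "set (?s A) = A"
      using that finite_subset[of A "{1..n}"] by (auto simp: rsubsets_def)
    show "sorted_wrt (<) (?s A)" by simp
    fix k assume "k < r"
    then have "?s A ! k \<in> A" using nth_mem[of k "?s A"] len set by simp
    then show "1 \<le> ?s A ! k \<and> ?s A ! k \<le> n" using that by (auto simp: rsubsets_def)
  qed
  have step: "?s A ! i + (j - i) \<le> ?s A ! j" if A: "A \<in> rsubsets r n" and "i \<le> j" "j < r" for A i j
    using that(2,3)
  proof (induction j rule: dec_induct)
    case (step m)
    have "?s A ! m < ?s A ! Suc m"
      using sorted_wrt_nth_less[OF props(4)[OF A], of m "Suc m"] props(2)[OF A] step by simp
    then show ?case using step by simp
  qed simp
  have low: "k + 1 \<le> ?s A ! k" and high: "?s A ! k - (k + 1) \<le> n - r"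
    if A: "A \<in> rsubsets r n" and k: "k < r" for A k
  proof -
    show "k + 1 \<le> ?s A ! k"
      using step[OF A, of 0 k] props(5)[OF A, of 0] k by simp
    have "?s A ! k + (r - 1 - k) \<le> n"
      using step[OF A, of k "r - 1"] props(5)[OF A, of "r - 1"] k by force
    then show "?s A ! k - (k + 1) \<le> n - r" using k by linarith
  qed
  show "inj_on part_of_subset (rsubsets r n)"
  proof (rule inj_onI)
    fix A B assume A: "A \<in> rsubsets r n" and B: "B \<in> rsubsets r n"
      and eq: "part_of_subset A = part_of_subset B"
    have cards: "card A = r" "card B = r" using A B by (auto simp: rsubsets_def)
    have "?s A = ?s B"
    proof (rule nth_equalityI)
      show "length (?s A) = length (?s B)" using props(2) A B by simp
      fix k assume "k < length (?s A)"
      then have k: "k < r" using props(2)[OF A] by simp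
      have "?s A ! k - (k + 1) = ?s B ! k - (k + 1)"
        using eq k unfolding part_of_subset_def cards by simp
      then show "?s A ! k = ?s B ! k" using low[OF A k] low[OF B k] by simp
    qed
    then show "A = B" using props(3) A B by metis
  qed
  show "part_of_subset ` rsubsets r n = Part r n"
  proof (intro equalityI subsetI)
    fix lam assume "lam \<in> part_of_subset ` rsubsets r n"
    then obtain A where A: "A \<in> rsubsets r n" and lam: "lam = part_of_subset A" by blast
    have "card A = r" using A by (auto simp: rsubsets_def)
    moreover have "?s A ! (r - Suc j) - Suc (r - Suc j) \<le> ?s A ! (r - Suc i) - Suc (r - Suc i)"
      if "i < j" "j < r" for i j
    proof -
      have "r - Suc j \<le> r - Suc i" "r - Suc i < r" using that by simp_all
      from step[OF A this] low[OF A, of "r - Suc j"] that show ?thesis by linarith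
    qed
    ultimately show "lam \<in> Part r n"
      using high[OF A] unfolding lam Part_def part_of_subset_def
      by (auto simp: rev_nth sorted_wrt_iff_nth_less simp del: diff_diff_left diff_Suc_Suc Suc_diff_diff)
  next
    fix lam assume "lam \<in> Part r n"
    then have len: "length lam = r" and mono: "sorted_wrt (\<ge>) lam"
      and le: "\<And>x. x \<in> set lam \<Longrightarrow> x \<le> n - r" by (auto simp: Part_def)
    define xs where "xs = map (\<lambda>k. rev lam ! k + (k + 1)) [0..<r]"
    have mono': "rev lam ! i \<le> rev lam ! j" if "i < j" "j < r" for i j
      using mono that len sorted_wrt_nth_less[of "(\<le>)" "rev lam" i j] by (simp add: sorted_wrt_rev)
    have sorted: "sorted_wrt (<) xs"
      unfolding xs_def by (auto simp: sorted_wrt_iff_nth_less intro: add_le_less_mono mono')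
    have s: "?s (set xs) = xs"
      using sorted by (simp add: strict_sorted_equal strict_sorted_list_of_set)
    have "distinct xs" using sorted by (simp add: strict_sorted_iff)
    then have card: "card (set xs) = r" using distinct_card[of xs] by (simp only: xs_def length_map length_upt diff_zero)
    have "x \<le> n" "1 \<le> x" if "x \<in> set xs" for x
    proof -
      from that obtain k where k: "k < r" "x = rev lam ! k + (k + 1)" by (auto simp: xs_def)
      have "rev lam ! k \<in> set lam" using k len nth_mem[of k "rev lam"] by simp
      from le[OF this] k assms show "x \<le> n" "1 \<le> x" by simp_all
    qed
    then have "set xs \<in> rsubsets r n" using card by (auto simp: rsubsets_def)
    moreover have "part_of_subset (set xs) = lam"
      unfolding part_of_subset_def s card
      by (rule nth_equalityI) (auto simp: xs_def len rev_nth)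
    ultimately show "lam \<in> part_of_subset ` rsubsets r n" by (metis imageI)
  qed
qed


section \<open>Permutations\<close>

definition one_line :: "nat list \<Rightarrow> nat \<Rightarrow> nat" where
  "one_line xs i = (if 1 \<le> i \<and> i \<le> length xs then xs ! (i - 1) else i)"

definition grassmannian_perm :: "nat \<Rightarrow> nat \<Rightarrow> nat list \<Rightarrow> nat \<Rightarrow> nat" where
  "grassmannian_perm r n lam =
     (let A = subset_of_part r n lam
      in one_line (sorted_list_of_set A @ sorted_list_of_set ({1..n} - A)))"

definition noncrossing :: "nat set set \<Rightarrow> bool" where
  "noncrossing P \<longleftrightarrow>
     \<not> (\<exists>B\<in>P. \<exists>C\<in>P. B \<noteq> C \<and>
          (\<exists>a b c d. a \<in> B \<and> b \<in> C \<and> c \<in> B \<and> d \<in> C \<and> a < b \<and> b < c \<and> c < d))"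

text \<open>The permutation sending, in each block, every element to the next smaller one and the
  least element to the greatest one.\<close>

definition NC :: "nat \<Rightarrow> (nat \<Rightarrow> nat) set" where
  "NC n = {w. w permutes {1..n} \<and>
              (\<exists>P. partition_on {1..n} P \<and> noncrossing P \<and>
                 (\<forall>B\<in>P. \<forall>x\<in>B. w x = cycle_of_list (rev (sorted_list_of_set B)) x))}"

definition kreweras_adjacent :: "nat \<Rightarrow> (nat \<Rightarrow> nat) \<Rightarrow> (nat \<Rightarrow> nat) \<Rightarrow> bool" where
  "kreweras_adjacent n u w \<longleftrightarrow>
     u \<in> NC n \<and> w \<in> NC n \<and>
     (\<exists>a\<in>{1..n}. \<exists>b\<in>{1..n}. a \<noteq> b \<and> w = transpose a b \<circ> u)"


section \<open>The quasisymmetric Johnson graph and inversions\<close>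

definition QJ_edge :: "nat \<Rightarrow> nat \<Rightarrow> nat set \<Rightarrow> nat set \<Rightarrow> bool" where
  "QJ_edge r n A B \<longleftrightarrow>
     A \<in> rsubsets r n \<and> B \<in> rsubsets r n \<and>
     (\<exists>j\<in>A. \<exists>i. i \<notin> A \<and> B = insert i (A - {j})) \<and>
     (\<exists>w u. kreweras_adjacent n w u \<and> A = w ` {1..r} \<and> B = u ` {1..r})"

definition Inv :: "nat set \<Rightarrow> (nat \<times> nat) set" where
  "Inv A = {(i, j). 1 \<le> i \<and> i < j \<and> j \<in> A \<and> i \<notin> A}"

definition InvQ :: "nat \<Rightarrow> nat \<Rightarrow> nat set \<Rightarrow> (nat \<times> nat) set" where
  "InvQ r n A = {(i, j) \<in> Inv A. QJ_edge r n A (insert i (A - {j}))}"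


section \<open>The Grassmannian and its Zariski topology\<close>

abbreviation colspan :: "nat \<Rightarrow> complex mat \<Rightarrow> complex vec set" where
  "colspan n M \<equiv> vec_space.col_space n M"

definition frames :: "nat \<Rightarrow> nat \<Rightarrow> complex mat set" where
  "frames r n = {M \<in> carrier_mat n r. vec_space.rank n M = r}"

definition Gr :: "nat \<Rightarrow> nat \<Rightarrow> complex vec set set" where
  "Gr r n = colspan n ` frames r n"

inductive_set poly_funs :: "nat \<Rightarrow> nat \<Rightarrow> (complex mat \<Rightarrow> complex) set" for r n where
  const: "(\<lambda>_. c) \<in> poly_funs r n"
| entry: "i < n \<Longrightarrow> j < r \<Longrightarrow> (\<lambda>M. M $$ (i, j)) \<in> poly_funs r n"
| add: "p \<in> poly_funs r n \<Longrightarrow> q \<in> poly_funs r n \<Longrightarrow> (\<lambda>M. p M + q M) \<in> poly_funs r n"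
| mult: "p \<in> poly_funs r n \<Longrightarrow> q \<in> poly_funs r n \<Longrightarrow> (\<lambda>M. p M * q M) \<in> poly_funs r n"

text \<open>
  The Grassmannian is the quotient of the variety of \<open>n \<times> r\<close> matrices of rank \<open>r\<close> by \<open>GL_r\<close>, and its
  Zariski topology is the quotient topology: a set of subspaces is closed iff the full-rank matrices
  spanning its members are cut out by polynomial equations in the entries.
  The sets whose closures are taken below are constructible, so the classical topology would give
  the same closures.
\<close>

definition Gr_open :: "nat \<Rightarrow> nat \<Rightarrow> complex vec set set \<Rightarrow> bool" where
  "Gr_open r n U \<longleftrightarrow>
     U \<subseteq> Gr r n \<and>
     (\<exists>E \<subseteq> poly_funs r n. \<forall>M \<in> frames r n. colspan n M \<notin> U \<longleftrightarrow> (\<forall>p\<in>E. p M = 0))"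

definition Gr_topology :: "nat \<Rightarrow> nat \<Rightarrow> complex vec set topology" where
  "Gr_topology r n = topology (Gr_open r n)"

lemma Gr_openI:
  assumes "U \<subseteq> Gr r n" "E \<subseteq> poly_funs r n"
    and "\<And>M. M \<in> frames r n \<Longrightarrow> colspan n M \<notin> U \<longleftrightarrow> (\<forall>p\<in>E. p M = 0)"
  shows "Gr_open r n U"
  unfolding Gr_open_def
  by (rule conjI[OF assms(1)], rule exI[of _ E], rule conjI[OF assms(2)], rule ballI, rule assms(3))

lemma istopology_Gr_open: "istopology (Gr_open r n)"
  unfolding istopology_def
proof (intro conjI allI impI)
  fix S T
  assume S: "Gr_open r n S" and T: "Gr_open r n T"
  obtain E where E: "S \<subseteq> Gr r n" "E \<subseteq> poly_funs r n"
      "\<forall>M\<in>frames r n. colspan n M \<notin> S \<longleftrightarrow> (\<forall>p\<in>E. p M = 0)"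
    using S unfolding Gr_open_def by (elim conjE exE)
  obtain F where F: "F \<subseteq> poly_funs r n"
      "\<forall>M\<in>frames r n. colspan n M \<notin> T \<longleftrightarrow> (\<forall>p\<in>F. p M = 0)"
    using T unfolding Gr_open_def by (elim conjE exE)
  define H where "H = (\<lambda>(p, q) M. p M * q M) ` (E \<times> F)"
  show "Gr_open r n (S \<inter> T)"
  proof (rule Gr_openI)
    show "S \<inter> T \<subseteq> Gr r n"
      using E(1) by blast
    show "H \<subseteq> poly_funs r n"
    proof
      fix h assume "h \<in> H"
      then obtain p q where "p \<in> E" "q \<in> F" "h = (\<lambda>M. p M * q M)"
        unfolding H_def by (elim imageE SigmaE) simp
      then show "h \<in> poly_funs r n"
        using E(2) F(1) poly_funs.mult by (metis subsetD)
    qed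
    fix M :: "complex mat"
    assume M: "M \<in> frames r n"
    have "(\<forall>h\<in>H. h M = 0) \<longleftrightarrow> (\<forall>p\<in>E. \<forall>q\<in>F. p M = 0 \<or> q M = 0)"
      unfolding H_def by simp
    also have "\<dots> \<longleftrightarrow> (\<forall>p\<in>E. p M = 0) \<or> (\<forall>q\<in>F. q M = 0)"
      by blast
    finally show "colspan n M \<notin> S \<inter> T \<longleftrightarrow> (\<forall>h\<in>H. h M = 0)"
      unfolding bspec[OF E(3) M, symmetric] bspec[OF F(2) M, symmetric] by simp
  qed
next
  fix \<K>
  assume K: "\<forall>K\<in>\<K>. Gr_open r n K"
  have "\<forall>K\<in>\<K>. \<exists>E \<subseteq> poly_funs r n.
      \<forall>M \<in> frames r n. colspan n M \<notin> K \<longleftrightarrow> (\<forall>p\<in>E. p M = 0)"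
  proof
    fix K assume "K \<in> \<K>"
    with K have "Gr_open r n K" by (rule bspec)
    then show "\<exists>E \<subseteq> poly_funs r n.
        \<forall>M \<in> frames r n. colspan n M \<notin> K \<longleftrightarrow> (\<forall>p\<in>E. p M = 0)"
      unfolding Gr_open_def by (rule conjunct2)
  qed
  from bchoice[OF this] obtain E where E: "\<forall>K\<in>\<K>. E K \<subseteq> poly_funs r n \<and>
      (\<forall>M \<in> frames r n. colspan n M \<notin> K \<longleftrightarrow> (\<forall>p\<in>E K. p M = 0))"
    by (elim exE)
  show "Gr_open r n (\<Union>\<K>)"
  proof (rule Gr_openI)
    show "\<Union>\<K> \<subseteq> Gr r n"
      using K unfolding Gr_open_def by (intro Union_least) simp
    show "(\<Union>K\<in>\<K>. E K) \<subseteq> poly_funs r n"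
      by (intro UN_least conjunct1[OF bspec[OF E]])
    fix M :: "complex mat"
    assume M: "M \<in> frames r n"
    have "colspan n M \<notin> \<Union>\<K> \<longleftrightarrow> (\<forall>K\<in>\<K>. colspan n M \<notin> K)"
      by simp
    also have "\<dots> \<longleftrightarrow> (\<forall>K\<in>\<K>. \<forall>p\<in>E K. p M = 0)"
      by (intro ball_cong refl bspec[OF conjunct2[OF bspec[OF E]] M])
    finally show "colspan n M \<notin> \<Union>\<K> \<longleftrightarrow> (\<forall>p\<in>(\<Union>K\<in>\<K>. E K). p M = 0)"
      by simp
  qed
qed

lemma openin_Gr_topology: "openin (Gr_topology r n) U \<longleftrightarrow> Gr_open r n U"
  unfolding Gr_topology_def using topology_inverse'[OF istopology_Gr_open] by (rule fun_cong)

lemma Gr_open_Gr: "Gr_open r n (Gr r n)"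
proof (rule Gr_openI)
  show "{\<lambda>_. 1} \<subseteq> poly_funs r n"
    by (simp add: poly_funs.const)
  fix M :: "complex mat"
  assume "M \<in> frames r n"
  then have "colspan n M \<in> Gr r n"
    unfolding Gr_def by (rule imageI)
  then show "colspan n M \<notin> Gr r n \<longleftrightarrow> (\<forall>p\<in>{\<lambda>_. 1}. p M = (0::complex))"
    by simp
qed simp

lemma topspace_Gr_topology: "topspace (Gr_topology r n) = Gr r n"
proof
  have "Gr_open r n (topspace (Gr_topology r n))"
    unfolding openin_Gr_topology[symmetric] by (rule openin_topspace)
  then show "topspace (Gr_topology r n) \<subseteq> Gr r n"
    unfolding Gr_open_def by (rule conjunct1)
  show "Gr r n \<subseteq> topspace (Gr_topology r n)"
    by (rule openin_subset) (unfold openin_Gr_topology, rule Gr_open_Gr)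
qed


text \<open>The permutation matrix of \<open>u\<close>, \<open>u \<cdot> e_i = e_{u(i)}\<close>, acting on subspaces and on sets of subspaces.\<close>

definition perm_matrix :: "nat \<Rightarrow> (nat \<Rightarrow> nat) \<Rightarrow> complex mat" where
  "perm_matrix n u = mat n n (\<lambda>(k, i). if k + 1 = u (i + 1) then 1 else 0)"

definition mat_act :: "complex mat \<Rightarrow> complex vec set \<Rightarrow> complex vec set" where
  "mat_act g V = (\<lambda>v. g *\<^sub>v v) ` V"

definition translate :: "nat \<Rightarrow> (nat \<Rightarrow> nat) \<Rightarrow> complex vec set set \<Rightarrow> complex vec set set" where
  "translate n u X = mat_act (perm_matrix n u) ` X"


section \<open>Schubert cells, Richardson varieties and quasisymmetric Schubert cycles\<close>

text \<open>For \<open>A = {a_1 < \<cdots> < a_r}\<close>: column spans of the matrices with entry 1 at \<open>(a_j, j)\<close>, arbitrary entry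
  at \<open>(i, j)\<close> if \<open>(i, a_j) \<in> I\<close>, and 0 elsewhere.\<close>

definition cell :: "nat \<Rightarrow> nat \<Rightarrow> nat set \<Rightarrow> (nat \<times> nat) set \<Rightarrow> complex vec set set" where
  "cell r n A I = {colspan n M | M. M \<in> carrier_mat n r \<and>
     (\<forall>i\<in>{1..n}. \<forall>j\<in>{1..r}. let a = sorted_list_of_set A ! (j - 1) in
        (i = a \<longrightarrow> M $$ (i - 1, j - 1) = 1) \<and>
        (i \<noteq> a \<and> (i, a) \<notin> I \<longrightarrow> M $$ (i - 1, j - 1) = 0))}"

definition X_NC :: "nat \<Rightarrow> nat \<Rightarrow> nat list \<Rightarrow> complex vec set set" where
  "X_NC r n lam =
     (let A = subset_of_part r n lam in Abstract_Topology.closure_of (Gr_topology r n) (cell r n A (InvQ r n A)))"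

definition schubert :: "nat \<Rightarrow> nat \<Rightarrow> nat list \<Rightarrow> complex vec set set" where
  "schubert r n lam =
     (let A = subset_of_part r n lam in Abstract_Topology.closure_of (Gr_topology r n) (cell r n A (Inv A)))"

definition coord_plane :: "nat \<Rightarrow> nat set \<Rightarrow> complex vec set" where
  "coord_plane n A =
     colspan n (mat_of_cols n (map (\<lambda>a. unit_vec n (a - 1)) (sorted_list_of_set A)))"

definition lower_orbit :: "nat \<Rightarrow> nat set \<Rightarrow> complex vec set set" where
  "lower_orbit n A = {mat_act g (coord_plane n A) | g.
     g \<in> carrier_mat n n \<and> invertible_mat g \<and> upper_triangular (transpose_mat g)}"

definition opposite_schubert :: "nat \<Rightarrow> nat \<Rightarrow> nat list \<Rightarrow> complex vec set set" where
  "opposite_schubert r n lam =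
     Abstract_Topology.closure_of (Gr_topology r n) (lower_orbit n (subset_of_part r n lam))"

definition richardson :: "nat \<Rightarrow> nat \<Rightarrow> nat list \<Rightarrow> nat list \<Rightarrow> complex vec set set" where
  "richardson r n eta nu = schubert r n eta \<inter> opposite_schubert r n nu"


section \<open>Compositions and ribbons\<close>

definition Comp :: "nat \<Rightarrow> nat \<Rightarrow> nat list set" where
  "Comp r n = {al. (\<forall>a\<in>set al. 1 \<le> a) \<and>
     (al = [] \<or> (length al \<le> r \<and> sum_list al - length al + 1 \<le> n - r))}"

definition arm :: "nat list \<Rightarrow> nat \<times> nat \<Rightarrow> nat" where
  "arm lam = (\<lambda>(i, j). card {j'. j < j' \<and> (i, j') \<in> diagram lam})"

definition leg :: "nat list \<Rightarrow> nat \<times> nat \<Rightarrow> nat" where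
  "leg lam = (\<lambda>(i, j). card {i'. i < i' \<and> (i', j) \<in> diagram lam})"

text \<open>The composition \<open>d_1 1^(e_1 - 1) (d_2 + 1) 1^(e_2 - 1) \<cdots> (d_k + 1) 1^(e_k - 1)\<close>; lists are
  0-based, so \<open>d_(j+1)\<close> is \<open>ds ! j\<close>.\<close>

definition comp_of_blocks :: "nat list \<Rightarrow> nat list \<Rightarrow> nat list" where
  "comp_of_blocks ds es =
     concat (map (\<lambda>j. (if j = 0 then ds ! j else ds ! j + 1) # replicate (es ! j - 1) 1)
                 [0..<length ds])"

text \<open>\<open>comp_part \<alpha> \<lambda>\<close> states that \<open>\<lambda>\<^sub>\<alpha> = \<lambda>\<close>, up to trailing zeros of \<open>\<lambda>\<close>.\<close>

definition comp_part :: "nat list \<Rightarrow> nat list \<Rightarrow> bool" where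
  "comp_part al lam \<longleftrightarrow>
     (if al = [] then diagram lam = {}
      else \<exists>ds es. length ds = length es \<and> (\<forall>d\<in>set ds. 1 \<le> d) \<and> (\<forall>e\<in>set es. 1 \<le> e) \<and>
             al = comp_of_blocks ds es \<and>
             {j. (j, j) \<in> diagram lam} = {1..length ds} \<and>
             (\<forall>j\<in>{1..length ds}.
                arm lam (j, j) = (\<Sum>i=j..length ds. ds ! (i - 1)) - 1 \<and>
                leg lam (j, j) = (\<Sum>i=j..length ds. es ! (i - 1)) - 1))"

definition box_adjacent :: "nat \<times> nat \<Rightarrow> nat \<times> nat \<Rightarrow> bool" where
  "box_adjacent = (\<lambda>(i, j) (i', j').
     (i = i' \<and> (j' = j + 1 \<or> j = j' + 1)) \<or> (j = j' \<and> (i' = i + 1 \<or> i = i' + 1)))"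

definition box_connected :: "(nat \<times> nat) set \<Rightarrow> bool" where
  "box_connected S \<longleftrightarrow>
     (\<forall>b\<in>S. \<forall>c\<in>S. (b, c) \<in> {(x, y). x \<in> S \<and> y \<in> S \<and> box_adjacent x y}\<^sup>*)"

definition ribbon :: "(nat \<times> nat) set \<Rightarrow> bool" where
  "ribbon S \<longleftrightarrow>
     box_connected S \<and> \<not> (\<exists>i j. {(i, j), (i + 1, j), (i, j + 1), (i + 1, j + 1)} \<subseteq> S)"

definition southwest_end :: "(nat \<times> nat) set \<Rightarrow> nat \<times> nat \<Rightarrow> bool" where
  "southwest_end S b \<longleftrightarrow> b \<in> S \<and> (\<forall>c\<in>S. fst c \<le> fst b \<and> snd b \<le> snd c)"

definition northeast_end :: "(nat \<times> nat) set \<Rightarrow> nat \<times> nat \<Rightarrow> bool" where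
  "northeast_end S b \<longleftrightarrow> b \<in> S \<and> (\<forall>c\<in>S. fst b \<le> fst c \<and> snd c \<le> snd b)"

text \<open>
  \<open>\<eta>/\<nu>\<close> is the ribbon with row lengths \<open>\<alpha>\<close> reaching the first column and the first row.
  For empty \<open>\<alpha>\<close> the ribbon has no extreme boxes, and the last clause forces \<open>\<eta> = \<nu> = \<emptyset>\<close>.
\<close>

definition ribbon_shape :: "nat list \<Rightarrow> nat list \<Rightarrow> nat list \<Rightarrow> bool" where
  "ribbon_shape al eta nu \<longleftrightarrow>
     (let S = diagram eta - diagram nu in
        diagram nu \<subseteq> diagram eta \<and>
        ribbon S \<and>
        (\<forall>i\<in>{1..length al}. part_row eta i - part_row nu i = al ! (i - 1)) \<and>
        (al \<noteq> [] \<longrightarrow>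
           (\<exists>b. southwest_end S b \<and> snd b = 1) \<and> (\<exists>b. northeast_end S b \<and> fst b = 1)) \<and>
        {i. part_row eta i \<noteq> 0} = {1..length al})"

definition ribbon_perm :: "nat \<Rightarrow> nat \<Rightarrow> nat \<Rightarrow> nat \<Rightarrow> nat" where
  "ribbon_perm r n l =
     one_line ([1..<r - l + 1] @ rev [r - l + 1..<r + 1] @ [r + 1..<n + 1])"

end

theory Submission
  imports Defs "HOL-Library.Function_Algebras" "Jordan_Normal_Form.Char_Poly"
begin

text \<open>
  A Richardson variety of a ribbon is governed by a chain of intervals \<open>[b_k, c_k]\<close> with
  \<open>c_k = b_(k+1)\<close>: its generic point is spanned by vectors \<open>v_k\<close> with support \<open>[b_k, c_k]\<close>.
  Pulled back by \<open>x\<close>, Gaussian elimination turns the \<open>v_k\<close> into the matrices of the cell of \<open>A\<close>,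
  because \<open>Inv\<^sup>Q(A)\<close> is the edge set of an explicit noncrossing tree: if \<open>(w, u)\<close> is a
  Kreweras-adjacent pair with \<open>u = (i j) w\<close>, the chords from \<open>z\<close> to \<open>w z\<close>, and likewise for \<open>u\<close>,
  do not cross, which leaves only the tree edges. This yields one inclusion of the closures.

  Conversely, every \<open>V\<close> in the Richardson variety has a basis \<open>l_k\<close> supported in \<open>{..c_k}\<close> and
  a basis \<open>u_k\<close> supported in \<open>{b_k..}\<close>, by echelon forms and vanishing minors. Peeling off the last interval,
  \<open>V\<close> is split as a smaller space of the same kind plus a vector supported in that interval; in the
  degenerate case \<open>e_(c_k) \<in> V\<close> this holds only for a curve of spaces through \<open>V\<close>. Polynomials
  vanishing on the chain spaces therefore vanish at \<open>V\<close>.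
\<close>

section \<open>Families of functions, frames and Zariski closures\<close>

text \<open>The Richardson variety is an intersection of two closures: a point comes with an
  approximating family for each closure, and neither family need respect the other flag.
  Irreducibility of the intersection would supply a common generic point; here each point is instead
  reached by explicit one-parameter degenerations whose members satisfy both flag conditions. The
  numbers b_k and c_k are the elements of the subsets of \<nu> and \<eta>. Consecutive rows of a
  ribbon share exactly one column, and for the rows of the ribbon this is the equality c_k =
  b_(k+1). Since \<open>w\<close> reverses the last \<ell>(\<alpha>) of the first \<open>r\<close>
  letters, the intervals correspond to the columns of the cell in reversed order. Only cell matrices
  all of whose free entries are nonzero are mapped into the open cells; closures lose nothing by
  this, because the free entries can be moved along a line. Rank, GL_r and vanishing are handled on
  frames, so every test polynomial is carried along a curve of matrices and not of
  subspaces.\<close>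

definition fscale :: "complex \<Rightarrow> (nat \<Rightarrow> complex) \<Rightarrow> nat \<Rightarrow> complex" where
  "fscale c f = (\<lambda>i. c * f i)"

lemma fscale_apply: "fscale c f i = c * f i"
  by (simp add: fscale_def)

lemma sum_fun_apply [simp]: "sum f A x = (\<Sum>a\<in>A. f a x)"
  for f :: "'a \<Rightarrow> 'b \<Rightarrow> 'c::comm_monoid_add"
  by (induction A rule: infinite_finite_induct) auto

interpretation fs: vector_space fscale
  by unfold_locales (auto simp: fun_eq_iff fscale_apply algebra_simps)

text \<open>The coefficients are indexed by \<open>A\<close> and not by the vectors, so repetitions
  among the \<open>m a\<close> do no harm.\<close>

lemma span_image_iff:
  assumes "finite A"
  shows "y \<in> fs.span (m ` A) \<longleftrightarrow> (\<exists>c. y = (\<Sum>a\<in>A. fscale (c a) (m a)))"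
proof
  assume "y \<in> fs.span (m ` A)"
  then show "\<exists>c. y = (\<Sum>a\<in>A. fscale (c a) (m a))"
  proof (induction rule: fs.span_induct_alt)
    case base
    show ?case by (rule exI[of _ "\<lambda>_. 0"]) (auto simp: fun_eq_iff fscale_apply)
  next
    case (step d v z)
    obtain a where a: "a \<in> A" "v = m a" using step by auto
    obtain c where c: "z = (\<Sum>a\<in>A. fscale (c a) (m a))" using step by (elim exE)
    have "fscale d v + z = (\<Sum>b\<in>A. fscale (if b = a then d else 0) (m b)) + (\<Sum>b\<in>A. fscale (c b) (m b))"
      using a assms by (auto simp: c fun_eq_iff fscale_apply if_distrib[of "\<lambda>x. x * _"] cong: if_cong)
    also have "\<dots> = (\<Sum>b\<in>A. fscale ((if b = a then d else 0) + c b) (m b))"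
      by (auto simp: fun_eq_iff fscale_apply sum.distrib algebra_simps)
    finally show ?case by (intro exI[of _ "\<lambda>b. (if b = a then d else 0) + c b"])
  qed
next
  assume "\<exists>c. y = (\<Sum>a\<in>A. fscale (c a) (m a))"
  then show "y \<in> fs.span (m ` A)"
    by (auto intro!: fs.span_sum fs.span_scale intro: fs.span_base)
qed

text \<open>Vectors are functions on the natural numbers supported in \<open>{1..n}\<close>:
  conditions on coordinate flags become conditions on supports, and a permutation acts by
  composition with its inverse.\<close>

definition supported :: "nat set \<Rightarrow> (nat \<Rightarrow> complex) set" where
  "supported S = {f. \<forall>i. i \<notin> S \<longrightarrow> f i = 0}"

lemma supportedI: "(\<And>i. i \<notin> S \<Longrightarrow> f i = 0) \<Longrightarrow> f \<in> supported S"
  by (simp add: supported_def)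

lemma supportedD: "f \<in> supported S \<Longrightarrow> i \<notin> S \<Longrightarrow> f i = 0"
  by (simp add: supported_def)

lemma supported_mono: "S \<subseteq> T \<Longrightarrow> supported S \<subseteq> supported T"
  by (auto simp: supported_def)

lemma subspace_supported: "fs.subspace (supported S)"
  by (auto simp: fs.subspace_def supported_def fscale_apply)

lemma span_supported: "B \<subseteq> supported S \<Longrightarrow> fs.span B \<subseteq> supported S"
  by (rule fs.span_minimal[OF _ subspace_supported])

section \<open>Vectors and matrices attached to families of functions\<close>

definition fun_vec :: "nat \<Rightarrow> (nat \<Rightarrow> complex) \<Rightarrow> complex vec" where
  "fun_vec n f = vec n (\<lambda>i. f (Suc i))"

definition fam_mat :: "nat \<Rightarrow> nat \<Rightarrow> (nat \<Rightarrow> nat \<Rightarrow> complex) \<Rightarrow> complex mat" where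
  "fam_mat n r y = mat n r (\<lambda>(i, k). y k (Suc i))"

lemma fun_vec_carrier [simp]: "fun_vec n f \<in> carrier_vec n" "dim_vec (fun_vec n f) = n"
  by (simp_all add: fun_vec_def)

lemma fam_mat_carrier [simp]: "fam_mat n r y \<in> carrier_mat n r"
  "dim_row (fam_mat n r y) = n" "dim_col (fam_mat n r y) = r"
  by (simp_all add: fam_mat_def)

lemma fun_vec_inj: "inj_on (fun_vec n) (supported {1..n})"
proof (rule inj_onI)
  fix f g assume fg: "f \<in> supported {1..n}" "g \<in> supported {1..n}" and eq: "fun_vec n f = fun_vec n g"
  show "f = g"
  proof
    fix i
    show "f i = g i"
    proof (cases "i \<in> {1..n}")
      case True
      then have "fun_vec n f $ (i - 1) = fun_vec n g $ (i - 1)" using eq by simp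
      with True show ?thesis by (cases i) (auto simp: fun_vec_def)
    qed (use fg in \<open>simp add: supported_def\<close>)
  qed
qed

lemma colspan_alt:
  assumes "M \<in> carrier_mat n r"
  shows "colspan n M = {M *\<^sub>v x |x. x \<in> carrier_vec r}"
  using assms unfolding vec_space.col_space_eq[OF assms]
  by (auto intro!: mult_mat_vec_carrier)

lemma colspan_fam_mat: "colspan n (fam_mat n r y) = fun_vec n ` fs.span (y ` {..<r})"
proof -
  have mv: "fam_mat n r y *\<^sub>v x = fun_vec n (\<Sum>k<r. fscale (x $ k) (y k))" if "x \<in> carrier_vec r" for x
    using that by (intro eq_vecI)
      (auto simp: fam_mat_def fun_vec_def fscale_apply scalar_prod_def atLeast0LessThan mult.commute intro!: sum.cong)
  show ?thesis unfolding colspan_alt[OF fam_mat_carrier(1)]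
  proof (intro equalityI subsetI)
    fix v assume "v \<in> {fam_mat n r y *\<^sub>v x |x. x \<in> carrier_vec r}"
    then obtain x where "x \<in> carrier_vec r" "v = fun_vec n (\<Sum>k<r. fscale (x $ k) (y k))"
      using mv by auto
    then show "v \<in> fun_vec n ` fs.span (y ` {..<r})"
      using span_image_iff[of "{..<r}"] by blast
  next
    fix v assume "v \<in> fun_vec n ` fs.span (y ` {..<r})"
    then obtain f where f: "v = fun_vec n f" "f \<in> fs.span (y ` {..<r})" by (rule imageE)
    obtain c where "f = (\<Sum>k<r. fscale (c k) (y k))"
      using f(2) unfolding span_image_iff[OF finite_lessThan] by (rule exE)
    with f have "v = fun_vec n (\<Sum>k<r. fscale (c k) (y k))" by simp
    then have "v = fam_mat n r y *\<^sub>v vec r c" by (subst mv) (auto simp: fun_vec_def)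
    then show "v \<in> {fam_mat n r y *\<^sub>v x |x. x \<in> carrier_vec r}" by (auto intro!: exI[of _ "vec r c"])
  qed
qed

section \<open>Frames and the action of GL_r on them\<close>

lemma mult_mat_unit_vec:
  fixes M :: "complex mat"
  assumes "M \<in> carrier_mat n r" and "k < r"
  shows "M *\<^sub>v unit_vec r k = col M k"
  using col_mult2[OF assms(1) one_carrier_mat assms(2)] assms by simp

lemma mult_mat_zero_vec:
  fixes M :: "complex mat"
  assumes "M \<in> carrier_mat n r"
  shows "M *\<^sub>v 0\<^sub>v r = 0\<^sub>v n"
  using assms by (intro eq_vecI) auto

text \<open>The rank is computed from the set of columns, hence the detour through
  \<open>distinct (cols M)\<close>: repeated columns leave fewer than r vectors for an independent
  set, and conversely they give a kernel vector, the difference of two unit vectors.\<close>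

lemma frames_iff_injective:
  "M \<in> frames r n \<longleftrightarrow> M \<in> carrier_mat n r \<and> (\<forall>v\<in>carrier_vec r. M *\<^sub>v v = 0\<^sub>v n \<longrightarrow> v = 0\<^sub>v r)"
proof (cases "M \<in> carrier_mat n r")
  case M: True
  interpret vs: vec_space "TYPE(complex)" n .
  show ?thesis
  proof
    assume "M \<in> frames r n"
    then have rank: "vs.rank M = r" by (simp add: frames_def)
    have "distinct (cols M)"
    proof -
      obtain S where S: "maximal S (\<lambda>T. T \<subseteq> set (cols M) \<and> vs.lin_indpt T)"
        using maximal_exists_superset[of "set (cols M)" "\<lambda>T. T \<subseteq> set (cols M) \<and> vs.lin_indpt T" "{}"]
          vs.finite_lin_indpt2[of "{}"] by auto
      then have "S \<subseteq> set (cols M)" by (simp add: maximal_def)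
      with vs.rank_card_indpt[OF M S] rank have "r \<le> card (set (cols M))"
        using card_mono[of "set (cols M)" S] by simp
      then show ?thesis using M card_length[of "cols M"]
        by (intro card_distinct) auto
    qed
    then have "\<forall>v\<in>carrier_vec r. M *\<^sub>v v = 0\<^sub>v n \<longrightarrow> v = 0\<^sub>v r"
      using vs.lin_depI[OF M] vs.full_rank_lin_indpt[OF M rank] by blast
    with M show "M \<in> carrier_mat n r \<and> (\<forall>v\<in>carrier_vec r. M *\<^sub>v v = 0\<^sub>v n \<longrightarrow> v = 0\<^sub>v r)" by blast
  next
    assume *: "M \<in> carrier_mat n r \<and> (\<forall>v\<in>carrier_vec r. M *\<^sub>v v = 0\<^sub>v n \<longrightarrow> v = 0\<^sub>v r)"
    have dist: "distinct (cols M)"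
    proof (rule ccontr)
      assume "\<not> distinct (cols M)"
      then obtain i j where ij: "i < r" "j < r" "i \<noteq> j" "col M i = col M j"
        using M by (auto simp: distinct_conv_nth)
      have eq: "M *\<^sub>v (unit_vec r i - unit_vec r j) = 0\<^sub>v n"
        using ij M by (subst mult_minus_distrib_mat_vec[OF M]) (auto simp: mult_mat_unit_vec[OF M])
      have "unit_vec r i - unit_vec r j = (0\<^sub>v r :: complex vec)"
        by (rule *[THEN conjunct2, rule_format]) (use eq in auto)
      then have "(unit_vec r i - unit_vec r j) $ i = (0\<^sub>v r :: complex vec) $ i" by simp
      then show False using ij by simp
    qed
    then have "vs.lin_indpt (set (cols M))" using vs.lin_depE[OF M _ dist] * by metis
    then have "vs.rank M = r" using vs.lin_indpt_full_rank[OF M dist] by blast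
    with M show "M \<in> frames r n" by (simp add: frames_def)
  qed
qed (auto simp: frames_def)

text \<open>The rows \<open>j l\<close> form an identity matrix, so coordinate l of a kernel vector
  is read off in row \<open>j l\<close>.\<close>

lemma fam_mat_frame:
  assumes "\<And>k. k < r \<Longrightarrow> j k \<in> {1..n}" and "\<And>k l. k < r \<Longrightarrow> l < r \<Longrightarrow> y k (j l) = (if k = l then 1 else 0)"
  shows "fam_mat n r y \<in> frames r n"
  unfolding frames_iff_injective
proof (intro conjI ballI impI)
  fix v :: "complex vec" assume v: "v \<in> carrier_vec r" and 0: "fam_mat n r y *\<^sub>v v = 0\<^sub>v n"
  show "v = 0\<^sub>v r"
  proof (rule eq_vecI)
    fix l assume "l < dim_vec (0\<^sub>v r :: complex vec)"
    then have l: "l < r" by simp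
    have "0 = (fam_mat n r y *\<^sub>v v) $ (j l - 1)" using 0 assms(1)[OF l] by auto
    also have "\<dots> = (\<Sum>k<r. y k (j l) * v $ k)"
      using assms(1)[OF l] v by (auto simp: fam_mat_def scalar_prod_def atLeast0LessThan intro!: sum.cong)
    also have "\<dots> = (\<Sum>k<r. (if k = l then v $ k else 0))"
      using assms(2) l by (intro sum.cong) auto
    finally show "v $ l = (0\<^sub>v r) $ l" using l by simp
  qed (use v in auto)
qed simp

lemma frames_mult:
  assumes M: "M \<in> frames r n" and g: "g \<in> carrier_mat r r" "det g \<noteq> 0"
  shows "M * g \<in> frames r n" "colspan n (M * g) = colspan n M"
proof -
  have Mc: "M \<in> carrier_mat n r" using M by (simp add: frames_def)
  obtain h where h: "h \<in> carrier_mat r r" "g * h = 1\<^sub>m r" "h * g = 1\<^sub>m r"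
    using det_non_zero_imp_unit[OF g(1)] g(2)
    by (auto simp: Units_def ring_mat_def)
  have Mg: "M * g \<in> carrier_mat n r" using Mc g by simp
  show "M * g \<in> frames r n" unfolding frames_iff_injective
  proof (intro conjI ballI impI Mg)
    fix v :: "complex vec" assume v: "v \<in> carrier_vec r" and "M * g *\<^sub>v v = 0\<^sub>v n"
    then have "M *\<^sub>v (g *\<^sub>v v) = 0\<^sub>v n" using Mc g by (simp add: assoc_mult_mat_vec)
    then have "g *\<^sub>v v = 0\<^sub>v r" using M v g unfolding frames_iff_injective by auto
    then have "h *\<^sub>v (g *\<^sub>v v) = 0\<^sub>v r" using mult_mat_zero_vec[OF h(1)] by simp
    then show "v = 0\<^sub>v r" using h g v by (simp flip: assoc_mult_mat_vec)
  qed
  show "colspan n (M * g) = colspan n M" unfolding colspan_alt[OF Mg] colspan_alt[OF Mc]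
  proof (intro equalityI subsetI)
    fix y assume "y \<in> {M * g *\<^sub>v x |x. x \<in> carrier_vec r}"
    then obtain x where "x \<in> carrier_vec r" "y = M *\<^sub>v (g *\<^sub>v x)"
      using Mc g by (auto simp: assoc_mult_mat_vec)
    then show "y \<in> {M *\<^sub>v x |x. x \<in> carrier_vec r}" using g by auto
  next
    fix y assume "y \<in> {M *\<^sub>v x |x. x \<in> carrier_vec r}"
    then obtain x where x: "x \<in> carrier_vec r" "y = M *\<^sub>v x" by auto
    then have "y = M *\<^sub>v ((g * h) *\<^sub>v x)" using h by simp
    also have "\<dots> = (M * g) *\<^sub>v (h *\<^sub>v x)"
      using assoc_mult_mat_vec[OF g(1) h(1) x(1)] assoc_mult_mat_vec[OF Mc g(1), of "h *\<^sub>v x"] x(1) h(1)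
      by simp
    finally show "y \<in> {M * g *\<^sub>v x |x. x \<in> carrier_vec r}" using h x by auto
  qed
qed

lemma colspan_factor:
  assumes M: "M \<in> carrier_mat n r" and N: "N \<in> carrier_mat n r" and sub: "colspan n N \<subseteq> colspan n M"
  shows "\<exists>g\<in>carrier_mat r r. N = M * g"
proof -
  have "\<exists>x\<in>carrier_vec r. col N k = M *\<^sub>v x" if "k < r" for k
  proof -
    have "col N k = N *\<^sub>v unit_vec r k" using mult_mat_unit_vec[OF N that] by simp
    then have "col N k \<in> colspan n N" unfolding colspan_alt[OF N] by auto
    with sub show ?thesis unfolding colspan_alt[OF M] by auto
  qed
  then obtain x where x: "\<And>k. k < r \<Longrightarrow> x k \<in> carrier_vec r \<and> col N k = M *\<^sub>v x k" by metis
  define g where "g = mat_of_cols r (map x [0..<r])"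
  have g: "g \<in> carrier_mat r r" by (simp add: g_def mat_of_cols_def)
  have "N = M * g"
  proof (rule mat_col_eqI)
    fix k assume "k < dim_col (M * g)"
    then have k: "k < r" using g by simp
    have "col g k = x k" unfolding g_def using k x by (subst col_mat_of_cols) auto
    then show "col N k = col (M * g) k" using k x g M by (subst col_mult2[OF M g]) auto
  qed (use M N g in auto)
  with g show ?thesis by blast
qed

text \<open>Factoring in both directions gives M (g h) = M, and a frame may be cancelled on the left
  because it is injective.\<close>

lemma frames_same_colspan:
  assumes M: "M \<in> frames r n" and N: "N \<in> frames r n" and eq: "colspan n M = colspan n N"
  obtains g where "g \<in> carrier_mat r r" "det g \<noteq> 0" "N = M * g"
proof -
  have Mc: "M \<in> carrier_mat n r" and Nc: "N \<in> carrier_mat n r" using M N by (auto simp: frames_def)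
  obtain g where g: "g \<in> carrier_mat r r" "N = M * g" using colspan_factor[OF Mc Nc] eq by auto
  obtain h where h: "h \<in> carrier_mat r r" "M = N * h" using colspan_factor[OF Nc Mc] eq by auto
  have "g * h = 1\<^sub>m r"
  proof (rule mat_col_eqI)
    fix k assume "k < dim_col (1\<^sub>m r :: complex mat)"
    then have k: "k < r" by simp
    define v where "v = col (g * h) k - col (1\<^sub>m r) k"
    have "v = 0\<^sub>v r"
    proof -
      have "M *\<^sub>v col (g * h) k = col (M * (g * h)) k"
        by (rule col_mult2[OF Mc _ k, symmetric]) (use g(1) h(1) in auto)
      also have "M * (g * h) = M * 1\<^sub>m r" using g h Mc by (metis assoc_mult_mat right_mult_one_mat)
      also have "col \<dots> k = M *\<^sub>v col (1\<^sub>m r) k" using col_mult2[OF Mc _ k, of "1\<^sub>m r"] by simp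
      finally have eq: "M *\<^sub>v col (g * h) k = M *\<^sub>v col (1\<^sub>m r) k" .
      have c: "col (g * h) k \<in> carrier_vec r" "col (1\<^sub>m r) k \<in> carrier_vec r"
        using g(1) h(1) k by (metis col_carrier_vec mult_carrier_mat, metis col_carrier_vec one_carrier_mat)
      have "M *\<^sub>v v = 0\<^sub>v n"
        unfolding v_def mult_minus_distrib_mat_vec[OF Mc c] eq
        by (rule minus_cancel_vec) (rule mult_mat_vec_carrier[OF Mc c(2)])
      moreover have "v \<in> carrier_vec r" unfolding v_def using c by (rule minus_carrier_vec)
      ultimately show ?thesis using M unfolding frames_iff_injective by blast
    qed
    then show "col (g * h) k = col (1\<^sub>m r) k"
      unfolding v_def vec_eq_iff using g(1) h(1) by auto
  qed (use g(1) h(1) in auto)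
  then have "det g * det h = 1" using det_mult[OF g(1) h(1)] by simp
  then have "det g \<noteq> 0" by auto
  with g that show ?thesis by blast
qed

section \<open>Polynomial functions of matrix entries and their restriction to curves\<close>

lemma poly_funs_comp:
  assumes "p \<in> poly_funs r n" and "\<And>i j. i < n \<Longrightarrow> j < r \<Longrightarrow> (\<lambda>M. \<Phi> M $$ (i, j)) \<in> poly_funs r n"
  shows "(\<lambda>M. p (\<Phi> M)) \<in> poly_funs r n"
  using assms(1) by induction (auto intro: poly_funs.intros assms(2))

lemma poly_funs_sum: "(\<And>k. k \<in> K \<Longrightarrow> f k \<in> poly_funs r n) \<Longrightarrow> (\<lambda>M. \<Sum>k\<in>K. f k M) \<in> poly_funs r n"
  by (induction K rule: infinite_finite_induct) (auto intro: poly_funs.intros)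

lemma poly_funs_prod: "(\<And>k. k \<in> K \<Longrightarrow> f k \<in> poly_funs r n) \<Longrightarrow> (\<lambda>M. \<Prod>k\<in>K. f k M) \<in> poly_funs r n"
  by (induction K rule: infinite_finite_induct) (auto intro: poly_funs.intros)

lemma poly_funs_right_mult:
  assumes "p \<in> poly_funs r n" and g: "g \<in> carrier_mat r r"
  obtains p' where "p' \<in> poly_funs r n" "\<And>M. M \<in> carrier_mat n r \<Longrightarrow> p' M = p (M * g)"
proof
  let ?\<Phi> = "\<lambda>M. mat n r (\<lambda>(i, j). \<Sum>k<r. M $$ (i, k) * g $$ (k, j))"
  show "(\<lambda>M. p (?\<Phi> M)) \<in> poly_funs r n"
    by (rule poly_funs_comp[OF assms(1)]) (auto intro!: poly_funs_sum intro: poly_funs.intros)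
  fix M :: "complex mat" assume "M \<in> carrier_mat n r"
  then have "?\<Phi> M = M * g"
    using g by (intro eq_matI) (auto simp: scalar_prod_def atLeast0LessThan)
  then show "p (?\<Phi> M) = p (M * g)" by simp
qed

lemma poly_along_curve:
  assumes "p \<in> poly_funs r n" and "\<And>i j. i < n \<Longrightarrow> j < r \<Longrightarrow> \<exists>P. \<forall>t. \<Phi> t $$ (i, j) = poly P t"
  shows "\<exists>P. \<forall>t. p (\<Phi> t) = poly P t"
  using assms(1)
proof induction
  case (const c)
  show ?case by (rule exI[of _ "[:c:]"]) simp
next
  case (entry i j)
  then show ?case by (rule assms(2))
next
  case (add p q)
  then show ?case by (metis poly_add)
next
  case (mult p q)
  then show ?case by (metis poly_mult)
qed

text \<open>The form in which degenerations are used below: along a curve with polynomial entries p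
  becomes a polynomial in t, and infinitely many zeros make it vanish also at the excluded
  parameters.\<close>

lemma vanishes_along_curve:
  assumes "p \<in> poly_funs r n" and "\<And>i j. i < n \<Longrightarrow> j < r \<Longrightarrow> \<exists>P. \<forall>t. \<Phi> t $$ (i, j) = poly P t"
    and "finite F" and "\<And>t. t \<notin> F \<Longrightarrow> p (\<Phi> t) = 0"
  shows "p (\<Phi> t) = 0"
proof -
  obtain P where P: "\<And>t. p (\<Phi> t) = poly P t" using poly_along_curve[OF assms(1,2)] by blast
  have "P = 0"
  proof (rule ccontr)
    assume "P \<noteq> 0"
    then have "finite {t. poly P t = 0}" by (rule poly_roots_finite)
    moreover have "UNIV = F \<union> {t. poly P t = 0}" using assms(4) P by auto
    ultimately show False using assms(3) infinite_UNIV_char_0[where 'a = complex] by (metis finite_Un)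
  qed
  then show ?thesis by (simp add: P)
qed

section \<open>Zariski closures in the Grassmannian, tested on frames\<close>

abbreviation Gr_closure :: "nat \<Rightarrow> nat \<Rightarrow> complex vec set set \<Rightarrow> complex vec set set" where
  "Gr_closure r n \<equiv> Abstract_Topology.closure_of (Gr_topology r n)"

text \<open>The complement of a neighbourhood missing Y is cut out by polynomials that vanish on all
  frames of Y, hence at M by assumption.\<close>

lemma closure_of_GrI:
  assumes M: "M \<in> frames r n"
    and van: "\<And>p. p \<in> poly_funs r n \<Longrightarrow> (\<And>N. N \<in> frames r n \<Longrightarrow> colspan n N \<in> Y \<Longrightarrow> p N = 0) \<Longrightarrow> p M = 0"
  shows "colspan n M \<in> Gr_closure r n Y"
  unfolding Abstract_Topology.in_closure_of topspace_Gr_topology openin_Gr_topology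
proof (intro conjI allI impI)
  show "colspan n M \<in> Gr r n" using M by (auto simp: Gr_def)
  fix T assume T: "colspan n M \<in> T \<and> Gr_open r n T"
  then obtain E where E: "E \<subseteq> poly_funs r n"
    "\<And>N. N \<in> frames r n \<Longrightarrow> colspan n N \<notin> T \<longleftrightarrow> (\<forall>p\<in>E. p N = 0)"
    unfolding Gr_open_def by auto
  show "\<exists>y. y \<in> Y \<and> y \<in> T"
  proof (rule ccontr)
    assume no: "\<nexists>y. y \<in> Y \<and> y \<in> T"
    have "p M = 0" if "p \<in> E" for p
      by (rule van) (use that E no in auto)
    then show False using E(2)[OF M] T by auto
  qed
qed

text \<open>Whether a single p vanishes depends on the frame and not only on the subspace, so p
  alone does not define an open set. The whole ideal \<open>I\<close> of Y does, because it is
  stable under right multiplication by GL_r.\<close>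

lemma closure_of_GrD:
  assumes V: "V \<in> Gr_closure r n Y"
    and p: "p \<in> poly_funs r n" "\<And>N. N \<in> frames r n \<Longrightarrow> colspan n N \<in> Y \<Longrightarrow> p N = 0"
    and M: "M \<in> frames r n" "colspan n M = V"
  shows "p M = 0"
proof (rule ccontr)
  assume nz: "p M \<noteq> 0"
  define I where "I = {p \<in> poly_funs r n. \<forall>N\<in>frames r n. colspan n N \<in> Y \<longrightarrow> p N = 0}"
  define T where "T = {colspan n N |N. N \<in> frames r n \<and> (\<exists>p\<in>I. p N \<noteq> 0)}"
  have "Gr_open r n T"
  proof (rule Gr_openI)
    show "T \<subseteq> Gr r n" by (auto simp: T_def Gr_def)
    show "I \<subseteq> poly_funs r n" by (auto simp: I_def)
    fix N :: "complex mat" assume N: "N \<in> frames r n"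
    show "colspan n N \<notin> T \<longleftrightarrow> (\<forall>p\<in>I. p N = 0)"
    proof
      assume *: "\<forall>p\<in>I. p N = 0"
      show "colspan n N \<notin> T"
      proof
        assume "colspan n N \<in> T"
        then obtain N' q where N': "N' \<in> frames r n" "colspan n N = colspan n N'" and q: "q \<in> I" "q N' \<noteq> 0"
          by (auto simp: T_def)
        obtain g where g: "g \<in> carrier_mat r r" "det g \<noteq> 0" "N' = N * g"
          using frames_same_colspan[OF N N'(1,2)] by blast
        obtain q' where q': "q' \<in> poly_funs r n" "\<And>M. M \<in> carrier_mat n r \<Longrightarrow> q' M = q (M * g)"
          using poly_funs_right_mult[of q r n g] q g by (auto simp: I_def)
        have "q' \<in> I" unfolding I_def
        proof (intro CollectI conjI ballI impI q'(1))
          fix L assume L: "L \<in> frames r n" "colspan n L \<in> Y"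
          then have "q (L * g) = 0" using frames_mult[OF L(1) g(1,2)] q by (auto simp: I_def)
          then show "q' L = 0" using q'(2) L by (auto simp: frames_def)
        qed
        then have "q' N = 0" using * by blast
        then show False using q'(2)[of N] N g q by (auto simp: frames_def)
      qed
    qed (use N in \<open>auto simp: T_def\<close>)
  qed
  moreover have "V \<in> T" unfolding T_def using M nz p by (auto simp: I_def)
  ultimately obtain y where y: "y \<in> Y" "y \<in> T"
    using V unfolding Abstract_Topology.in_closure_of openin_Gr_topology by blast
  then obtain N q where "N \<in> frames r n" "y = colspan n N" "q \<in> I" "q N \<noteq> 0" by (auto simp: T_def)
  with y show False by (auto simp: I_def)
qed

lemma supported_fam:
  assumes "M \<in> carrier_mat n r"
  obtains y where "M = fam_mat n r y" "\<And>k. y k \<in> supported {1..n}"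
proof
  show "M = fam_mat n r (\<lambda>k i. if i \<in> {1..n} then M $$ (i - 1, k) else 0)"
    using assms by (intro eq_matI) (auto simp: fam_mat_def)
qed (auto simp: supported_def)

section \<open>Spaces squeezed between two flags\<close>

lemma triangular_independent:
  assumes "\<And>k. k \<in> {1..m} \<Longrightarrow> l k \<notin> fs.span (l ` {1..<k})"
  shows "fs.independent (l ` {1..m}) \<and> card (l ` {1..m}) = m"
  using assms
proof (induction m)
  case (Suc m)
  have eq: "l ` {1..Suc m} = insert (l (Suc m)) (l ` {1..m})"
    by (simp add: atLeastAtMostSuc_conv)
  have nin: "l (Suc m) \<notin> fs.span (l ` {1..m})"
    using Suc.prems[of "Suc m"] by (simp add: atLeastLessThanSuc_atLeastAtMost)
  then have "l (Suc m) \<notin> l ` {1..m}" using fs.span_base by blast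
  then show ?case
    using Suc nin unfolding eq by (simp add: fs.independent_insert)
qed (simp add: fs.independent_empty)

text \<open>The modular law: the span of U and e meets \<open>fs.span L\<close> in the span of U
  only, since e lies outside \<open>fs.span L\<close>.\<close>

lemma span_eq_hyperplane:
  assumes "U \<subseteq> fs.span L" and "L \<subseteq> fs.span (insert e U)" and "e \<notin> fs.span L"
  shows "fs.span U = fs.span L"
proof
  show "fs.span U \<subseteq> fs.span L" using assms(1) by (rule fs.span_minimal) simp
  show "fs.span L \<subseteq> fs.span U"
  proof (rule fs.span_minimal)
    show "L \<subseteq> fs.span U"
    proof
      fix y assume y: "y \<in> L"
      then obtain k where k: "y - fscale k e \<in> fs.span U"
        using assms(2) fs.span_breakdown_eq by blast
      with \<open>fs.span U \<subseteq> fs.span L\<close> have "y - fscale k e \<in> fs.span L" by blast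
      then have "fscale k e \<in> fs.span L"
        using fs.span_diff[OF fs.span_base[OF y]] by fastforce
      then have "k = 0"
        using assms(3) fs.span_scale[of "fscale k e" L "1 / k"] by (cases "k = 0") (auto simp: fscale_def)
      with k show "y \<in> fs.span U" by (simp add: fscale_def flip: zero_fun_def)
    qed
  qed simp
qed

lemma span_monoD: "x \<in> fs.span A \<Longrightarrow> A \<subseteq> B \<Longrightarrow> x \<in> fs.span B"
  using fs.span_mono by blast

lemma span_zero_at: "B \<subseteq> {f. f i = 0} \<Longrightarrow> fs.span B \<subseteq> {f. f i = 0}"
  by (rule fs.span_minimal) (auto simp: fscale_apply fs.subspace_def)

definition vanishes_on :: "nat \<Rightarrow> nat \<Rightarrow> (complex mat \<Rightarrow> complex) \<Rightarrow> (nat \<Rightarrow> complex) set \<Rightarrow> bool" where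
  "vanishes_on n r p W \<longleftrightarrow> (\<forall>y. (\<forall>k<r. y k \<in> W) \<longrightarrow> p (fam_mat n r y) = 0)"

lemma vanishes_on_mono: "vanishes_on n r p W \<Longrightarrow> V \<subseteq> W \<Longrightarrow> vanishes_on n r p V"
  unfolding vanishes_on_def by blast

text \<open>Induction on the number m of intervals not yet treated. The vectors \<open>s k\<close>
  with k > m already lie in their intervals; the rest of the space is known only through a spanning
  family \<open>l\<close> adapted to one flag and a spanning family \<open>u\<close> adapted to the
  other.\<close>

lemma vanishes_on_chain:
  fixes b c :: "nat \<Rightarrow> nat" and l u s :: "nat \<Rightarrow> nat \<Rightarrow> complex"
  assumes p: "p \<in> poly_funs r n"
    and chain: "\<And>s. (\<And>k. k \<in> {1..r} \<Longrightarrow> s k \<in> supported {b k..c k}) \<Longrightarrow> vanishes_on n r p (fs.span (s ` {1..r}))"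
    and c_less: "\<And>i j. 1 \<le> i \<Longrightarrow> i < j \<Longrightarrow> j \<le> r \<Longrightarrow> c i < c j"
    and b_le: "\<And>i j. 1 \<le> i \<Longrightarrow> i \<le> j \<Longrightarrow> j \<le> r \<Longrightarrow> b i \<le> b j"
    and cb: "\<And>i. 1 \<le> i \<Longrightarrow> i < r \<Longrightarrow> c i \<le> b (Suc i)"
  shows "m \<le> r \<Longrightarrow> (\<And>k. k \<in> {1..m} \<Longrightarrow> l k \<in> supported {..c k}) \<Longrightarrow>
    (\<And>k. k \<in> {1..m} \<Longrightarrow> u k \<in> supported {b k..}) \<Longrightarrow> fs.span (l ` {1..m}) = fs.span (u ` {1..m}) \<Longrightarrow>
    (\<And>k. k \<in> {1..m} \<Longrightarrow> l k \<notin> fs.span (l ` {1..<k})) \<Longrightarrow>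
    (\<And>k. k \<in> {m<..r} \<Longrightarrow> s k \<in> supported {b k..c k}) \<Longrightarrow>
    vanishes_on n r p (fs.span (l ` {1..m} \<union> s ` {m<..r}))"
proof (induction m arbitrary: l u s)
  case 0
  have "{0<..r} = {1..r}" by auto
  then show ?case using chain[of s] 0 by simp
next
  case (Suc m)
  let ?M = "Suc m"
  note l = Suc.prems(2) and u = Suc.prems(3) and lu = Suc.prems(4) and ind = Suc.prems(5) and s = Suc.prems(6)
  let ?S = "s ` {?M<..r}"
  have upto: "f ` {1..?M} = insert (f ?M) (f ` {1..m})" for f :: "nat \<Rightarrow> nat \<Rightarrow> complex"
    by (simp add: atLeastAtMostSuc_conv)
  have Suc_range: "{m<..r} = insert ?M {?M<..r}" using Suc.prems(1) by auto
  have lV: "l k \<in> fs.span (u ` {1..?M})" if "k \<in> {1..?M}" for k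
    unfolding lu[symmetric] using that by (intro fs.span_base imageI)
  have uV: "u k \<in> fs.span (l ` {1..?M})" if "k \<in> {1..?M}" for k
    unfolding lu using that by (intro fs.span_base imageI)
  have lM: "l ?M \<notin> fs.span (l ` {1..m})"
    using ind[of ?M] by (simp add: atLeastLessThanSuc_atLeastAtMost)
  have "l ` {1..?M} \<subseteq> supported {..c ?M}"
  proof (intro image_subsetI supportedI)
    fix k i assume k: "k \<in> {1..?M}" and i: "i \<notin> {..c ?M}"
    have "c k \<le> c ?M" using c_less[of k ?M] k Suc.prems(1) by (cases "k = ?M") auto
    then show "l k i = 0" using i by (intro supportedD[OF l[OF k]]) auto
  qed
  then have V_supp: "fs.span (l ` {1..?M}) \<subseteq> supported {..c ?M}" by (rule span_supported)
  show ?case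
  proof (cases "u ?M \<in> fs.span (l ` {1..m})")
    \<comment> \<open>Here \<open>u ?M\<close> completes l 1, ..., l m. As an element of the space
      it is also bounded by \<open>c ?M\<close>, so it serves as the new interval vector.
      Subtracting multiples of it from the other \<open>u i\<close> produces a spanning family for l
      1, ..., l m, and the lower bounds survive because b is monotone.\<close>
    case False
    have lM': "l ?M \<in> fs.span (insert (u ?M) (l ` {1..m}))"
      using fs.in_span_insert[OF _ False] uV[of ?M] unfolding upto by simp
    have "\<exists>k. u i - fscale k (u ?M) \<in> fs.span (l ` {1..m})" if "i \<in> {1..m}" for i
    proof -
      have "fs.span (l ` {1..?M}) \<subseteq> fs.span (insert (u ?M) (l ` {1..m}))"
        unfolding upto using lM' by (intro fs.span_minimal) (auto intro: fs.span_base)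
      with uV[of i] that have "u i \<in> fs.span (insert (u ?M) (l ` {1..m}))" by auto
      then show ?thesis by (simp add: fs.span_breakdown_eq)
    qed
    then obtain \<kappa> where \<kappa>: "\<And>i. i \<in> {1..m} \<Longrightarrow> u i - fscale (\<kappa> i) (u ?M) \<in> fs.span (l ` {1..m})" by metis
    define u' where "u' i = u i - fscale (\<kappa> i) (u ?M)" for i
    have span_u': "fs.span (u' ` {1..m}) = fs.span (l ` {1..m})"
    proof (rule span_eq_hyperplane[OF _ _ False])
      show "u' ` {1..m} \<subseteq> fs.span (l ` {1..m})" using \<kappa> by (auto simp: fscale_apply u'_def)
      have "u i \<in> fs.span (insert (u ?M) (u' ` {1..m}))" if "i \<in> {1..?M}" for i
      proof (cases "i = ?M")
        case False
        then have "u' i \<in> fs.span (insert (u ?M) (u' ` {1..m}))" using that by (intro fs.span_base) auto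
        moreover have "fscale (\<kappa> i) (u ?M) \<in> fs.span (insert (u ?M) (u' ` {1..m}))"
          by (intro fs.span_scale fs.span_base) auto
        ultimately have "u' i + fscale (\<kappa> i) (u ?M) \<in> fs.span (insert (u ?M) (u' ` {1..m}))" by (rule fs.span_add)
        then show ?thesis by (simp add: fscale_apply u'_def)
      qed (auto intro: fs.span_base)
      then have "fs.span (u ` {1..?M}) \<subseteq> fs.span (insert (u ?M) (u' ` {1..m}))"
        by (intro fs.span_minimal) auto
      then show "l ` {1..m} \<subseteq> fs.span (insert (u ?M) (u' ` {1..m}))" using lV by fastforce
    qed
    define s' where "s' = s(?M := u ?M)"
    have van: "vanishes_on n r p (fs.span (l ` {1..m} \<union> s' ` {m<..r}))"
    proof (rule Suc.IH[of l u'])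
      show "u' k \<in> supported {b k..}" if "k \<in> {1..m}" for k
      proof (rule supportedI)
        fix i assume "i \<notin> {b k..}"
        with b_le[of k ?M] that Suc.prems(1) have "i < b k" "i < b ?M" by auto
        then show "u' k i = 0" using u[of k] u[of ?M] that by (simp add: fscale_apply u'_def supported_def)
      qed
      show "s' k \<in> supported {b k..c k}" if "k \<in> {m<..r}" for k
      proof (cases "k = ?M")
        case True
        have "u ?M \<in> supported {..c ?M}" using V_supp uV[of ?M] by auto
        then show ?thesis using True u[of ?M] by (auto simp: fscale_apply s'_def supported_def)
      qed (use s[of k] that in \<open>auto simp: s'_def\<close>)
    qed (use Suc.prems(1) l ind span_u' in auto)
    have "s' ` {m<..r} = insert (u ?M) ?S" unfolding Suc_range by (auto simp: s'_def)
    then have "fs.span (l ` {1..?M} \<union> ?S) \<subseteq> fs.span (l ` {1..m} \<union> s' ` {m<..r})"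
      unfolding upto using lM' fs.span_mono[of "insert (u ?M) (l ` {1..m})" "l ` {1..m} \<union> s' ` {m<..r}"]
      by (intro fs.span_minimal) (auto intro: fs.span_base)
    with van show ?thesis by (rule vanishes_on_mono)
  next
    case True
    have uM0: "u ?M \<noteq> 0"
    proof
      assume "u ?M = 0"
      then have "l ` {1..?M} \<subseteq> fs.span (u ` {1..m})" using lV unfolding upto by (auto simp: fs.span_insert_0)
      then have "card (l ` {1..?M}) \<le> card (u ` {1..m})"
        using fs.independent_span_bound[of "u ` {1..m}" "l ` {1..?M}"] triangular_independent[OF ind] by blast
      also have "\<dots> \<le> m" using card_image_le[of "{1..m}" u] by simp
      finally show False using triangular_independent[OF ind] by simp
    qed
    then have m: "1 \<le> m" using True by (cases m) auto
    \<comment> \<open>As a combination of l 1, ..., l m the vector \<open>u ?M\<close> is bounded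
      above by \<open>c m\<close>, and it is bounded below by \<open>b ?M\<close>. Since
      \<open>c m\<close> is at most \<open>b ?M\<close>, a single coordinate remains and the two
      bounds coincide.\<close>
    define c0 where "c0 = c m"
    have below: "c j < c0" if "j \<in> {1..<m}" for j
      using that c_less[of j m] Suc.prems(1) by (auto simp: c0_def)
    have "l ` {1..m} \<subseteq> supported {..c0}"
    proof (intro image_subsetI supportedI)
      fix k i assume k: "k \<in> {1..m}" and i: "i \<notin> {..c0}"
      have "c k \<le> c0" using c_less[of k m] k Suc.prems(1) by (cases "k = m") (auto simp: c0_def)
      then show "l k i = 0" using i k by (intro supportedD[OF l[of k]]) auto
    qed
    then have u_le: "u ?M \<in> supported {..c0}" using True span_supported by blast
    have u_ge: "u ?M \<in> supported {b ?M..}" using u by simp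
    have uM: "u ?M i = 0" if "i \<noteq> c0 \<or> c0 \<noteq> b ?M" for i
    proof -
      have "c0 \<le> b ?M" using cb[of m] m Suc.prems(1) by (simp add: c0_def)
      with that have "i \<notin> {..c0} \<or> i \<notin> {b ?M..}" by auto
      then show ?thesis using supportedD[OF u_le, of i] supportedD[OF u_ge, of i] by blast
    qed
    obtain i0 where i0: "u ?M i0 \<noteq> 0" using uM0 by (auto simp: fun_eq_iff)
    then have bM: "b ?M = c0" and uM_c0: "u ?M c0 \<noteq> 0" using uM by metis+
    have uM': "u ?M i = 0" if "i \<noteq> c0" for i using uM that by blast
    \<comment> \<open>Here \<open>u (Suc m)\<close> is a multiple of the unit vector \<open>e\<close>. Writing the space as the span of \<open>L0\<close>, \<open>e\<close>
      and \<open>z = z' + z''\<close>, split at \<open>c0\<close>, it is the limit \<open>\<sigma> \<rightarrow> \<infinity>\<close> of the spans of \<open>L0\<close>,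
      \<open>z' + \<sigma> e\<close> and \<open>z'' - \<sigma> e\<close>, to which the induction hypothesis applies.\<close>
    define e where "e = (\<lambda>i. if i = c0 then 1 else 0 :: complex)"
    have e_uM: "e = fscale (1 / u ?M c0) (u ?M)" "u ?M = fscale (u ?M c0) e"
      using uM' uM_c0 by (auto simp: e_def fun_eq_iff fscale_apply)
    have e_span: "e \<in> fs.span (l ` {1..m})" using True by (subst e_uM(1)) (rule fs.span_scale)
    define L0 where "L0 = l ` {1..<m}"
    have l_m: "l ` {1..m} = insert (l m) L0" using m unfolding L0_def by (auto simp: le_less)
    have L0_supp: "fs.span L0 \<subseteq> supported {..<c0}"
    proof (intro span_supported, unfold L0_def, intro image_subsetI supportedI)
      fix k i assume k: "k \<in> {1..<m}" and i: "i \<notin> {..<c0}"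
      then show "l k i = 0" using below[OF k] by (intro supportedD[OF l[of k]]) auto
    qed
    have L0_c0: "f c0 = 0" if "f \<in> fs.span L0" for f
      using supportedD[of f "{..<c0}" c0] L0_supp that by auto
    have e_L0: "e \<notin> fs.span L0" using L0_c0[of e] by (auto simp: e_def)
    have lm: "l m \<in> fs.span (insert e L0)" using fs.in_span_insert[OF _ e_L0] e_span l_m by simp
    then obtain \<eta> where \<eta>: "l m - fscale \<eta> e \<in> fs.span L0" by (auto simp: fs.span_breakdown_eq)
    have lm_c0: "l m c0 \<noteq> 0"
    proof
      assume 0: "l m c0 = 0"
      have "(l m - fscale \<eta> e) c0 = 0" using \<eta> by (rule L0_c0)
      then have "\<eta> = 0" using 0 by (simp add: fscale_apply e_def)
      then have "l m \<in> fs.span L0" using \<eta> by (simp add: fscale_def flip: zero_fun_def)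
      then have "fs.span (l ` {1..m}) = fs.span L0" unfolding l_m by (simp add: fs.span_redundant)
      then show False using e_span e_L0 by simp
    qed
    \<comment> \<open>Modulo \<open>L0\<close> the vector \<open>l m\<close> is a nonzero multiple
      of e. It can therefore be used to clear coordinate c0 of \<open>l ?M\<close> inside the space,
      after which z falls into a part below c0 and a part above.\<close>
    define z where "z = l ?M - fscale (l ?M c0 / l m c0) (l m)"
    have z_c0: "z c0 = 0" using lm_c0 by (simp add: fscale_apply z_def)
    have z_L0: "z \<notin> fs.span L0"
    proof
      assume "z \<in> fs.span L0"
      then have "z \<in> fs.span (l ` {1..m})" unfolding l_m using fs.span_mono[of L0 "insert (l m) L0"] by auto
      moreover have "fscale (l ?M c0 / l m c0) (l m) \<in> fs.span (l ` {1..m})"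
        unfolding l_m by (intro fs.span_scale fs.span_base) simp
      ultimately have "z + fscale (l ?M c0 / l m c0) (l m) \<in> fs.span (l ` {1..m})" by (rule fs.span_add)
      then show False using lM by (simp add: fscale_apply z_def)
    qed
    let ?L = "insert z L0"
    have V: "fs.span (l ` {1..?M}) = fs.span (insert e ?L)"
    proof
      have "l m \<in> fs.span (insert e ?L)" using lm fs.span_mono[of "insert e L0" "insert e ?L"] by auto
      moreover from this have "z + fscale (l ?M c0 / l m c0) (l m) \<in> fs.span (insert e ?L)"
        by (intro fs.span_add fs.span_scale) (auto intro: fs.span_base)
      then have "l ?M \<in> fs.span (insert e ?L)" by (simp add: fscale_apply z_def)
      ultimately show "fs.span (l ` {1..?M}) \<subseteq> fs.span (insert e ?L)"
        unfolding upto l_m by (intro fs.span_minimal) (auto intro: fs.span_base)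
      have "e \<in> fs.span (l ` {1..?M})" by (rule span_monoD[OF e_span]) auto
      moreover have "z \<in> fs.span (l ` {1..?M})" unfolding z_def
        using m by (intro fs.span_diff fs.span_scale) (auto intro: fs.span_base)
      ultimately show "fs.span (insert e ?L) \<subseteq> fs.span (l ` {1..?M})"
        using m by (intro fs.span_minimal) (auto simp: L0_def intro: fs.span_base)
    qed
    have L_c0: "fs.span ?L \<subseteq> {f. f c0 = 0}"
      using z_c0 L0_supp fs.span_superset[of L0] by (intro span_zero_at) (auto simp: supported_def)
    have e_L: "e \<notin> fs.span ?L" using L_c0 by (auto simp: fscale_apply e_def)
    \<comment> \<open>The hyperplane of the space on which coordinate c0 vanishes is spanned by z
      and \<open>L0\<close>, and equally by the \<open>u i\<close> with that coordinate
      removed.\<close>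
    define u' where "u' i = u i - fscale (u i c0) e" for i
    have u'_L: "u' i \<in> fs.span ?L" if "i \<in> {1..m}" for i
    proof -
      have "u i \<in> fs.span (insert e ?L)" using uV[of i] that V by auto
      then obtain k where k: "u i - fscale k e \<in> fs.span ?L" by (auto simp: fs.span_breakdown_eq)
      then have "(u i - fscale k e) c0 = 0" using L_c0 by blast
      then have "k = u i c0" by (simp add: fscale_apply e_def)
      with k show ?thesis by (simp add: fscale_apply u'_def)
    qed
    have span_u': "fs.span (u' ` {1..m}) = fs.span ?L"
    proof (rule span_eq_hyperplane[OF _ _ e_L])
      show "u' ` {1..m} \<subseteq> fs.span ?L" using u'_L by auto
      let ?W = "fs.span (insert e (u' ` {1..m}))"
      have eW: "fscale k e \<in> ?W" for k by (intro fs.span_scale fs.span_base) simp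
      have "u i \<in> ?W" if "i \<in> {1..?M}" for i
      proof (cases "i = ?M")
        case False
        then have "u' i \<in> ?W" using that by (intro fs.span_base) auto
        then have "u' i + fscale (u i c0) e \<in> ?W" using eW by (rule fs.span_add)
        then show ?thesis by (simp add: fscale_apply u'_def)
      qed (use eW e_uM(2) in metis)
      then have "fs.span (u ` {1..?M}) \<subseteq> ?W" by (intro fs.span_minimal) auto
      moreover have "?L \<subseteq> fs.span (u ` {1..?M})" using V lu fs.span_superset[of "insert e ?L"] by auto
      ultimately show "?L \<subseteq> ?W" by auto
    qed
    have "\<exists>k. u' i - fscale k z \<in> fs.span L0" if "i \<in> {1..m}" for i
      using u'_L[OF that] by (simp add: fs.span_breakdown_eq)
    then obtain \<kappa> where \<kappa>: "\<And>i. i \<in> {1..m} \<Longrightarrow> u' i - fscale (\<kappa> i) z \<in> fs.span L0" by metis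
    define trunc where "trunc f = (\<lambda>i. if i < c0 then f i else 0)" for f :: "nat \<Rightarrow> complex"
    have trunc_L0: "trunc f = f" if "f \<in> fs.span L0" for f
      using that L0_supp by (auto simp: trunc_def supported_def fun_eq_iff fscale_apply)
    define z2 where "z2 = z - trunc z"
    have step: "vanishes_on n r p (fs.span (insert (trunc z + fscale \<sigma> e) (insert (z2 - fscale \<sigma> e) (L0 \<union> ?S))))"
      if \<sigma>: "\<sigma> \<noteq> 0" for \<sigma>
    proof -
      define z1 where "z1 = trunc z + fscale \<sigma> e"
      define l' where "l' = l(m := z1)"
      define s' where "s' = s(?M := z2 - fscale \<sigma> e)"
      \<comment> \<open>The linear map that fixes \<open>L0\<close> and sends z to z1 truncates a
        vector at c0 and adds \<sigma> times its z-coefficient times e. Applied to the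
        \<open>u' i\<close> it keeps the lower bounds \<open>b i\<close>, because c0 equals
        \<open>b ?M\<close> and b is monotone.\<close>
      define u'' where "u'' i = trunc (u' i) + fscale (\<sigma> * \<kappa> i) e" for i
      have l'_im: "l' ` {1..m} = insert z1 L0" using m unfolding L0_def by (auto simp: l'_def le_less image_iff)
      have comb: "(\<Sum>i\<in>{1..m}. fscale (a i) (u'' i)) = trunc y + fscale (\<sigma> * (\<Sum>i\<in>{1..m}. a i * \<kappa> i)) e"
        "y - fscale (\<Sum>i\<in>{1..m}. a i * \<kappa> i) z \<in> fs.span L0"
        if "y = (\<Sum>i\<in>{1..m}. fscale (a i) (u' i))" for a y
      proof -
        show "(\<Sum>i\<in>{1..m}. fscale (a i) (u'' i)) = trunc y + fscale (\<sigma> * (\<Sum>i\<in>{1..m}. a i * \<kappa> i)) e"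
          unfolding that by (auto simp: fun_eq_iff fscale_apply u''_def trunc_def sum.distrib sum_distrib_left sum_distrib_right algebra_simps)
        have "y - fscale (\<Sum>i\<in>{1..m}. a i * \<kappa> i) z = (\<Sum>i\<in>{1..m}. fscale (a i) (u' i - fscale (\<kappa> i) z))"
          unfolding that by (auto simp: fun_eq_iff fscale_apply sum_subtractf sum_distrib_left sum_distrib_right algebra_simps)
        then show "y - fscale (\<Sum>i\<in>{1..m}. a i * \<kappa> i) z \<in> fs.span L0"
          using \<kappa> by (auto intro!: fs.span_sum fs.span_scale)
      qed
      have u''_span: "trunc y + fscale (\<sigma> * k) e \<in> fs.span (u'' ` {1..m})"
        if "y \<in> fs.span ?L" "y - fscale k z \<in> fs.span L0" for y k
      proof -
        obtain a where a: "y = (\<Sum>i\<in>{1..m}. fscale (a i) (u' i))"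
          using \<open>y \<in> fs.span ?L\<close> span_image_iff[of "{1..m}" y u'] unfolding span_u' by auto
        define k' where "k' = (\<Sum>i\<in>{1..m}. a i * \<kappa> i)"
        \<comment> \<open>The z-coefficient modulo \<open>L0\<close> is unique, as z is not in the
          span of \<open>L0\<close>; so the given k agrees with the one computed from the
          \<open>\<kappa> i\<close>.\<close>
        have "(y - fscale k z) - (y - fscale k' z) \<in> fs.span L0"
          by (rule fs.span_diff[OF that(2) comb(2)[OF a, folded k'_def]])
        moreover have "(y - fscale k z) - (y - fscale k' z) = fscale (k' - k) z" by (auto simp: fun_eq_iff fscale_apply algebra_simps)
        ultimately have "k' = k"
          using z_L0 fs.span_scale[of "fscale (k' - k) z" L0 "1 / (k' - k)"] by (cases "k' = k") (auto simp: fscale_def)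
        then show ?thesis using comb(1)[OF a, folded k'_def, symmetric]
          by (auto intro!: fs.span_sum fs.span_scale intro: fs.span_base)
      qed
      have spans: "fs.span (l' ` {1..m}) = fs.span (u'' ` {1..m})" unfolding l'_im
      proof
        have "u'' i \<in> fs.span (insert z1 L0)" if "i \<in> {1..m}" for i
        proof -
          have "u'' i = trunc (u' i - fscale (\<kappa> i) z) + fscale (\<kappa> i) z1"
            by (auto simp: fun_eq_iff fscale_apply u''_def z1_def trunc_def algebra_simps)
          then have "u'' i = (u' i - fscale (\<kappa> i) z) + fscale (\<kappa> i) z1" by (simp only: trunc_L0[OF \<kappa>[OF that]])
          moreover have "u' i - fscale (\<kappa> i) z \<in> fs.span (insert z1 L0)"
            using \<kappa>[OF that] fs.span_mono[of L0 "insert z1 L0"] by blast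
          ultimately show ?thesis by (auto intro!: fs.span_add fs.span_scale intro: fs.span_base)
        qed
        then show "fs.span (u'' ` {1..m}) \<subseteq> fs.span (insert z1 L0)" by (intro fs.span_minimal) auto
        have "y \<in> fs.span (u'' ` {1..m})" if "y \<in> L0" for y
          using u''_span[of y 0] trunc_L0[of y] fs.span_base[of y L0] fs.span_base[of y ?L] that
          by (simp add: fscale_def flip: zero_fun_def)
        moreover have "z1 \<in> fs.span (u'' ` {1..m})"
          using u''_span[of z 1] fs.span_base[of z ?L] fs.span_zero by (simp add: z1_def fscale_def)
        ultimately show "fs.span (insert z1 L0) \<subseteq> fs.span (u'' ` {1..m})" by (intro fs.span_minimal) auto
      qed
      have "vanishes_on n r p (fs.span (l' ` {1..m} \<union> s' ` {m<..r}))"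
      proof (rule Suc.IH[OF _ _ _ spans])
        show "l' k \<in> supported {..c k}" if "k \<in> {1..m}" for k
          using that l[of k] by (auto simp: fscale_apply l'_def z1_def trunc_def e_def supported_def c0_def)
        show "u'' k \<in> supported {b k..}" if "k \<in> {1..m}" for k
          using that u[of k] b_le[of k ?M] Suc.prems(1) bM
          by (auto simp: fscale_apply u''_def trunc_def u'_def e_def supported_def)
        show "l' k \<notin> fs.span (l' ` {1..<k})" if k: "k \<in> {1..m}" for k
        proof (cases "k = m")
          case True
          have "l' ` {1..<m} = L0" by (auto simp: L0_def l'_def)
          moreover have "z1 c0 \<noteq> 0" using \<sigma> by (simp add: fscale_apply z1_def trunc_def e_def)
          then have "z1 \<notin> fs.span L0" using L0_c0 by blast
          ultimately show ?thesis using True by (simp add: l'_def)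
        next
          case False
          then have "l' ` {1..<k} = l ` {1..<k}" "l' k = l k" using k by (auto simp: l'_def)
          then show ?thesis using ind[of k] k by simp
        qed
        show "s' k \<in> supported {b k..c k}" if "k \<in> {m<..r}" for k
        proof (cases "k = ?M")
          case True
          have "z \<in> supported {..c ?M}"
            using V_supp fs.span_base[of z "insert e ?L"] unfolding V by auto
          moreover have "c0 \<le> c ?M" using c_less[of m ?M] m Suc.prems(1) by (simp add: c0_def)
          ultimately show ?thesis using True bM z_c0
            by (auto simp: fscale_apply s'_def z2_def trunc_def e_def supported_def)
        qed (use s[of k] that in \<open>auto simp: s'_def\<close>)
      qed (use Suc.prems(1) in auto)
      moreover have "l' ` {1..m} \<union> s' ` {m<..r} = insert z1 (insert (z2 - fscale \<sigma> e) (L0 \<union> ?S))"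
        unfolding l'_im Suc_range by (auto simp: s'_def)
      ultimately show ?thesis by (simp add: fscale_apply z1_def)
    qed
    have "vanishes_on n r p (fs.span (insert e (insert z (L0 \<union> ?S))))"
      unfolding vanishes_on_def
    proof (intro allI impI)
      fix y assume y: "\<forall>k<r. y k \<in> fs.span (insert e (insert z (L0 \<union> ?S)))"
      have "\<exists>\<alpha> \<beta>. y k - fscale \<alpha> e - fscale \<beta> z \<in> fs.span (L0 \<union> ?S)" if "k < r" for k
        using y that by (simp add: fs.span_breakdown_eq)
      then obtain \<alpha> \<beta> where \<alpha>\<beta>: "\<And>k. k < r \<Longrightarrow> y k - fscale (\<alpha> k) e - fscale (\<beta> k) z \<in> fs.span (L0 \<union> ?S)" by metis
      \<comment> \<open>With \<sigma> = 1 / t, the vector e is t z1 minus t times the truncation of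
        z. Adding this error term to \<open>y k\<close> moves it into the deformed span; the term
        disappears at t = 0. The vector z needs no correction, being the sum of the two deformed
        vectors.\<close>
      define Y where "Y t k = y k + fscale (t * \<alpha> k) (trunc z)" for t k
      have "p (fam_mat n r (Y 0)) = 0"
      proof (rule vanishes_along_curve[OF p, of "\<lambda>t. fam_mat n r (Y t)" "{0}"])
        show "\<exists>P. \<forall>t. fam_mat n r (Y t) $$ (i, j) = poly P t" if "i < n" "j < r" for i j
          using that by (intro exI[of _ "[:y j (Suc i), \<alpha> j * trunc z (Suc i):]"]) (auto simp: fscale_apply fam_mat_def Y_def)
        show "p (fam_mat n r (Y t)) = 0" if "t \<notin> {0}" for t
        proof -
          let ?z1 = "trunc z + fscale (1 / t) e" and ?s = "z2 - fscale (1 / t) e"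
          let ?W = "fs.span (insert ?z1 (insert ?s (L0 \<union> ?S)))"
          have "Y t k \<in> ?W" if "k < r" for k
          proof -
            have "y k - fscale (\<alpha> k) e - fscale (\<beta> k) z \<in> ?W"
              using \<alpha>\<beta>[OF that] fs.span_mono[of "L0 \<union> ?S" "insert ?z1 (insert ?s (L0 \<union> ?S))"] by blast
            moreover have "fscale (t * \<alpha> k) ?z1 \<in> ?W" "fscale (\<beta> k) ?z1 \<in> ?W" "fscale (\<beta> k) ?s \<in> ?W"
              by (auto intro!: fs.span_scale intro: fs.span_base)
            ultimately have "(y k - fscale (\<alpha> k) e - fscale (\<beta> k) z) + (fscale (t * \<alpha> k) ?z1
                + (fscale (\<beta> k) ?z1 + fscale (\<beta> k) ?s)) \<in> ?W"
              by (intro fs.span_add)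
            moreover have "(y k - fscale (\<alpha> k) e - fscale (\<beta> k) z) + (fscale (t * \<alpha> k) ?z1
                + (fscale (\<beta> k) ?z1 + fscale (\<beta> k) ?s)) = Y t k"
              using \<open>t \<notin> {0}\<close> by (auto simp: fun_eq_iff fscale_apply Y_def z2_def field_simps)
            ultimately show ?thesis by simp
          qed
          then show ?thesis using step[of "1 / t"] that unfolding vanishes_on_def by simp
        qed
      qed simp
      moreover have "Y 0 = y" by (auto simp: Y_def fun_eq_iff fscale_apply)
      ultimately show "p (fam_mat n r y) = 0" by simp
    qed
    moreover have "fs.span (l ` {1..?M} \<union> ?S) \<subseteq> fs.span (insert e (insert z (L0 \<union> ?S)))"
    proof (rule fs.span_minimal)
      have "l ` {1..?M} \<subseteq> fs.span (insert e (insert z L0))" using V fs.span_superset by blast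
      also have "\<dots> \<subseteq> fs.span (insert e (insert z (L0 \<union> ?S)))" by (rule fs.span_mono) auto
      finally show "l ` {1..?M} \<union> ?S \<subseteq> fs.span (insert e (insert z (L0 \<union> ?S)))"
        by (auto intro: fs.span_base)
    qed simp
    ultimately show ?thesis by (rule vanishes_on_mono)
  qed
qed

section \<open>Echelon bases and minors\<close>

lemma independent_family:
  assumes A: "finite A"
    and z: "\<And>c. (\<Sum>a\<in>A. fscale (c a) (m a)) = 0 \<Longrightarrow> \<forall>a\<in>A. c a = 0"
  shows "fs.independent (m ` A)" and "inj_on m A"
proof -
  show inj: "inj_on m A"
  proof (rule inj_onI, rule ccontr)
    fix a b assume ab: "a \<in> A" "b \<in> A" "m a = m b" "a \<noteq> b"
    define c where "c x = (if x = a then 1 else 0) - (if x = b then 1 else 0 :: complex)" for x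
    have "(\<Sum>x\<in>A. fscale (c x) (m x)) = (\<Sum>x\<in>A. if x = a then m a else 0) - (\<Sum>x\<in>A. if x = b then m b else 0)"
      by (auto simp: c_def fun_eq_iff fscale_apply simp flip: sum_subtractf intro!: sum.cong)
    also have "\<dots> = 0" using ab A by simp
    finally have "\<forall>a\<in>A. c a = 0" by (rule z)
    with ab show False by (auto simp: c_def)
  qed
  show "fs.independent (m ` A)"
  proof
    assume "fs.dependent (m ` A)"
    then obtain u v where u: "v \<in> m ` A" "u v \<noteq> 0" "(\<Sum>v\<in>m ` A. fscale (u v) v) = 0"
      using A by (auto simp: fs.dependent_finite)
    have "(\<Sum>a\<in>A. fscale (u (m a)) (m a)) = 0"
      using u(3) by (simp add: sum.reindex[OF inj])
    from z[OF this] u(1,2) show False by auto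
  qed
qed

lemma independent_dual:
  assumes "finite J" and "\<And>a b. a \<in> J \<Longrightarrow> b \<in> J \<Longrightarrow> f a b = (if a = b then 1 else 0)"
  shows "fs.independent (f ` J)" and "inj_on f J"
proof -
  have *: "\<forall>a\<in>J. c a = 0" if "(\<Sum>a\<in>J. fscale (c a) (f a)) = 0" for c
  proof
    fix b assume b: "b \<in> J"
    have "0 = (\<Sum>a\<in>J. fscale (c a) (f a)) b" using that by simp
    also have "\<dots> = (\<Sum>a\<in>J. if a = b then c a else 0)"
      using assms(2)[OF _ b] by (auto simp: fscale_apply intro!: sum.cong)
    finally show "c b = 0" using assms(1) b by simp
  qed
  show "fs.independent (f ` J)" and "inj_on f J"
    using independent_family[OF assms(1), of f] * by blast+
qed

text \<open>Reduced echelon form with respect to an arbitrary ranking of the coordinates.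
  Coordinates are added by increasing key, and x becomes a pivot exactly if some vector of W
  supported in the coordinates so far is nonzero at x. The key \<open>int\<close> places pivots at
  largest indices and its negative at smallest ones, which serves both flags.\<close>

lemma echelon_basis:
  fixes key :: "nat \<Rightarrow> int"
  assumes "finite S" and "fs.subspace W" and "W \<subseteq> supported S"
  shows "\<exists>J f. J \<subseteq> S \<and> (\<forall>a\<in>J. f a \<in> W \<and> (\<forall>i. key a < key i \<longrightarrow> f a i = 0) \<and>
    (\<forall>b\<in>J. f a b = (if a = b then 1 else 0))) \<and> fs.span (f ` J) = W"
  using assms
proof (induction S arbitrary: W rule: finite_ranking_induct[where f = key])
  case empty
  then have "W = {0}" using fs.subspace_0 by (auto simp: supported_def fun_eq_iff)
  then show ?case by (intro exI[of _ "{}"]) simp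
next
  case (insert x S)
  define W0 where "W0 = W \<inter> supported S"
  have sub0: "fs.subspace W0" unfolding W0_def
    using insert.prems(1) subspace_supported by (rule fs.subspace_inter)
  obtain J f where J: "J \<subseteq> S" and f: "\<And>a. a \<in> J \<Longrightarrow> f a \<in> W0"
      "\<And>a i. a \<in> J \<Longrightarrow> key a < key i \<Longrightarrow> f a i = 0"
      "\<And>a b. a \<in> J \<Longrightarrow> b \<in> J \<Longrightarrow> f a b = (if a = b then 1 else 0)" "fs.span (f ` J) = W0"
  proof -
    have "W0 \<subseteq> supported S" by (simp add: W0_def)
    from insert.IH[OF sub0 this] show ?thesis using that by (elim exE conjE) blast
  qed
  show ?case
  proof (cases "W = W0")
    case True
    show ?thesis using J f True by (intro exI[of _ J] exI[of _ f]) auto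
  next
    case False
    then obtain w where w: "w \<in> W" "w \<notin> supported S" by (auto simp: W0_def)
    have wx: "w x \<noteq> 0" and xS: "x \<notin> S"
      using w insert.prems(2) unfolding supported_def by force+
    have finJ: "finite J" using J insert.hyps finite_subset by blast
    have fx: "f a x = 0" if "a \<in> J" for a using f(1)[OF that] xS by (auto simp: W0_def supported_def)
    define g where "g = fscale (1 / w x) w"
    \<comment> \<open>The new vector is cleared at the old pivots; the old vectors vanish at x, so
      its value 1 at x is kept.\<close>
    define h where "h = g - (\<Sum>a\<in>J. fscale (g a) (f a))"
    have gW: "g \<in> W" unfolding g_def using insert.prems(1) w by (intro fs.subspace_scale)
    have hW: "h \<in> W" unfolding h_def using insert.prems(1) gW f(1)
      by (intro fs.subspace_diff fs.subspace_sum fs.subspace_scale) (auto simp: W0_def)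
    have hx: "h x = 1" using wx fx by (simp add: h_def g_def fscale_apply)
    have hJ: "h b = 0" if "b \<in> J" for b
    proof -
      have "(\<Sum>a\<in>J. g a * f a b) = (\<Sum>a\<in>J. if a = b then g a else 0)"
        using f(3)[OF _ that] by (intro sum.cong) auto
      then show ?thesis using finJ that by (simp add: h_def fscale_apply)
    qed
    define f' where "f' = f(x := h)"
    have xJ: "x \<notin> J" using J xS by auto
    show ?thesis
    proof (intro exI[of _ "insert x J"] exI[of _ f'] conjI ballI allI impI)
      show "insert x J \<subseteq> insert x S" using J by auto
      show "f' a \<in> W" if "a \<in> insert x J" for a
        using that hW f(1) by (auto simp: f'_def W0_def)
      show "f' a i = 0" if "a \<in> insert x J" "key a < key i" for a i
      proof (cases "a = x")
        case True
        have "i \<notin> insert x S" using insert.hyps(2)[of i] that(2) True by auto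
        then show ?thesis using hW insert.prems(2) True by (auto simp: f'_def supported_def)
      qed (use that f(2) in \<open>auto simp: f'_def\<close>)
      show "f' a b = (if a = b then 1 else 0)" if "a \<in> insert x J" "b \<in> insert x J" for a b
        using that hx hJ fx f(3) xJ by (auto simp: f'_def)
      have im: "f' ` insert x J = insert h (f ` J)" using xJ by (auto simp: f'_def)
      show "fs.span (f' ` insert x J) = W" unfolding im
      proof
        show "fs.span (insert h (f ` J)) \<subseteq> W"
          using hW f(1) insert.prems(1) by (intro fs.span_minimal) (auto simp: W0_def)
        show "W \<subseteq> fs.span (insert h (f ` J))"
        proof
          fix v assume v: "v \<in> W"
          have "v - fscale (v x) h \<in> W" using v hW insert.prems(1)
            by (intro fs.subspace_diff fs.subspace_scale)
          moreover have "v - fscale (v x) h \<in> supported S"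
          proof (rule supportedI)
            fix i assume "i \<notin> S"
            show "(v - fscale (v x) h) i = 0"
            proof (cases "i = x")
              case False
              with \<open>i \<notin> S\<close> have "v i = 0" "h i = 0"
                using insert.prems(2) v hW supportedD[of _ "insert x S" i] by auto
              then show ?thesis by (simp add: fscale_apply)
            qed (use hx in \<open>simp add: fscale_apply\<close>)
          qed
          ultimately show "v \<in> fs.span (insert h (f ` J))"
            unfolding fs.span_breakdown_eq f(4) W0_def by blast
        qed
      qed
    qed
  qed
qed

text \<open>The columns of a frame are independent, so the number of pivots is r.\<close>

lemma frame_echelon:
  fixes key :: "nat \<Rightarrow> int"
  assumes F: "fam_mat n r y \<in> frames r n" and y: "\<And>k. y k \<in> supported {1..n}"
  obtains J f where "J \<in> rsubsets r n" "fs.span (f ` J) = fs.span (y ` {..<r})"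
    "\<And>a. a \<in> J \<Longrightarrow> f a \<in> supported {1..n}" "\<And>a i. a \<in> J \<Longrightarrow> key a < key i \<Longrightarrow> f a i = 0"
    "\<And>a b. a \<in> J \<Longrightarrow> b \<in> J \<Longrightarrow> f a b = (if a = b then 1 else 0)"
proof -
  let ?W = "fs.span (y ` {..<r})"
  have W: "?W \<subseteq> supported {1..n}" using y by (intro span_supported) auto
  have ex: "\<exists>J f. J \<subseteq> {1..n} \<and> (\<forall>a\<in>J. f a \<in> ?W \<and> (\<forall>i. key a < key i \<longrightarrow> f a i = 0) \<and>
    (\<forall>b\<in>J. f a b = (if a = b then 1 else 0))) \<and> fs.span (f ` J) = ?W"
    by (rule echelon_basis[OF _ _ W]) auto
  then obtain J f where J: "J \<subseteq> {1..n}" and f: "\<And>a. a \<in> J \<Longrightarrow> f a \<in> ?W"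
      "\<And>a i. a \<in> J \<Longrightarrow> key a < key i \<Longrightarrow> f a i = 0"
      "\<And>a b. a \<in> J \<Longrightarrow> b \<in> J \<Longrightarrow> f a b = (if a = b then 1 else 0)" "fs.span (f ` J) = ?W"
    by metis
  have finJ: "finite J" using J finite_subset by blast
  have "\<forall>k\<in>{..<r}. c k = 0" if c: "(\<Sum>k\<in>{..<r}. fscale (c k) (y k)) = 0" for c
  proof
    fix k assume k: "k \<in> {..<r}"
    have "fam_mat n r y *\<^sub>v vec r c = 0\<^sub>v n"
    proof (rule eq_vecI)
      fix i assume "i < dim_vec (0\<^sub>v n :: complex vec)"
      then have "(fam_mat n r y *\<^sub>v vec r c) $ i = (\<Sum>k<r. fscale (c k) (y k)) (Suc i)"
        by (auto simp: fam_mat_def scalar_prod_def atLeast0LessThan fscale_apply mult.commute intro!: sum.cong)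
      then show "(fam_mat n r y *\<^sub>v vec r c) $ i = 0\<^sub>v n $ i"
        using c \<open>i < dim_vec (0\<^sub>v n)\<close> by simp
    qed simp
    then have "vec r c = 0\<^sub>v r" using F unfolding frames_iff_injective by auto
    then have "vec r c $ k = 0\<^sub>v r $ k" by simp
    then show "c k = 0" using k by simp
  qed
  note indy = independent_family[OF finite_lessThan this]
  note indf = independent_dual[OF finJ f(3)]
  have "card (f ` J) \<le> card (y ` {..<r})"
    using fs.independent_span_bound[of "y ` {..<r}" "f ` J"] indf f(1) by auto
  moreover have "card (y ` {..<r}) \<le> card (f ` J)"
    using fs.independent_span_bound[of "f ` J" "y ` {..<r}"] indy finJ unfolding f(4)
    by (auto intro: fs.span_base)
  ultimately have "card J = r" using card_image[OF indf(2)] card_image[OF indy(2)] by simp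
  then have "J \<in> rsubsets r n" using J by (simp add: rsubsets_def)
  moreover have "f a \<in> supported {1..n}" if "a \<in> J" for a using f(1)[OF that] W by blast
  ultimately show ?thesis using that[of J f] f by blast
qed

section \<open>Maximal minors and the pivots of spaces in a closure\<close>

definition minor :: "nat list \<Rightarrow> complex mat \<Rightarrow> complex" where
  "minor js M = det (mat (length js) (length js) (\<lambda>(i, k). M $$ (js ! i - 1, k)))"

lemma minor_mult:
  assumes M: "M \<in> carrier_mat n r" and h: "h \<in> carrier_mat r r" and js: "length js = r" "set js \<subseteq> {1..n}"
  shows "minor js (M * h) = minor js M * det h"
proof -
  have lt: "js ! i - 1 < n" if "i < r" for i
  proof -
    have "js ! i \<in> {1..n}" using that js nth_mem by blast
    then show ?thesis by auto
  qed
  have "mat r r (\<lambda>(i, k). (M * h) $$ (js ! i - 1, k)) = mat r r (\<lambda>(i, k). M $$ (js ! i - 1, k)) * h"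
    using M h lt by (intro eq_matI) (auto simp: scalar_prod_def intro!: sum.cong)
  then show ?thesis using det_mult[of "mat r r (\<lambda>(i, k). M $$ (js ! i - 1, k))" r h] h js
    by (simp add: minor_def)
qed

lemma minor_poly_funs:
  assumes js: "length js = r" "set js \<subseteq> {1..n}"
  shows "minor js \<in> poly_funs r n"
proof -
  have lt: "js ! i - 1 < n" if "i < r" for i
  proof -
    have "js ! i \<in> {1..n}" using that js nth_mem by blast
    then show ?thesis by auto
  qed
  have "minor js = (\<lambda>M. \<Sum>p\<in>{p. p permutes {0..<r}}. signof p * (\<Prod>i\<in>{0..<r}. M $$ (js ! i - 1, p i)))"
  proof
    fix M
    have "minor js M = (\<Sum>p\<in>{p. p permutes {0..<r}}. signof p *
        (\<Prod>i\<in>{0..<r}. mat r r (\<lambda>(i, k). M $$ (js ! i - 1, k)) $$ (i, p i)))"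
      unfolding minor_def js by (rule det_def'[OF mat_carrier])
    also have "\<dots> = (\<Sum>p\<in>{p. p permutes {0..<r}}. signof p * (\<Prod>i\<in>{0..<r}. M $$ (js ! i - 1, p i)))"
      by (intro sum.cong refl arg_cong2[of _ _ _ _ "(*)"] prod.cong) (auto simp: permutes_in_image)
    finally show "minor js M = \<dots>" .
  qed
  moreover have "(\<lambda>M. \<Sum>p\<in>{p. p permutes {0..<r}}. signof p * (\<Prod>i\<in>{0..<r}. M $$ (js ! i - 1, p i)))
      \<in> poly_funs r n"
  proof (intro poly_funs_sum poly_funs.mult poly_funs_prod poly_funs.const poly_funs.entry)
    fix p i assume "p \<in> {p. p permutes {0..<r}}" "i \<in> {0..<r}"
    then show "js ! i - 1 < n" "p i < r" using lt permutes_in_image[of p "{0..<r}" i] by auto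
  qed
  ultimately show ?thesis by simp
qed

text \<open>In the Leibniz sum a permutation would have to send the last r - k rows injectively into
  the r - k - 1 columns after k; hence every term has a factor in the zero block.\<close>

lemma det_zero_block:
  fixes A :: "complex mat"
  assumes A: "A \<in> carrier_mat r r" and k: "k < r"
    and z: "\<And>i j. k \<le> i \<Longrightarrow> i < r \<Longrightarrow> j \<le> k \<Longrightarrow> A $$ (i, j) = 0"
  shows "det A = 0"
  unfolding det_def'[OF A]
proof (intro sum.neutral ballI)
  fix p assume "p \<in> {p. p permutes {0..<r}}"
  then have p: "p permutes {0..<r}" by simp
  have "\<exists>i\<in>{k..<r}. p i \<le> k"
  proof (rule ccontr)
    assume "\<not> (\<exists>i\<in>{k..<r}. p i \<le> k)"
    moreover have "p i < r" if "i < r" for i using permutes_in_image[OF p, of i] that by simp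
    ultimately have "p ` {k..<r} \<subseteq> {k<..<r}" by (auto simp: not_le)
    then have "card (p ` {k..<r}) \<le> card {k<..<r}" by (intro card_mono) auto
    moreover have "card (p ` {k..<r}) = r - k"
      using permutes_inj_on[OF p] by (simp add: card_image)
    ultimately show False using k by simp
  qed
  then obtain i where "i \<in> {k..<r}" "p i \<le> k" by blast
  then have "(\<Prod>i = 0..<r. A $$ (i, p i)) = 0"
    using z[of i "p i"] by (intro prod_zero bexI[of _ i]) auto
  then show "signof p * (\<Prod>i = 0..<r. A $$ (i, p i)) = 0" by simp
qed

text \<open>One spanning matrix per space is enough, even one that is not assumed to be a frame: any
  frame of the space is a product \<open>M * h\<close>, and its minor is that of M times
  \<open>det h\<close>.\<close>

lemma closure_minor:
  assumes V: "V \<in> Gr_closure r n Y"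
    and Y: "\<And>V. V \<in> Y \<Longrightarrow> \<exists>M\<in>carrier_mat n r. colspan n M = V \<and> minor js M = 0"
    and js: "length js = r" "set js \<subseteq> {1..n}"
    and F: "F \<in> frames r n" "colspan n F = V"
  shows "minor js F = 0"
proof (rule closure_of_GrD[OF V minor_poly_funs[OF js] _ F])
  fix N assume N: "N \<in> frames r n" "colspan n N \<in> Y"
  then obtain M where M: "M \<in> carrier_mat n r" "colspan n M = colspan n N" "minor js M = 0" using Y by blast
  then obtain h where "h \<in> carrier_mat r r" "N = M * h"
    using colspan_factor[of M n r N] N(1) by (auto simp: frames_def)
  with M minor_mult[OF M(1) _ js] show "minor js N = 0" by simp
qed

lemma rsubsets_sorted_list:
  assumes "J \<in> rsubsets r n"
  shows "finite J" "set (sorted_list_of_set J) = J" "length (sorted_list_of_set J) = r"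
    "\<And>i j. i < j \<Longrightarrow> j < r \<Longrightarrow> sorted_list_of_set J ! i < sorted_list_of_set J ! j"
    "\<And>i j. i \<le> j \<Longrightarrow> j < r \<Longrightarrow> sorted_list_of_set J ! i \<le> sorted_list_of_set J ! j"
    "\<And>i. i < r \<Longrightarrow> sorted_list_of_set J ! i \<in> J"
proof -
  show fin: "finite J" using assms finite_subset by (auto simp: rsubsets_def)
  then show set: "set (sorted_list_of_set J) = J" by simp
  show len: "length (sorted_list_of_set J) = r" using assms fin by (simp add: rsubsets_def)
  show less: "sorted_list_of_set J ! i < sorted_list_of_set J ! j" if "i < j" "j < r" for i j
    using that len by (intro sorted_wrt_nth_less[of "(<)"]) simp_all
  show "sorted_list_of_set J ! i \<le> sorted_list_of_set J ! j" if "i \<le> j" "j < r" for i j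
    using that less by (cases "i = j") (auto intro: less_imp_le)
  show "sorted_list_of_set J ! i \<in> J" if "i < r" for i
    using that len set nth_mem by metis
qed

lemma image_sorted_list:
  assumes "J \<in> rsubsets r n"
  shows "f ` J = (\<lambda>k. f (sorted_list_of_set J ! k)) ` {..<r}"
proof -
  note js = rsubsets_sorted_list[OF assms]
  have "J = (!) (sorted_list_of_set J) ` {..<r}"
    using js(2,3) by (metis lessThan_atLeast0 nth_image order_refl take_all)
  then show ?thesis by (metis image_image)
qed

lemma image_shift_atLeast: "g ` {1..r} = (\<lambda>k. g (Suc k)) ` {..<r}"
proof -
  have "{1..r} = Suc ` {..<r}" by (simp add: image_Suc_lessThan)
  then show ?thesis by (metis image_image)
qed

text \<open>The pivot minor of the echelon frame is 1, so it cannot vanish on all of Y, since the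
  vanishing would pass to the closure. The last conclusion records this; both Schubert conditions
  are derived from it.\<close>

lemma closure_echelon:
  fixes key :: "nat \<Rightarrow> int"
  assumes V: "V \<in> Gr_closure r n Y"
  obtains J f where "J \<in> rsubsets r n" "V = fun_vec n ` fs.span (f ` J)"
    "\<And>a. a \<in> J \<Longrightarrow> f a \<in> supported {1..n}" "\<And>a i. a \<in> J \<Longrightarrow> key a < key i \<Longrightarrow> f a i = 0"
    "\<And>a b. a \<in> J \<Longrightarrow> b \<in> J \<Longrightarrow> f a b = (if a = b then 1 else 0)"
    "\<not> (\<forall>V\<in>Y. \<exists>M\<in>carrier_mat n r. colspan n M = V \<and> minor (sorted_list_of_set J) M = 0)"
proof -
  have "V \<in> Gr r n"
    using V Abstract_Topology.closure_of_subset_topspace[of "Gr_topology r n" Y] topspace_Gr_topology by blast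
  then obtain M where M: "M \<in> frames r n" "colspan n M = V" by (auto simp: Gr_def)
  then obtain y where y: "M = fam_mat n r y" "\<And>k. y k \<in> supported {1..n}"
    using supported_fam[of M n r] by (auto simp: frames_def)
  obtain J f where J: "J \<in> rsubsets r n" "fs.span (f ` J) = fs.span (y ` {..<r})"
    and f: "\<And>a. a \<in> J \<Longrightarrow> f a \<in> supported {1..n}" "\<And>a i. a \<in> J \<Longrightarrow> key a < key i \<Longrightarrow> f a i = 0"
    "\<And>a b. a \<in> J \<Longrightarrow> b \<in> J \<Longrightarrow> f a b = (if a = b then 1 else 0)"
    using frame_echelon[of n r y key] M(1) y by metis
  have Veq: "V = fun_vec n ` fs.span (f ` J)" using M(2) by (simp add: y(1) colspan_fam_mat J(2))
  let ?js = "sorted_list_of_set J"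
  note js = rsubsets_sorted_list[OF J(1)]
  have JN: "J \<subseteq> {1..n}" using J by (simp add: rsubsets_def)
  define F where "F = fam_mat n r (\<lambda>k. f (?js ! k))"
  have "F \<in> frames r n" unfolding F_def
  proof (rule fam_mat_frame[of r "\<lambda>k. ?js ! k"])
    show "?js ! k \<in> {1..n}" if "k < r" for k using js(6)[OF that] JN by blast
    show "f (?js ! k) (?js ! l) = (if k = l then 1 else 0)" if "k < r" "l < r" for k l
      using f(3) js(3,6) that nth_eq_iff_index_eq[of ?js k l] by simp
  qed
  moreover have "colspan n F = V" unfolding Veq F_def colspan_fam_mat image_sorted_list[OF J(1)] by simp
  moreover have "minor ?js F = 1"
  proof -
    have "mat r r (\<lambda>(i, k). F $$ (?js ! i - 1, k)) = 1\<^sub>m r"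
    proof (intro eq_matI)
      fix i k assume "i < dim_row (1\<^sub>m r :: complex mat)" "k < dim_col (1\<^sub>m r :: complex mat)"
      then have ik: "i < r" "k < r" by simp_all
      have "?js ! i \<in> {1..n}" using js(6) ik JN by blast
      then show "mat r r (\<lambda>(i, k). F $$ (?js ! i - 1, k)) $$ (i, k) = 1\<^sub>m r $$ (i, k)"
        using ik f(3)[OF js(6) js(6), of k i] nth_eq_iff_index_eq[of ?js k i] js(3)
        by (auto simp: F_def fam_mat_def)
    qed simp_all
    then show ?thesis using js(3) by (simp add: minor_def)
  qed
  ultimately have no: "\<not> (\<forall>V\<in>Y. \<exists>M\<in>carrier_mat n r. colspan n M = V \<and> minor ?js M = 0)"
    using closure_minor[OF V _ js(3), of F] js(2) JN by (metis one_neq_zero)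
  show ?thesis
    by (rule that[of J f], rule J(1), rule Veq, erule f(1), erule (1) f(2), erule (1) f(3), rule no)
qed

text \<open>Each pivot j_k is at most c_k. Otherwise the columns up to k of every matrix of the cell
  vanish in the rows from j_k on, a block too large for the pivot minor to be nonzero. Increasing
  pivots at the largest indices also give the triangular independence.\<close>

lemma schubert_adapted:
  assumes C: "C \<in> rsubsets r n"
    and V: "V \<in> Gr_closure r n (cell r n C (Inv C))"
  obtains l where "V = fun_vec n ` fs.span (l ` {1..r})"
    "\<And>k. k \<in> {1..r} \<Longrightarrow> l k \<in> supported ({1..n} \<inter> {..sorted_list_of_set C ! (k - 1)})"
    "\<And>k. k \<in> {1..r} \<Longrightarrow> l k \<notin> fs.span (l ` {1..<k})"
proof -
  obtain J f where J: "J \<in> rsubsets r n" "V = fun_vec n ` fs.span (f ` J)"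
    and f: "\<And>a. a \<in> J \<Longrightarrow> f a \<in> supported {1..n}" "\<And>a i. a \<in> J \<Longrightarrow> int a < int i \<Longrightarrow> f a i = 0"
    "\<And>a b. a \<in> J \<Longrightarrow> b \<in> J \<Longrightarrow> f a b = (if a = b then 1 else 0)"
    and no: "\<not> (\<forall>V\<in>cell r n C (Inv C).
        (\<exists>M\<in>carrier_mat n r. colspan n M = V \<and> minor (sorted_list_of_set J) M = 0))"
    by (rule closure_echelon[OF V, of int], rule that)
  let ?js = "sorted_list_of_set J" and ?cs = "sorted_list_of_set C"
  note js = rsubsets_sorted_list[OF J(1)] and cs = rsubsets_sorted_list[OF C]
  have JN: "J \<subseteq> {1..n}" using J by (simp add: rsubsets_def)
  have le: "?js ! k \<le> ?cs ! k" if k: "k < r" for k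
  proof (rule ccontr)
    assume gt: "\<not> ?js ! k \<le> ?cs ! k"
    have ex: "\<exists>M\<in>carrier_mat n r. colspan n M = V \<and> minor ?js M = 0" if "V \<in> cell r n C (Inv C)" for V
    proof -
      from that obtain M where M: "M \<in> carrier_mat n r" "V = colspan n M"
        and all: "\<forall>i\<in>{1..n}. \<forall>j\<in>{1..r}. let a = ?cs ! (j - 1) in
          (i = a \<longrightarrow> M $$ (i - 1, j - 1) = 1) \<and> (i \<noteq> a \<and> (i, a) \<notin> Inv C \<longrightarrow> M $$ (i - 1, j - 1) = 0)"
        unfolding cell_def by (elim CollectE exE conjE)
      have ent: "M $$ (i - 1, j - 1) = 0"
        if "i \<in> {1..n}" "j \<in> {1..r}" "i \<noteq> ?cs ! (j - 1)" "(i, ?cs ! (j - 1)) \<notin> Inv C" for i j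
        using all[rule_format, OF that(1,2)] that(3,4) by (simp add: Let_def)
      have "minor ?js M = 0" unfolding minor_def js(3)
      proof (rule det_zero_block[OF _ k])
        fix i j assume ij: "k \<le> i" "i < r" "j \<le> k"
        have "?cs ! j < ?js ! i" using js(5)[OF ij(1,2)] cs(5)[OF ij(3) k] gt by simp
        moreover have "?js ! i \<in> {1..n}" using js(6) ij JN by blast
        ultimately show "mat r r (\<lambda>(i, k). M $$ (?js ! i - 1, k)) $$ (i, j) = 0"
          using ent[of "?js ! i" "Suc j"] ij k by (simp add: Inv_def)
      qed simp
      with M show ?thesis by (intro bexI[of _ M] conjI) simp_all
    qed
    show False by (rule notE[OF no]) (intro ballI ex)
  qed
  show ?thesis
  proof (rule that[of "\<lambda>k. f (?js ! (k - 1))"])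
    show "V = fun_vec n ` fs.span ((\<lambda>k. f (?js ! (k - 1))) ` {1..r})"
      using J(2) unfolding image_sorted_list[OF J(1)] by (subst image_shift_atLeast) simp
    fix k assume k: "k \<in> {1..r}"
    then have kJ: "?js ! (k - 1) \<in> J" "?js ! (k - 1) \<le> ?cs ! (k - 1)" using js(6) le by auto
    show "f (?js ! (k - 1)) \<in> supported ({1..n} \<inter> {..?cs ! (k - 1)})"
      using f(1)[OF kJ(1)] f(2)[OF kJ(1)] kJ(2) by (auto simp: supported_def)
    have "(\<lambda>k. f (?js ! (k - 1))) ` {1..<k} \<subseteq> {g. g (?js ! (k - 1)) = 0}"
    proof (intro image_subsetI CollectI)
      fix i assume i: "i \<in> {1..<k}"
      then have "?js ! (i - 1) < ?js ! (k - 1)" using k by (intro js(4)) auto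
      then show "f (?js ! (i - 1)) (?js ! (k - 1)) = 0" using f(3)[OF js(6) kJ(1), of "i - 1"] i k by auto
    qed
    from span_zero_at[OF this] f(3)[OF kJ(1) kJ(1)]
    show "f (?js ! (k - 1)) \<notin> fs.span ((\<lambda>k. f (?js ! (k - 1))) ` {1..<k})" by auto
  qed
qed

lemma mat_act_colspan:
  assumes "g \<in> carrier_mat n n" and "M \<in> carrier_mat n r"
  shows "mat_act g (colspan n M) = colspan n (g * M)"
proof -
  have "g * M \<in> carrier_mat n r" using assms by simp
  then show ?thesis
    unfolding mat_act_def colspan_alt[OF assms(2)] colspan_alt[OF \<open>g * M \<in> carrier_mat n r\<close>]
    using assoc_mult_mat_vec[OF assms] by (auto simp: image_iff) metis+
qed

text \<open>Acting on a coordinate plane selects the columns of g numbered by B.\<close>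

lemma coord_plane_mat:
  fixes n B defines "E \<equiv> mat_of_cols n (map (\<lambda>a. unit_vec n (a - 1)) (sorted_list_of_set B)) :: complex mat"
  assumes B: "B \<in> rsubsets r n" and g: "g \<in> carrier_mat n n"
  shows "E \<in> carrier_mat n r" "mat_act g (coord_plane n B) = colspan n (g * E)"
    "\<And>i k. i < n \<Longrightarrow> k < r \<Longrightarrow> (g * E) $$ (i, k) = g $$ (i, sorted_list_of_set B ! k - 1)"
proof -
  note bs = rsubsets_sorted_list[OF B]
  show E: "E \<in> carrier_mat n r" unfolding E_def using mat_of_cols_carrier(1)[of n "map (\<lambda>a. unit_vec n (a - 1)) (sorted_list_of_set B)"] bs(3)
    by simp
  show "mat_act g (coord_plane n B) = colspan n (g * E)"
    using mat_act_colspan[OF g E] by (simp add: coord_plane_def E_def)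
  fix i k assume ik: "i < n" "k < r"
  have bn: "sorted_list_of_set B ! k - 1 < n" using bs(6)[OF ik(2)] B by (fastforce simp: rsubsets_def)
  have "col E k = unit_vec n (sorted_list_of_set B ! k - 1)"
    unfolding E_def using ik bs(3) by (subst col_mat_of_cols) auto
  then show "(g * E) $$ (i, k) = g $$ (i, sorted_list_of_set B ! k - 1)"
    using ik g E bn by simp
qed

text \<open>The mirror image of \<open>schubert_adapted\<close>, with pivots at the smallest
  indices. For lower triangular g the columns from b_k on vanish in the rows before b_k, so the zero
  block appears in the transposed minor.\<close>

lemma opposite_adapted:
  assumes B: "B \<in> rsubsets r n"
    and V: "V \<in> Gr_closure r n (lower_orbit n B)"
  obtains u where "V = fun_vec n ` fs.span (u ` {1..r})"
    "\<And>k. k \<in> {1..r} \<Longrightarrow> u k \<in> supported ({1..n} \<inter> {sorted_list_of_set B ! (k - 1)..})"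
proof -
  obtain J f where J: "J \<in> rsubsets r n" "V = fun_vec n ` fs.span (f ` J)"
    and f: "\<And>a. a \<in> J \<Longrightarrow> f a \<in> supported {1..n}" "\<And>a i. a \<in> J \<Longrightarrow> - int a < - int i \<Longrightarrow> f a i = 0"
    "\<And>a b. a \<in> J \<Longrightarrow> b \<in> J \<Longrightarrow> f a b = (if a = b then 1 else 0)"
    and no: "\<not> (\<forall>V\<in>lower_orbit n B.
        (\<exists>M\<in>carrier_mat n r. colspan n M = V \<and> minor (sorted_list_of_set J) M = 0))"
    by (rule closure_echelon[OF V, of "\<lambda>i. - int i"], rule that)
  let ?js = "sorted_list_of_set J" and ?bs = "sorted_list_of_set B"
  note js = rsubsets_sorted_list[OF J(1)] and bs = rsubsets_sorted_list[OF B]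
  have JN: "J \<subseteq> {1..n}" and BN: "B \<subseteq> {1..n}" using J B by (simp_all add: rsubsets_def)
  have le: "?bs ! k \<le> ?js ! k" if k: "k < r" for k
  proof (rule ccontr)
    assume gt: "\<not> ?bs ! k \<le> ?js ! k"
    have ex: "\<exists>M\<in>carrier_mat n r. colspan n M = V \<and> minor ?js M = 0" if "V \<in> lower_orbit n B" for V
    proof -
      from that obtain g where g: "g \<in> carrier_mat n n" "upper_triangular (transpose_mat g)"
        and V: "V = mat_act g (coord_plane n B)"
        unfolding lower_orbit_def by (elim CollectE exE conjE)
      define M where "M = g * mat_of_cols n (map (\<lambda>a. unit_vec n (a - 1)) ?bs)"
      note M = coord_plane_mat[OF B g(1), folded M_def]
      have Mc: "M \<in> carrier_mat n r" unfolding M_def using g(1) M(1) by simp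
      let ?A = "mat r r (\<lambda>(i, k). M $$ (?js ! i - 1, k))"
      have "det (transpose_mat ?A) = 0"
      proof (rule det_zero_block[OF _ k])
        fix i j assume ij: "k \<le> i" "i < r" "j \<le> k"
        have lt: "?js ! j < ?bs ! i" using js(5)[OF ij(3) k] bs(5)[OF ij(1,2)] gt by simp
        have jn: "?js ! j \<in> {1..n}" "?bs ! i \<in> {1..n}" using js(6)[of j] bs(6)[of i] ij k JN BN by auto
        have "transpose_mat ?A $$ (i, j) = M $$ (?js ! j - 1, i)" using ij k by simp
        also have "\<dots> = g $$ (?js ! j - 1, ?bs ! i - 1)" using jn ij by (intro M(3)) auto
        also have "\<dots> = transpose_mat g $$ (?bs ! i - 1, ?js ! j - 1)" using jn g(1) by auto
        also have "\<dots> = 0" using g lt jn by (intro upper_triangularD[of "transpose_mat g"]) auto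
        finally show "transpose_mat ?A $$ (i, j) = 0" .
      qed simp
      then have "minor ?js M = 0" unfolding minor_def js(3) using det_transpose[of ?A r] by simp
      with M(2) V Mc show ?thesis by (intro bexI[of _ M] conjI) simp_all
    qed
    show False by (rule notE[OF no]) (intro ballI ex)
  qed
  show ?thesis
  proof (rule that[of "\<lambda>k. f (?js ! (k - 1))"])
    show "V = fun_vec n ` fs.span ((\<lambda>k. f (?js ! (k - 1))) ` {1..r})"
      using J(2) unfolding image_sorted_list[OF J(1)] by (subst image_shift_atLeast) simp
    fix k assume k: "k \<in> {1..r}"
    then have kJ: "?js ! (k - 1) \<in> J" "?bs ! (k - 1) \<le> ?js ! (k - 1)" using js(6) le by auto
    show "f (?js ! (k - 1)) \<in> supported ({1..n} \<inter> {?bs ! (k - 1)..})"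
      using f(1)[OF kJ(1)] f(2)[OF kJ(1)] kJ(2) by (auto simp: supported_def)
  qed
qed

section \<open>Noncrossing permutations\<close>

definition block_cycle :: "nat set \<Rightarrow> nat \<Rightarrow> nat" where
  "block_cycle B = cycle_of_list (rev (sorted_list_of_set B))"

lemma cycle_of_list_nth:
  assumes "distinct xs" and "i < length xs"
  shows "cycle_of_list xs (xs ! i) = xs ! (Suc i mod length xs)"
proof -
  have "map (cycle_of_list xs) xs = rotate1 xs" using cyclic_rotation[OF assms(1), of 1] by simp
  then have "map (cycle_of_list xs) xs ! i = rotate1 xs ! i" by simp
  then show ?thesis using assms by (simp add: nth_rotate1)
qed

lemma block_cycle_in: "finite B \<Longrightarrow> x \<in> B \<Longrightarrow> block_cycle B x \<in> B"
  unfolding block_cycle_def using permutes_in_image[OF cycle_permutes[of "rev (sorted_list_of_set B)"], of x] by simp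

text \<open>A description without lists: a descent goes to a neighbour in the block, and the one
  remaining element goes from the bottom to the top. The arguments on chords use nothing else about
  the cycles.\<close>

lemma block_cycle_cases:
  assumes B: "finite B" "x \<in> B"
  shows "(block_cycle B x < x \<and> (\<forall>y\<in>B. \<not> (block_cycle B x < y \<and> y < x))) \<or>
    (\<forall>y\<in>B. x \<le> y \<and> y \<le> block_cycle B x)"
proof -
  define xs where "xs = rev (sorted_list_of_set B)"
  have xs: "distinct xs" "set xs = B" using B by (auto simp: xs_def)
  have dec: "xs ! j < xs ! i" if "i < j" "j < length xs" for i j
    using that strict_sorted_list_of_set[of B] unfolding xs_def
    by (simp add: rev_nth) (rule sorted_wrt_nth_less[of "(<)"], auto)
  obtain i where i: "i < length xs" "x = xs ! i" using B(2) unfolding xs(2)[symmetric] in_set_conv_nth by blast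
  have c: "block_cycle B x = xs ! (Suc i mod length xs)"
    using cycle_of_list_nth[OF xs(1) i(1)] i(2) by (simp add: xs_def block_cycle_def)
  show ?thesis
  proof (cases "Suc i < length xs")
    case True
    then have c: "block_cycle B x = xs ! Suc i" using c by simp
    have "\<not> (xs ! Suc i < y \<and> y < x)" if "y \<in> B" for y
    proof -
      from that obtain j where j: "j < length xs" "y = xs ! j" unfolding xs(2)[symmetric] in_set_conv_nth by blast
      consider "j < i" | "j = i" | "j = Suc i" | "Suc i < j" by linarith
      then show ?thesis
      proof cases
        case 1
        then show ?thesis using dec[OF 1 i(1)] unfolding i(2) j(2) by simp
      next
        case 4
        then show ?thesis using dec[OF 4 j(1)] unfolding i(2) j(2) by simp
      qed (simp_all add: i(2) j(2))
    qed
    then show ?thesis using dec[of i "Suc i"] True i c by auto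
  next
    case False
    then have last: "Suc i = length xs" using i by simp
    have "x \<le> y \<and> y \<le> xs ! 0" if "y \<in> B" for y
    proof -
      from that obtain j where j: "j < length xs" "y = xs ! j" unfolding xs(2)[symmetric] in_set_conv_nth by blast
      show ?thesis using dec[of j i] dec[of 0 j] i j last
        by (cases "j = i"; cases "j = 0") (auto intro: less_imp_le)
    qed
    then show ?thesis using c last by simp
  qed
qed

text \<open>The set partition is encoded by the block of each element, which avoids choosing members
  of a set of sets; the last clause is the noncrossing condition.\<close>

definition NC_blocks :: "nat \<Rightarrow> (nat \<Rightarrow> nat) \<Rightarrow> (nat \<Rightarrow> nat set) \<Rightarrow> bool" where
  "NC_blocks n w blk \<longleftrightarrow>
    (\<forall>x\<in>{1..n}. x \<in> blk x \<and> w x \<in> blk x \<and> blk x \<subseteq> {1..n} \<and>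
      ((w x < x \<and> (\<forall>y\<in>blk x. \<not> (w x < y \<and> y < x))) \<or> (\<forall>y\<in>blk x. x \<le> y \<and> y \<le> w x))) \<and>
    (\<forall>x\<in>{1..n}. \<forall>y\<in>{1..n}. (y \<in> blk x \<longleftrightarrow> blk y = blk x) \<and>
      (\<forall>p\<in>blk x. \<forall>q\<in>blk y. \<forall>p'\<in>blk x. \<forall>q'\<in>blk y. p < q \<and> q < p' \<and> p' < q' \<longrightarrow> blk x = blk y))"

lemma NC_blocksD:
  assumes "NC_blocks n w blk"
  shows "x \<in> {1..n} \<Longrightarrow> x \<in> blk x \<and> w x \<in> blk x"
    "x \<in> {1..n} \<Longrightarrow> y \<in> {1..n} \<Longrightarrow> y \<in> blk x \<longleftrightarrow> blk y = blk x"
    "x \<in> {1..n} \<Longrightarrow> y \<in> blk x \<Longrightarrow> y \<in> {1..n}"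
    "x \<in> {1..n} \<Longrightarrow> (w x < x \<and> (\<forall>y\<in>blk x. \<not> (w x < y \<and> y < x))) \<or> (\<forall>y\<in>blk x. x \<le> y \<and> y \<le> w x)"
    "x \<in> {1..n} \<Longrightarrow> y \<in> {1..n} \<Longrightarrow> p \<in> blk x \<Longrightarrow> q \<in> blk y \<Longrightarrow> p' \<in> blk x \<Longrightarrow> q' \<in> blk y \<Longrightarrow>
      p < q \<Longrightarrow> q < p' \<Longrightarrow> p' < q' \<Longrightarrow> blk x = blk y"
  using assms unfolding NC_blocks_def by (blast, blast, blast, blast, metis)

lemma NC_cases:
  assumes "w \<in> NC n"
  obtains blk where "NC_blocks n w blk"
proof -
  obtain P where P: "partition_on {1..n} P" "noncrossing P"
    and w: "\<And>B x. B \<in> P \<Longrightarrow> x \<in> B \<Longrightarrow> w x = block_cycle B x"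
    using assms unfolding NC_def block_cycle_def by blast
  define blk where "blk x = (THE B. B \<in> P \<and> x \<in> B)" for x
  have ex: "\<exists>!B. B \<in> P \<and> x \<in> B" if "x \<in> {1..n}" for x
    using P(1) that unfolding partition_on_def disjoint_def by blast
  have blk: "blk x \<in> P" "x \<in> blk x" if "x \<in> {1..n}" for x
    using theI'[OF ex[OF that]] unfolding blk_def by auto
  have sub: "B \<subseteq> {1..n}" "finite B" if "B \<in> P" for B
    using P(1) that finite_subset[of B "{1..n}"] unfolding partition_on_def by auto
  have eq: "blk x = B" if "B \<in> P" "x \<in> B" for x B
    using ex[of x] blk[of x] sub[OF that(1)] that by blast
  have "NC_blocks n w blk" unfolding NC_blocks_def
  proof (intro conjI ballI impI)
    fix x assume x: "x \<in> {1..n}"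
    note b = blk[OF x]
    have wx: "w x = block_cycle (blk x) x" using w b by blast
    show "x \<in> blk x" "w x \<in> blk x" using b block_cycle_in[OF sub(2)[OF b(1)] b(2)] wx by simp_all
    show "blk x \<subseteq> {1..n}" using sub[OF b(1)] by blast
    show "w x < x \<and> (\<forall>y\<in>blk x. \<not> (w x < y \<and> y < x)) \<or> (\<forall>y\<in>blk x. x \<le> y \<and> y \<le> w x)"
      using block_cycle_cases[OF sub(2)[OF b(1)] b(2)] wx by simp
    fix y
    assume y: "y \<in> {1..n}"
    show "y \<in> blk x \<longleftrightarrow> blk y = blk x" using eq[OF b(1)] blk[OF y] by blast
    fix p q p' q' assume "p \<in> blk x" "q \<in> blk y" "p' \<in> blk x" "q' \<in> blk y" "p < q \<and> q < p' \<and> p' < q'"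
    then have "\<exists>a b c d. a \<in> blk x \<and> b \<in> blk y \<and> c \<in> blk x \<and> d \<in> blk y \<and> a < b \<and> b < c \<and> c < d"
      by (intro exI[of _ p] exI[of _ q] exI[of _ p'] exI[of _ q']) simp
    then show "blk x = blk y" using P(2)[unfolded noncrossing_def] b(1) blk(1)[OF y] by metis
  qed
  then show ?thesis by (rule that)
qed

text \<open>Crossing chords would belong to the same block. There a chord joins two neighbours, with
  nothing of the block between them, or the two extremes, with nothing of the block outside.\<close>

lemma NC_chords_noncrossing:
  assumes w: "w \<in> NC n" and xy: "x \<in> {1..n}" "y \<in> {1..n}"
    and "min x (w x) < min y (w y)" "min y (w y) < max x (w x)" "max x (w x) < max y (w y)"
  shows False
  using w
proof (rule NC_cases)
  fix blk assume bb: "NC_blocks n w blk"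
  note b = NC_blocksD[OF bb]
  have mm: "min x (w x) \<in> blk x" "max x (w x) \<in> blk x" "min y (w y) \<in> blk y" "max y (w y) \<in> blk y"
    using b(1)[OF xy(1)] b(1)[OF xy(2)] by (auto simp: min_def max_def)
  have "blk x = blk y" using b(5)[OF xy mm(1,3,2,4)] assms(4-6) by blast
  then have "\<forall>z\<in>{min y (w y), max y (w y)}. z \<in> blk x" using mm by auto
  then show False using b(4)[OF xy(1)] assms(4-6) by fastforce
qed

text \<open>An ascent leads from the least element of a block to its greatest, and the preimage of x
  lies in that block.\<close>

lemma NC_ascent:
  assumes w: "w \<in> NC n" and xz: "x \<in> {1..n}" "z \<in> {1..n}" and "x < w x" "w z = x"
  shows "z \<le> w x"
  using w
proof (rule NC_cases)
  fix blk assume bb: "NC_blocks n w blk"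
  note b = NC_blocksD[OF bb]
  have "z \<in> blk x" using b(1)[OF xz(2)] b(2)[OF xz(2) xz(1)] assms(5) by auto
  then show ?thesis using b(4)[OF xz(1)] assms(4) by auto
qed

text \<open>For a decreasing h, as many values lie below \<open>h p\<close> as arguments lie above
  p; so the image alone determines h.\<close>

lemma antimono_bij_unique:
  fixes f g :: "nat \<Rightarrow> nat"
  assumes "finite P" and f: "\<And>x y. x \<in> P \<Longrightarrow> y \<in> P \<Longrightarrow> x < y \<Longrightarrow> f y < f x"
    and g: "\<And>x y. x \<in> P \<Longrightarrow> y \<in> P \<Longrightarrow> x < y \<Longrightarrow> g y < g x" and im: "f ` P = g ` P" and p: "p \<in> P"
  shows "f p = g p"
proof -
  have card: "card {y \<in> h ` P. y < h p} = card {x \<in> P. p < x}"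
    if h: "\<And>x y. x \<in> P \<Longrightarrow> y \<in> P \<Longrightarrow> x < y \<Longrightarrow> h y < h x" for h :: "nat \<Rightarrow> nat"
  proof -
    have "{y \<in> h ` P. y < h p} = h ` {x \<in> P. p < x}"
    proof (intro equalityI subsetI)
      fix y assume "y \<in> {y \<in> h ` P. y < h p}"
      then obtain x where x: "x \<in> P" "y = h x" "h x < h p" by auto
      have "\<not> x < p" "x \<noteq> p" using h[OF x(1) p] x(3) by auto
      then have "p < x" by simp
      with x show "y \<in> h ` {x \<in> P. p < x}" by blast
    qed (use h p in auto)
    moreover have "inj_on h {x \<in> P. p < x}"
      using h by (intro linorder_inj_onI) (auto simp: neq_iff)
    ultimately show ?thesis by (simp add: card_image)
  qed
  have eq: "card {y \<in> g ` P. y < f p} = card {y \<in> g ` P. y < g p}"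
    using card[of f, OF f] card[of g, OF g] im by simp
  have fin: "finite {y \<in> g ` P. y < b}" for b using assms(1) by simp
  have "card {y \<in> g ` P. y < b} < card {y \<in> g ` P. y < c}" if "b < c" "b \<in> g ` P" for b c
    using that by (intro psubset_card_mono fin psubsetI) auto
  note less = this
  have mem: "f p \<in> g ` P" "g p \<in> g ` P" using p im by blast+
  show ?thesis
    using less[OF _ mem(1), of "g p"] less[OF _ mem(2), of "f p"] eq by (cases "f p" "g p" rule: linorder_cases) auto
qed

text \<open>Each block \<open>X p\<close> leaves a gap between \<open>g p\<close> and
  \<open>h p\<close>, and the blocks with larger index lie inside it. Such nested blocks cannot
  cross, and the points outside all blocks are singletons. Every noncrossing permutation constructed
  below has this form.\<close>

lemma NC_intro:
  assumes disj: "\<And>p q. p \<in> I \<Longrightarrow> q \<in> I \<Longrightarrow> p < q \<Longrightarrow> \<forall>x\<in>X q. g p < x \<and> x < h p"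
    and gap: "\<And>p x. p \<in> I \<Longrightarrow> x \<in> X p \<Longrightarrow> x \<in> {1..n} \<and> (x \<le> g p \<or> h p \<le> x)"
    and ne: "\<And>p. p \<in> I \<Longrightarrow> X p \<noteq> {}"
    and w: "\<And>p x. p \<in> (I :: nat set) \<Longrightarrow> x \<in> X p \<Longrightarrow> w x = block_cycle (X p) x"
      "\<And>x. (\<And>p. p \<in> I \<Longrightarrow> x \<notin> X p) \<Longrightarrow> w x = x"
  shows "w \<in> NC n"
proof -
  have disj': "p = q" if "p \<in> I" "q \<in> I" "x \<in> X p" "x \<in> X q" for p q x
  proof (rule ccontr)
    assume "p \<noteq> q"
    then consider "p < q" | "q < p" by linarith
    then show False
    proof cases
      case 1
      with disj[OF that(1,2)] gap[OF that(1,3)] that(4) show False by fastforce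
    next
      case 2
      with disj[OF that(2,1)] gap[OF that(2,4)] that(3) show False by fastforce
    qed
  qed
  define R where "R = {1..n} - (\<Union>p\<in>I. X p)"
  define Q where "Q = X ` I \<union> (\<lambda>x. {x}) ` R"
  have fin: "finite (X p)" if "p \<in> I" for p   proof (rule finite_subset)
    show "X p \<subseteq> {1..n}" using gap that by blast
  qed simp
  have part: "partition_on {1..n} Q"
  proof (rule partition_onI)
    show "\<Union> Q = {1..n}" using gap by (auto simp: Q_def R_def)
    show "{} \<notin> Q" using ne by (auto simp: Q_def)
    show "disjnt p q" if "p \<in> Q" "q \<in> Q" "p \<noteq> q" for p q
    proof -
      have "False" if "x \<in> p" "x \<in> q" for x
      proof -
        have cases: "(\<exists>i\<in>I. B = X i) \<or> (B = {x} \<and> x \<in> R)" if "B \<in> Q" "x \<in> B" for B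
          using that by (auto simp: Q_def)
        show False
        proof (cases "x \<in> R")
          case True
          then have "B = {x}" if "B \<in> Q" "x \<in> B" for B using cases[OF that] that by (auto simp: R_def)
          then show False using \<open>p \<in> Q\<close> \<open>q \<in> Q\<close> \<open>p \<noteq> q\<close> that by metis
        next
          case False
          with cases[OF \<open>p \<in> Q\<close> that(1)] cases[OF \<open>q \<in> Q\<close> that(2)]
          obtain i j where "i \<in> I" "j \<in> I" "p = X i" "q = X j" by auto
          then show False using disj'[of i j x] that \<open>p \<noteq> q\<close> by auto
        qed
      qed
      then show ?thesis by (auto simp: disjnt_def)
    qed
  qed
  have nest: False if pq: "p \<in> I" "q \<in> I" "p < q"
    and x: "x1 \<in> X p" "x2 \<in> X p" "y1 \<in> X q" "y2 \<in> X q"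
    and c: "(x1 < y1 \<and> y1 < x2 \<and> x2 < y2) \<or> (y1 < x1 \<and> x1 < y2 \<and> y2 < x2)" for p q x1 x2 y1 y2
    using disj[OF pq] gap[OF pq(1) x(1)] gap[OF pq(1) x(2)] x(3,4) c by fastforce
  have nonc: "noncrossing Q"
    unfolding noncrossing_def
  proof (intro notI, elim bexE conjE exE)
    fix B C x1 x2 y1 y2 :: "nat"
    fix B C assume BC: "B \<in> Q" "C \<in> Q" "B \<noteq> C"
      and x: "x1 \<in> B" "y1 \<in> C" "x2 \<in> B" "y2 \<in> C" "x1 < y1" "y1 < x2" "x2 < y2"
    have "B \<in> X ` I" using BC(1) x(1,3,5,6) unfolding Q_def by auto
    moreover have "C \<in> X ` I" using BC(2) x(2,4,6,7) unfolding Q_def by auto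
    ultimately obtain p q where pq: "p \<in> I" "q \<in> I" "B = X p" "C = X q" by blast
    then have "p \<noteq> q" using BC(3) by auto
    then consider "p < q" | "q < p" by linarith
    then show False using nest[of p q x1 x2 y1 y2] nest[of q p y1 y2 x1 x2] pq x by cases auto
  qed
  have wQ: "w x = block_cycle B x" if "B \<in> Q" "x \<in> B" for B x
  proof (cases "B \<in> X ` I")
    case False
    then have "B = {x}" "x \<in> R" using that by (auto simp: Q_def)
    then show ?thesis using w(2)[of x] by (auto simp: R_def block_cycle_def)
  qed (use w(1) that in blast)
  have finQ: "finite B" if "B \<in> Q" for B using that fin by (auto simp: Q_def)
  have blk: "\<exists>B\<in>Q. x \<in> B" if "x \<in> {1..n}" for x using part that unfolding partition_on_def by blast
  have sub: "B \<subseteq> {1..n}" if "B \<in> Q" for B using part that unfolding partition_on_def by blast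
  have "inj_on w {1..n}"
  proof (rule inj_onI)
    fix x y assume xy: "x \<in> {1..n}" "y \<in> {1..n}" "w x = w y"
    obtain B C where BC: "B \<in> Q" "x \<in> B" "C \<in> Q" "y \<in> C" using blk xy by meson
    have "w x \<in> B" "w y \<in> C" using wQ BC block_cycle_in finQ by simp_all
    then have "B = C" using part BC xy unfolding partition_on_def disjoint_def by (metis disjoint_iff)
    then have "block_cycle B x = block_cycle B y" using xy wQ BC by simp
    then show "x = y" using permutes_inj[OF cycle_permutes] unfolding block_cycle_def by (metis injD)
  qed
  moreover have "w ` {1..n} \<subseteq> {1..n}"
  proof (rule image_subsetI)
    fix x assume "x \<in> {1..n}"
    then obtain B where "B \<in> Q" "x \<in> B" using blk by blast
    then have "w x \<in> B" using wQ block_cycle_in[of B x] finQ by simp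
    then show "w x \<in> {1..n}" using sub[OF \<open>B \<in> Q\<close>] by blast
  qed
  ultimately have "bij_betw w {1..n} {1..n}"
    by (simp add: bij_betw_def endo_inj_surj)
  moreover have "w x = x" if "x \<notin> {1..n}" for x using w(2)[of x] gap that by blast
  ultimately have "w permutes {1..n}" by (rule bij_imp_permutes)
  then show ?thesis unfolding NC_def using part nonc wQ[unfolded block_cycle_def] by blast
qed

section \<open>Cycles of small blocks, exchanges, and a criterion for membership in
  \<open>InvQ\<close>\<close>

lemma block_cycle_2:
  assumes "p < q" shows "block_cycle {p, q} p = q" "block_cycle {p, q} q = p"
proof -
  have "sorted_list_of_set {p, q} = [p, q]"
    using assms sorted_list_of_set.idem_if_sorted_distinct[of "[p, q]"] by simp
  then show "block_cycle {p, q} p = q" "block_cycle {p, q} q = p" by (auto simp: transpose_def block_cycle_def)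
qed

lemma block_cycle_3:
  assumes "p < s" "s < q"
  shows "block_cycle {p, s, q} p = q" "block_cycle {p, s, q} s = p" "block_cycle {p, s, q} q = s"
proof -
  have "sorted_list_of_set {p, s, q} = [p, s, q]"
    using assms sorted_list_of_set.idem_if_sorted_distinct[of "[p, s, q]"] by simp
  then show "block_cycle {p, s, q} p = q" "block_cycle {p, s, q} s = p" "block_cycle {p, s, q} q = s"
    using assms by (auto simp: transpose_def block_cycle_def)
qed

lemma block_cycle_4:
  assumes "p < s" "s < t" "t < q"
  shows "block_cycle {p, s, t, q} p = q" "block_cycle {p, s, t, q} s = p"
    "block_cycle {p, s, t, q} t = s" "block_cycle {p, s, t, q} q = t"
proof -
  have "sorted_list_of_set {p, s, t, q} = [p, s, t, q]"
    using assms sorted_list_of_set.idem_if_sorted_distinct[of "[p, s, t, q]"] by simp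
  then show "block_cycle {p, s, t, q} p = q" "block_cycle {p, s, t, q} s = p"
    "block_cycle {p, s, t, q} t = s" "block_cycle {p, s, t, q} q = t"
    using assms by (auto simp: transpose_def block_cycle_def)
qed

lemma transpose_image_exchange:
  assumes "i \<notin> A" "j \<in> A"
  shows "Transposition.transpose i j ` A = insert i (A - {j})"
proof -
  have "Transposition.transpose i j x = (if x = j then i else x)" if "x \<in> A" for x
    using that assms by (auto simp: transpose_def)
  then have "Transposition.transpose i j ` A = (\<lambda>x. if x = j then i else x) ` A" by (rule image_cong[OF refl])
  also have "\<dots> = insert i (A - {j})" using assms by auto
  finally show ?thesis .
qed

lemma exchange_unique:
  assumes eq: "insert i (A - {j}) = insert y (A - {x})" and "i \<notin> A" "j \<in> A" "y \<notin> A" "x \<in> A"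
  shows "i = y \<and> j = x"
proof
  have "i \<in> insert y (A - {x})" using eq[symmetric] by simp
  then show "i = y" using assms(2) by simp
  have "x \<notin> insert i (A - {j})" unfolding eq using assms(4,5) by auto
  then show "j = x" using assms(5) by simp
qed

text \<open>The transposition relating the two permutations carries A to
  \<open>insert i (A - {j})\<close>. It must therefore move one element out of A and one into A,
  which forces it to exchange i and j.\<close>

lemma InvQ_iff:
  assumes A: "A \<in> rsubsets r n"
  shows "(i, j) \<in> InvQ r n A \<longleftrightarrow> 1 \<le> i \<and> i < j \<and> j \<in> A \<and> i \<notin> A \<and>
    (\<exists>w. w \<in> NC n \<and> Transposition.transpose i j \<circ> w \<in> NC n \<and> w ` {1..r} = A)"
proof
  assume "(i, j) \<in> InvQ r n A"
  then have ij: "1 \<le> i" "i < j" "j \<in> A" "i \<notin> A" and "QJ_edge r n A (insert i (A - {j}))"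
    by (auto simp: InvQ_def Inv_def)
  then obtain w u where wu: "kreweras_adjacent n w u" "A = w ` {1..r}" "insert i (A - {j}) = u ` {1..r}"
    unfolding QJ_edge_def by blast
  then obtain x y where xy: "x \<noteq> y" "u = Transposition.transpose x y \<circ> w" "w \<in> NC n" "u \<in> NC n"
    unfolding kreweras_adjacent_def by blast
  have "u ` {1..r} = Transposition.transpose x y ` w ` {1..r}" by (simp only: xy(2) image_comp)
  then have *: "insert i (A - {j}) = Transposition.transpose x y ` A" using wu(2,3) by simp
  have "{x, y} = {i, j}"
  proof (cases "x \<in> A"; cases "y \<in> A")
    assume "x \<in> A" "y \<in> A"
    then have "Transposition.transpose x y ` A = A"
      by (auto simp: transpose_def image_iff)
    then show ?thesis using * ij by blast
  next
    assume "x \<notin> A" "y \<notin> A"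
    then have "Transposition.transpose x y ` A = A"
      by (auto simp: transpose_def image_iff)
    then show ?thesis using * ij by blast
  next
    assume "x \<in> A" "y \<notin> A"
    then have "insert i (A - {j}) = insert y (A - {x})"
      using * transpose_image_exchange[of y A x] by (simp add: transpose_commute)
    from exchange_unique[OF this ij(4,3) \<open>y \<notin> A\<close> \<open>x \<in> A\<close>] show ?thesis by auto
  next
    assume "x \<notin> A" "y \<in> A"
    then have "insert i (A - {j}) = insert x (A - {y})"
      using * transpose_image_exchange[of x A y] by simp
    from exchange_unique[OF this ij(4,3) \<open>x \<notin> A\<close> \<open>y \<in> A\<close>] show ?thesis by auto
  qed
  then have "Transposition.transpose x y = Transposition.transpose i j"
    by (auto simp: doubleton_eq_iff transpose_commute)
  with xy wu ij show "1 \<le> i \<and> i < j \<and> j \<in> A \<and> i \<notin> A \<and>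
    (\<exists>w. w \<in> NC n \<and> Transposition.transpose i j \<circ> w \<in> NC n \<and> w ` {1..r} = A)" by auto
next
  assume "1 \<le> i \<and> i < j \<and> j \<in> A \<and> i \<notin> A \<and>
    (\<exists>w. w \<in> NC n \<and> Transposition.transpose i j \<circ> w \<in> NC n \<and> w ` {1..r} = A)"
  then obtain w where ij: "1 \<le> i" "i < j" "j \<in> A" "i \<notin> A"
    and w: "w \<in> NC n" "Transposition.transpose i j \<circ> w \<in> NC n" "w ` {1..r} = A" by blast
  have AN: "A \<subseteq> {1..n}" "finite A" "card A = r" using rsubsets_sorted_list(1)[OF A] A by (auto simp: rsubsets_def)
  have ijn: "i \<in> {1..n}" "j \<in> {1..n}" using ij AN by auto
  have "insert i (A - {j}) \<in> rsubsets r n"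
    using AN ij ijn card_gt_0_iff[of A] by (auto simp: rsubsets_def card_insert_if)
  moreover have "insert i (A - {j}) = (Transposition.transpose i j \<circ> w) ` {1..r}"
    unfolding image_comp[symmetric] w(3) transpose_image_exchange[OF ij(4,3)] ..
  moreover have "kreweras_adjacent n w (Transposition.transpose i j \<circ> w)"
    unfolding kreweras_adjacent_def using w(1,2) ijn ij(2)
    by (intro conjI bexI[of _ i] bexI[of _ j]) simp_all
  ultimately have "QJ_edge r n A (insert i (A - {j}))"
    unfolding QJ_edge_def using A ij w(3) by (metis (lifting))
  then show "(i, j) \<in> InvQ r n A" using ij by (simp add: InvQ_def Inv_def)
qed

text \<open>
  For the composition \<open>\<alpha>\<close> and \<open>a = r - \<ell>(\<alpha>) + 1\<close>, the difference \<open>\<rho> s - \<rho> (s + 1)\<close> is \<open>\<alpha>_i - 1\<close>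
  with \<open>i = s - a + 1\<close> (and \<open>\<alpha>_1\<close> for \<open>i = 1\<close>); then \<open>A\<close> below is the subset with partition
  \<open>\<lambda>_\<alpha>\<close>, and \<open>T\<close> is the noncrossing tree \<open>Inv\<^sup>Q(A)\<close>.
\<close>

locale staircase =
  fixes r n a :: nat and \<rho> :: "nat \<Rightarrow> nat"
  assumes a1: "1 \<le> a" and a_le: "a \<le> r + 1"
    and \<rho>_anti: "\<And>i j. a \<le> i \<Longrightarrow> i \<le> j \<Longrightarrow> j \<le> r + 1 \<Longrightarrow> \<rho> j \<le> \<rho> i"
    and \<rho>_last: "\<rho> (r + 1) = r" and \<rho>_first: "\<rho> a \<le> n"
    and \<rho>_drop: "a \<le> r \<Longrightarrow> \<rho> (a + 1) < \<rho> a"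
begin

definition P :: "nat set" where "P = {s \<in> {a..r}. \<rho> (s + 1) < \<rho> s}"

definition A :: "nat set" where "A = ({1..r} - P) \<union> \<rho> ` P"

definition pp :: "nat \<Rightarrow> nat" where "pp s = Max {p \<in> P. p \<le> s}"

definition T :: "(nat \<times> nat) set" where
  "T = {(pp s, s) |s. s \<in> A \<and> a \<le> s \<and> s \<le> r} \<union> {(i, \<rho> p) |p i. p \<in> P \<and> \<rho> (p + 1) < i \<and> i < \<rho> p} \<union>
     {(p, \<rho> p) |p. p \<in> P} \<union> {(pp (p - 1), \<rho> p) |p. p \<in> P \<and> a < p}"

lemma P_bounds: "p \<in> P \<Longrightarrow> a \<le> p \<and> 1 \<le> p \<and> p \<le> r" "p \<in> P \<Longrightarrow> \<rho> (p + 1) < \<rho> p"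
  using a1 by (auto simp: P_def)

lemma \<rho>_P_bounds: "p \<in> P \<Longrightarrow> r < \<rho> p \<and> \<rho> p \<le> n"
  using P_bounds[of p] \<rho>_anti[of "p + 1" "r + 1"] \<rho>_anti[of a p] \<rho>_last \<rho>_first by auto

lemma finite_P [simp]: "finite P"
  by (simp add: P_def)

lemma \<rho>_less: "p \<in> P \<Longrightarrow> p < s \<Longrightarrow> s \<le> r + 1 \<Longrightarrow> \<rho> s < \<rho> p"
  using P_bounds[of p] \<rho>_anti[of "p + 1" s] by auto

lemma rn: "r \<le> n"
  using \<rho>_anti[of a "r + 1"] a_le \<rho>_last \<rho>_first by simp

lemma inj_\<rho>: "inj_on \<rho> P"
  by (rule linorder_inj_onI') (use \<rho>_less P_bounds(1) in \<open>fastforce\<close>)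

lemma in_A_iff: "x \<in> A \<longleftrightarrow> (x \<in> {1..r} \<and> x \<notin> P) \<or> (\<exists>p\<in>P. x = \<rho> p)"
  by (auto simp: A_def)

lemma in_A_le: "x \<le> r \<Longrightarrow> x \<in> A \<longleftrightarrow> 1 \<le> x \<and> x \<notin> P"
  using \<rho>_P_bounds by (fastforce simp: in_A_iff)

lemma in_A_gt: "r < x \<Longrightarrow> x \<in> A \<longleftrightarrow> x \<in> \<rho> ` P"
  by (auto simp: in_A_iff)

lemma A_rsubsets: "A \<in> rsubsets r n"
proof -
  have "card A = card ({1..r} - P) + card (\<rho> ` P)"
    unfolding A_def using \<rho>_P_bounds by (intro card_Un_disjoint) fastforce+
  also have "card (\<rho> ` P) = card P" by (rule card_image[OF inj_\<rho>])
  also have "card ({1..r} - P) = r - card P"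
    using P_bounds by (subst card_Diff_subset) auto
  also have "r - card P + card P = r"
    using card_mono[of "{1..r}" P] P_bounds by fastforce
  finally show ?thesis using \<rho>_P_bounds rn by (fastforce simp: rsubsets_def A_def)
qed

lemma a_in_P: "a \<le> r \<Longrightarrow> a \<in> P"
  using \<rho>_drop by (simp add: P_def)

lemma pp_greatest: "a \<le> s \<Longrightarrow> s \<le> r \<Longrightarrow> pp s \<in> P \<and> pp s \<le> s \<and> (\<forall>p\<in>P. p \<le> s \<longrightarrow> p \<le> pp s)"
proof -
  assume s: "a \<le> s" "s \<le> r"
  have "pp s \<in> {p \<in> P. p \<le> s}" unfolding pp_def using a_in_P s by (intro Max_in) auto
  then show ?thesis unfolding pp_def using Max_ge[of "{p \<in> P. p \<le> s}"] by auto
qed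

lemma ppI: "p \<in> P \<Longrightarrow> p \<le> s \<Longrightarrow> (\<And>c. c \<in> P \<Longrightarrow> c \<le> s \<Longrightarrow> c \<le> p) \<Longrightarrow> pp s = p"
  unfolding pp_def by (rule Max_eqI) auto

text \<open>On its way from \<open>\<rho> s\<close> down to \<open>\<rho> (r + 1) = r\<close> the
  staircase passes height t at some drop.\<close>

lemma step_exists:
  assumes "a \<le> s" "s \<le> r + 1" "r < t" "t \<le> \<rho> s"
  shows "\<exists>p\<in>P. s \<le> p \<and> \<rho> (p + 1) < t \<and> t \<le> \<rho> p"
  using assms(2,1,3,4)
proof (induction s rule: inc_induct)
  case base
  then show ?case using \<rho>_last by simp
next
  case (step m)
  show ?case
  proof (cases "t \<le> \<rho> (Suc m)")
    case True
    then show ?thesis using step by (meson Suc_leD le_SucI)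
  next
    case False
    then have "m \<in> P" using step by (auto simp: P_def)
    then show ?thesis using False step by auto
  qed
qed

text \<open>An element p of P is missing from A, so its preimage y exceeds r; as y descends to p, no
  element of the block lies between them. The greatest element of the block is the image of the
  least, which is at most r, so it lies in A and above r, hence in the image of P under \<rho>.
  Noncrossing makes these greatest elements decrease in p, and so does \<rho>; by
  \<open>antimono_bij_unique\<close> they are the \<open>\<rho> p\<close>.\<close>

lemma NC_blocks_match:
  assumes w: "w \<in> NC n" and wA: "w ` {1..r} = A"
    and bb: "NC_blocks n w blk"
    and p: "p \<in> P"
  shows "\<rho> p \<in> blk p" "\<And>y. y \<in> blk p \<Longrightarrow> y \<le> \<rho> p" "\<And>y. y \<in> blk p \<Longrightarrow> y \<le> r \<Longrightarrow> y \<le> p"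
    "\<exists>y\<in>blk p. r < y \<and> w y = p"
proof -
  note b = NC_blocksD[OF bb]
  have perm: "w permutes {1..n}" using w by (simp add: NC_def)
  have PN: "p \<in> {1..n}" if "p \<in> P" for p using P_bounds[OF that] rn by auto
  have fin: "finite (blk p)" if "p \<in> P" for p
  proof (rule finite_subset)
    show "blk p \<subseteq> {1..n}" using b(3)[OF PN[OF that]] by blast
  qed simp
  have pre: "\<exists>y\<in>blk p. r < y \<and> w y = p" if "p \<in> P" for p
  proof -
    from PN[OF that] obtain y where y: "y \<in> {1..n}" "w y = p" using permutes_image[OF perm] by (metis imageE)
    have "y \<notin> {1..r}"
      using imageI[of y "{1..r}" w] y(2) that in_A_le[of p] P_bounds[OF that] unfolding wA by auto
    moreover have "y \<in> blk p" using b(1)[OF y(1)] b(2)[OF y(1) PN[OF that]] b(2)[OF PN[OF that] y(1)] y(2) by auto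
    ultimately show ?thesis using y by (intro bexI[of _ y]) auto
  qed
  have last: "y \<le> p" if "p \<in> P" "y \<in> blk p" "y \<le> r" for p y
  proof -
    from pre[OF that(1)] obtain x where x: "x \<in> blk p" "r < x" "w x = p" by blast
    then have xn: "x \<in> {1..n}" using b(3)[OF PN[OF that(1)] x(1)] by simp
    have "blk x = blk p" using b(2)[OF PN[OF that(1)] xn] x(1) by simp
    then show ?thesis using b(4)[OF xn] x that P_bounds[OF that(1)] by force
  qed
  define \<phi> where "\<phi> p = Max (blk p)" for p
  have \<phi>: "\<phi> p \<in> blk p" "\<And>y. y \<in> blk p \<Longrightarrow> y \<le> \<phi> p" if "p \<in> P" for p
    unfolding \<phi>_def using Max_in[OF fin[OF that]] Max_ge[OF fin[OF that]] b(1)[OF PN[OF that]] by auto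
  have \<phi>_in: "\<phi> p \<in> \<rho> ` P" if "p \<in> P" for p
  proof -
    have gt: "r < \<phi> p" using pre[OF that] \<phi>(2)[OF that] by fastforce
    define z where "z = Min (blk p)"
    have z: "z \<in> blk p" "z \<le> p"
      unfolding z_def using Min_in[OF fin[OF that]] Min_le[OF fin[OF that]] b(1)[OF PN[OF that]] by auto
    have zn: "z \<in> {1..n}" "z \<in> {1..r}" using b(3)[OF PN[OF that] z(1)] z(2) P_bounds[OF that] by auto
    have bz: "blk z = blk p" using b(2)[OF PN[OF that] zn(1)] z by simp
    have wz: "w z \<in> blk p" using b(1)[OF zn(1)] bz by simp
    then have "z \<le> w z" unfolding z_def by (rule Min_le[OF fin[OF that]])
    then have "w z = \<phi> p"
    proof -
      have "\<forall>y\<in>blk z. z \<le> y \<and> y \<le> w z" using b(4)[OF zn(1)] \<open>z \<le> w z\<close> by linarith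
      then have "\<phi> p \<le> w z" using \<phi>(1)[OF that] bz by simp
      then show ?thesis using \<phi>(2)[OF that wz] by simp
    qed
    then have "\<phi> p \<in> A" using imageI[OF zn(2), of w] unfolding wA by simp
    then show ?thesis using in_A_gt[OF gt] by simp
  qed
  have anti: "\<phi> q < \<phi> p" if pq: "p \<in> P" "q \<in> P" "p < q" for p q
  proof (rule ccontr)
    assume "\<not> \<phi> q < \<phi> p"
    have ne: "blk p \<noteq> blk q"
      using last[OF pq(1), of q] P_bounds[OF pq(2)] b(1)[OF PN[OF pq(2)]] pq(3) by auto
    moreover have "\<phi> p \<noteq> \<phi> q"
    proof
      assume eq: "\<phi> p = \<phi> q"
      have "\<phi> p \<in> {1..n}" using b(3)[OF PN[OF pq(1)]] \<phi>(1)[OF pq(1)] by blast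
      then show False using b(2)[OF PN[OF pq(1)]] b(2)[OF PN[OF pq(2)]] \<phi>(1)[OF pq(1)] \<phi>(1)[OF pq(2)] eq ne by metis
    qed
    ultimately have "\<phi> p < \<phi> q" using \<open>\<not> \<phi> q < \<phi> p\<close> by simp
    moreover have "q < \<phi> p" using P_bounds[OF pq(2)] \<phi>_in[OF pq(1)] \<rho>_P_bounds by force
    ultimately have "blk p = blk q"
      using b(5)[OF PN[OF pq(1)] PN[OF pq(2)], of p q "\<phi> p" "\<phi> q"] b(1) PN pq \<phi>(1) by blast
    then show False using ne by simp
  qed
  have "inj_on \<phi> P" by (rule linorder_inj_onI') (use anti in fastforce)
  then have "card (\<phi> ` P) = card (\<rho> ` P)" by (simp add: card_image inj_\<rho>)
  then have "\<phi> ` P = \<rho> ` P" using \<phi>_in by (intro card_subset_eq) auto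
  then have "\<phi> p = \<rho> p" using anti \<rho>_less P_bounds(1) p
    by (intro antimono_bij_unique[of P]) (auto simp: le_SucI)
  then show "\<rho> p \<in> blk p" "\<And>y. y \<in> blk p \<Longrightarrow> y \<le> \<rho> p" using \<phi>[OF p] by auto
  show "\<And>y. y \<in> blk p \<Longrightarrow> y \<le> r \<Longrightarrow> y \<le> p" using last[OF p] by blast
  show "\<exists>y\<in>blk p. r < y \<and> w y = p" by (rule pre[OF p])
qed

text \<open>Let s and t be the preimages of j and i under w. Passing from w to u replaces the chords
  s-j and t-i by s-i and t-j and keeps all others. A third chord has to avoid both pairs, which
  excludes everything but tree edges.\<close>

lemma InvQ_subset_T: "InvQ r n A \<subseteq> T"
proof clarify
  fix i j assume "(i, j) \<in> InvQ r n A"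
  then obtain w where ij: "1 \<le> i" "i < j" "j \<in> A" "i \<notin> A"
    and w: "w \<in> NC n" "w ` {1..r} = A" and u': "Transposition.transpose i j \<circ> w \<in> NC n"
    unfolding InvQ_iff[OF A_rsubsets] by blast
  define u where "u = Transposition.transpose i j \<circ> w"
  have u: "u \<in> NC n" using u' by (simp add: u_def)
  have perm: "w permutes {1..n}" using w by (simp add: NC_def)
  have AN: "A \<subseteq> {1..n}" using A_rsubsets by (simp add: rsubsets_def)
  have jn: "j \<in> {1..n}" and in': "i \<in> {1..n}" using AN ij by auto
  have pre_in: "\<exists>y\<in>{1..r}. w y = c" if "c \<in> A" for c
    using that unfolding w(2)[symmetric] by auto
  obtain s where s: "s \<in> {1..r}" "w s = j" using pre_in[OF ij(3)] by blast
  obtain t where t0: "t \<in> {1..n}" "w t = i" using permutes_image[OF perm] in' by (metis imageE)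
  have "t \<notin> {1..r}" using imageI[of t "{1..r}" w] t0(2) ij(4) unfolding w(2) by auto
  then have t: "t \<in> {1..n}" "r < t" using t0(1) by auto
  have sn: "s \<in> {1..n}" using s rn by auto
  have us: "u s = i" "u t = j" using s t0 by (simp_all add: u_def)
  have u_eq: "u y = c" if "w y = c" "c \<noteq> i" "c \<noteq> j" for y c
    using that by (simp add: u_def transpose_def)
  have pre_out: "\<exists>y\<in>{1..n}. r < y \<and> w y = c \<and> u y = c \<and> y \<noteq> t"
    if "c \<in> {1..n}" "c \<notin> A" "c \<noteq> i" for c
  proof -
    from that(1) obtain y where y: "y \<in> {1..n}" "w y = c" using permutes_image[OF perm] by (metis imageE)
    have "y \<notin> {1..r}" using imageI[of y "{1..r}" w] y(2) that(2) unfolding w(2) by auto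
    moreover have "c \<noteq> j" using that(2) ij(3) by auto
    ultimately show ?thesis using u_eq[OF y(2) that(3)] that(3) t0 y by (intro bexI[of _ y]) auto
  qed
  consider (low) "j \<le> r" | (high) "r < i" | (mid) "i \<le> r" "r < j" by linarith
  then show "(i, j) \<in> T"
  proof cases
    \<comment> \<open>A drop c strictly between i and j has a preimage y above r. Its chord crosses
      t-i in w if t < y, and t-j in u if y < t.\<close>
    case low
    have iP: "i \<in> P" using in_A_le[of i] ij low by auto
    have "c \<le> i" if c: "c \<in> P" "c \<le> j" for c
    proof (rule ccontr)
      assume ci: "\<not> c \<le> i"
      have "c \<notin> A" using c in_A_le[of c] P_bounds by auto
      moreover from this have "c < j" using c(2) ij(3) by (cases "c = j") auto
      moreover have "c \<in> {1..n}" using P_bounds[OF c(1)] rn by auto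
      ultimately obtain y where y: "y \<in> {1..n}" "r < y" "w y = c" "u y = c" "y \<noteq> t"
        using pre_out[of c] ci by auto
      have "\<not> t < y"
        using NC_chords_noncrossing[OF w(1) t(1) y(1)] t0 y ci \<open>c < j\<close> low t(2) by (auto simp: min_def max_def)
      moreover have "\<not> y < t"
        using NC_chords_noncrossing[OF u y(1) t(1)] us y ci \<open>c < j\<close> low t(2) by (auto simp: min_def max_def)
      ultimately show False using y(5) by simp
    qed
    then have "pp j = i" using iP ij by (intro ppI) auto
    moreover have "a \<le> j" using P_bounds[OF iP] ij by auto
    ultimately show ?thesis unfolding T_def using ij low by blast
  next
    \<comment> \<open>If i were too low, some element c of A would lie strictly between i and j,
      with a preimage y in \<open>{1..r}\<close>. Its chord crosses s-j in w if y < s, and s-i in u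
      if s < y.\<close>
    case high
    then obtain p where p: "p \<in> P" "j = \<rho> p" using in_A_gt[of j] ij by auto
    have "\<rho> (p + 1) < i"
    proof (rule ccontr)
      assume "\<not> \<rho> (p + 1) < i"
      then obtain p' where p': "p' \<in> P" "p + 1 \<le> p'" "i \<le> \<rho> p'"
        using step_exists[of "p + 1" i] P_bounds[OF p(1)] high by auto
      define c where "c = \<rho> p'"
      have cA: "c \<in> A" using p' by (auto simp: c_def in_A_iff)
      then have ic: "i < c" using p'(3) ij(4) by (cases "i = c") (auto simp: c_def)
      have cj: "c < j" using \<rho>_less[OF p(1), of p'] p' P_bounds[OF p'(1)] p(2) by (auto simp: c_def)
      obtain y where y: "y \<in> {1..r}" "w y = c" using pre_in[OF cA] by blast
      have uy: "u y = c" using u_eq[OF y(2)] ic cj by simp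
      have yn: "y \<in> {1..n}" using y rn by auto
      have "\<not> y < s"
        using NC_chords_noncrossing[OF w(1) yn sn] s y ic cj high by (auto simp: min_def max_def)
      moreover have "\<not> s < y"
        using NC_chords_noncrossing[OF u sn yn] us uy s y ic cj high by (auto simp: min_def max_def)
      ultimately show False using s y cj by simp
    qed
    then show ?thesis unfolding T_def using p ij by blast
  next
    \<comment> \<open>Here i is a drop and j = \<rho> p for a drop p. If p differs from i, then s
      lies in the block of p and is at most p, and the new chord s-i of u forces i < p. A further
      drop c between i and p would have to precede s, since the blocks of c and p do not cross, and
      then its chord crosses s-i.\<close>
    case mid
    have iP: "i \<in> P" using in_A_le[of i] ij mid by auto
    obtain p where p: "p \<in> P" "j = \<rho> p" using in_A_gt[of j] ij mid by auto
    have iN: "i \<in> {1..n}" and pN: "p \<in> {1..n}" using P_bounds[OF iP] P_bounds[OF p(1)] rn by auto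
    have pA: "p \<notin> A" using in_A_le[of p] p P_bounds[OF p(1)] by auto
    show ?thesis
    proof (cases "p = i")
      case True
      then show ?thesis unfolding T_def using p by blast
    next
      case False
      show ?thesis using w(1)
      proof (rule NC_cases)
        fix blk assume bb: "NC_blocks n w blk"
        note b = NC_blocksD[OF bb]
        note match = NC_blocks_match[OF w bb]
        have jb: "blk j = blk p" using match(1)[OF p(1)] b(2)[OF pN jn] p(2) by simp
        have sb: "blk s = blk p" using b(1)[OF sn] b(2)[OF sn jn] s(2) jb by auto
        have s_min: "s \<le> p" using b(4)[OF sn] s(2) sb b(1)[OF pN] s(1) mid by auto
        obtain y where y: "y \<in> {1..n}" "r < y" "w y = p" "u y = p" "y \<noteq> t"
          using pre_out[OF pN pA False] by blast
        have ip: "i < p"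
        proof (rule ccontr)
          assume "\<not> i < p"
          then have "p < i" using False by simp
          show False
          proof (cases "s = p")
            case True
            then show False using NC_ascent[OF u sn y(1)] us y mid \<open>p < i\<close> by auto
          next
            case False
            then show False using NC_chords_noncrossing[OF u sn y(1)] us y mid \<open>p < i\<close> s_min
              by (auto simp: min_def max_def)
          qed
        qed
        have "c \<le> i" if c: "c \<in> P" "c \<le> p - 1" for c
        proof (rule ccontr)
          assume ci: "\<not> c \<le> i"
          have cp: "c < p" using c ip by simp
          have cN: "c \<in> {1..n}" using P_bounds[OF c(1)] rn by auto
          have cA: "c \<notin> A" using in_A_le[of c] c P_bounds[OF c(1)] by auto
          obtain x where x: "x \<in> {1..n}" "r < x" "w x = c" "u x = c" "x \<noteq> t"
            using pre_out[OF cN cA] ci by auto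
          have xb: "blk x = blk c" using b(1)[OF x(1)] b(2)[OF x(1) cN] x(3) by auto
          have ne: "blk c \<noteq> blk p"
            using match(3)[OF c(1), of p] P_bounds[OF p(1)] b(1)[OF pN] cp by auto
          have "c < s"
          proof (rule ccontr)
            assume "\<not> c < s"
            then have "s < c" using ne sb by (cases "s = c") auto
            then have "blk p = blk c"
              using b(5)[OF pN cN, of s c p x] b(1)[OF sn] b(1)[OF cN] b(1)[OF pN] b(1)[OF x(1)] sb xb cp
                x(2) P_bounds[OF p(1)] by auto
            then show False using ne by simp
          qed
          then show False using NC_chords_noncrossing[OF u sn x(1)] us x ci s
            by (auto simp: min_def max_def)
        qed
        then have "pp (p - 1) = i" using iP ip by (intro ppI) auto
        moreover have "a < p" using P_bounds[OF iP] ip by simp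
        ultimately show ?thesis unfolding T_def using p by blast
      qed
    qed
  qed
qed

end

section \<open>Noncrossing permutations that realise the tree edges\<close>

definition nested_family :: "nat \<Rightarrow> nat set \<Rightarrow> (nat \<Rightarrow> nat set) \<Rightarrow> (nat \<Rightarrow> nat) \<Rightarrow> (nat \<Rightarrow> nat) \<Rightarrow> bool" where
  "nested_family n I X g h \<longleftrightarrow>
    (\<forall>p\<in>I. \<forall>q\<in>I. p < q \<longrightarrow> (\<forall>x\<in>X q. g p < x \<and> x < h p)) \<and>
    (\<forall>p\<in>I. X p \<noteq> {} \<and> (\<forall>x\<in>X p. x \<in> {1..n} \<and> (x \<le> g p \<or> h p \<le> x)))"

definition rotates_blocks :: "nat set \<Rightarrow> (nat \<Rightarrow> nat set) \<Rightarrow> (nat \<Rightarrow> nat) \<Rightarrow> bool" where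
  "rotates_blocks I X w \<longleftrightarrow> (\<forall>p\<in>I. \<forall>x\<in>X p. w x = block_cycle (X p) x) \<and> (\<forall>x. (\<forall>p\<in>I. x \<notin> X p) \<longrightarrow> w x = x)"

lemma nested_family_NC:
  assumes "nested_family n I X g h" and "rotates_blocks I X w"
  shows "w \<in> NC n"
  by (rule NC_intro[of I X g h]) (use assms in \<open>auto simp: nested_family_def rotates_blocks_def\<close>)

lemma rotates_blocks_exists:
  assumes "nested_family n I X g h"
  obtains w where "rotates_blocks I X w"
proof -
  have disj: "\<not> p < q" if "p \<in> I" "q \<in> I" "x \<in> X p" "x \<in> X q" for p q x
    using assms that unfolding nested_family_def by (metis leD)
  have eq: "(SOME q. q \<in> I \<and> x \<in> X q) = p" if "p \<in> I" "x \<in> X p" for p x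
  proof -
    have "\<exists>q. q \<in> I \<and> x \<in> X q" using that by blast
    from someI_ex[OF this] disj[of p _ x] disj[of _ p x] that show ?thesis by (metis linorder_neqE_nat)
  qed
  define w where "w x = (if \<exists>p\<in>I. x \<in> X p then block_cycle (X (SOME p. p \<in> I \<and> x \<in> X p)) x else x)" for x
  have "w x = block_cycle (X p) x" if "p \<in> I" "x \<in> X p" for p x
    using that eq[OF that] unfolding w_def by auto
  moreover have "w x = x" if "\<forall>p\<in>I. x \<notin> X p" for x using that unfolding w_def by auto
  ultimately have "rotates_blocks I X w" by (simp add: rotates_blocks_def)
  then show ?thesis by (rule that)
qed

context staircase
begin

lemma P_facts:
  assumes "p \<in> P" "q \<in> P"
  shows "p < \<rho> q" "p \<noteq> \<rho> q" "\<rho> p \<notin> P" "p \<in> {1..n}" "\<rho> p \<in> {1..n}" "\<rho> p = \<rho> q \<longleftrightarrow> p = q"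
    "p < q \<Longrightarrow> \<rho> q < \<rho> p"
proof -
  show "p < \<rho> q" "p \<noteq> \<rho> q" "p \<in> {1..n}" "\<rho> p \<in> {1..n}"
    using P_bounds(1)[OF assms(1)] \<rho>_P_bounds[OF assms(1)] \<rho>_P_bounds[OF assms(2)] rn by auto
  show "\<rho> p \<notin> P" using P_bounds(1)[of "\<rho> p"] \<rho>_P_bounds[OF assms(1)] by auto
  show "\<rho> p = \<rho> q \<longleftrightarrow> p = q" using inj_\<rho> assms by (auto dest: inj_onD)
  show "p < q \<Longrightarrow> \<rho> q < \<rho> p" using \<rho>_less[OF assms(1)] P_bounds(1)[OF assms(2)] by simp
qed

lemma image_A:
  assumes "\<And>p. p \<in> P \<Longrightarrow> w p = \<rho> p" and "\<And>x. x \<in> {1..r} - P \<Longrightarrow> w x = x"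
  shows "w ` {1..r} = A"
proof -
  have "{1..r} = ({1..r} - P) \<union> P" using P_bounds by auto
  then have "w ` {1..r} = w ` ({1..r} - P) \<union> w ` P" by (metis image_Un)
  also have "w ` ({1..r} - P) = {1..r} - P" using assms(2) by simp
  also have "w ` P = \<rho> ` P" using assms(1) by simp
  finally show ?thesis by (simp add: A_def)
qed

text \<open>The product of the transpositions of p and \<open>\<rho> p\<close>. Its blocks are
  nested because \<rho> decreases strictly on P. Three of the four kinds of edges arise by
  multiplying it with one more transposition.\<close>

lemma base_family:
  obtains w where "w \<in> NC n" "w ` {1..r} = A"
    "\<And>p. p \<in> P \<Longrightarrow> w p = \<rho> p" "\<And>p. p \<in> P \<Longrightarrow> w (\<rho> p) = p" "\<And>x. x \<notin> P \<Longrightarrow> x \<notin> \<rho> ` P \<Longrightarrow> w x = x"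
proof -
  let ?X = "\<lambda>p. {p, \<rho> p}"
  have nest: "nested_family n P ?X (\<lambda>p. p) \<rho>"
    unfolding nested_family_def using P_facts by auto
  obtain w where w: "rotates_blocks P ?X w" using rotates_blocks_exists[OF nest] .
  have wp: "w p = \<rho> p" "w (\<rho> p) = p" if "p \<in> P" for p
    using w that block_cycle_2[OF P_facts(1)[OF that that]] unfolding rotates_blocks_def by auto
  have wx: "w x = x" if "x \<notin> P" "x \<notin> \<rho> ` P" for x
    using w that unfolding rotates_blocks_def by auto
  have "w ` {1..r} = A"
    by (rule image_A[OF wp(1)], assumption, rule wx) (use \<rho>_P_bounds in fastforce)+
  with that nested_family_NC[OF nest w] wp wx show ?thesis by blast
qed

lemma rotates_blocksI:
  assumes "\<And>p x. p \<in> I \<Longrightarrow> x \<in> X p \<Longrightarrow> w x = block_cycle (X p) x"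
    and "\<And>x. (\<And>p. p \<in> I \<Longrightarrow> x \<notin> X p) \<Longrightarrow> w x = x"
  shows "rotates_blocks I X w"
  using assms unfolding rotates_blocks_def by blast

text \<open>The transposition splits the block of p into two fixed points.\<close>

lemma InvQ_drop:
  assumes p: "p \<in> P" shows "(p, \<rho> p) \<in> InvQ r n A"
proof -
  obtain w where w: "w \<in> NC n" "w ` {1..r} = A"
    "\<And>p. p \<in> P \<Longrightarrow> w p = \<rho> p" "\<And>p. p \<in> P \<Longrightarrow> w (\<rho> p) = p" "\<And>x. x \<notin> P \<Longrightarrow> x \<notin> \<rho> ` P \<Longrightarrow> w x = x"
    by (rule base_family, rule that)
  let ?u = "Transposition.transpose p (\<rho> p) \<circ> w" and ?X = "\<lambda>p. {p, \<rho> p}"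
  have "rotates_blocks (P - {p}) ?X ?u"
  proof (rule rotates_blocksI)
    fix q x assume q: "q \<in> P - {p}" and x: "x \<in> {q, \<rho> q}"
    have qP: "q \<in> P" "q \<noteq> p" using q by auto
    show "?u x = block_cycle {q, \<rho> q} x"
      using x block_cycle_2[OF P_facts(1)[OF qP(1) qP(1)]] w(3,4)[OF qP(1)] P_facts[OF qP(1) p] P_facts[OF p qP(1)] qP
      by (auto simp: transpose_def)
  next
    fix x assume x: "\<And>q. q \<in> P - {p} \<Longrightarrow> x \<notin> {q, \<rho> q}"
    show "?u x = x"
    proof (cases "x = p \<or> x = \<rho> p")
      case True
      then show ?thesis using w(3,4)[OF p] by (auto simp: transpose_def)
    next
      case False
      then have "x \<notin> P" "x \<notin> \<rho> ` P" using x by auto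
      then show ?thesis using w(5)[of x] False by (auto simp: transpose_def)
    qed
  qed
  moreover have "nested_family n (P - {p}) ?X (\<lambda>p. p) \<rho>"
    unfolding nested_family_def using P_facts by auto
  ultimately have "?u \<in> NC n" by (intro nested_family_NC)
  moreover have "p \<notin> A" "\<rho> p \<in> A" using p in_A_le[of p] P_bounds(1)[OF p] by (auto simp: in_A_iff)
  ultimately show ?thesis
    unfolding InvQ_iff[OF A_rsubsets] using w(1,2) P_facts(1)[OF p p] P_bounds(1)[OF p] by auto
qed

text \<open>The transposition inserts the fixed point s into the block of p, whose gap now begins at
  s. No drop lies between p and s, so the blocks of later drops remain inside the gap.\<close>

lemma InvQ_low:
  assumes s: "s \<in> A" "a \<le> s" "s \<le> r" shows "(pp s, s) \<in> InvQ r n A"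
proof -
  define p where "p = pp s"
  have sP: "s \<notin> P" using s in_A_le[of s] by simp
  have p: "p \<in> P" "p < s" "\<And>q. q \<in> P \<Longrightarrow> q \<le> s \<Longrightarrow> q \<le> p"
    using pp_greatest[OF s(2,3)] sP unfolding p_def by (auto simp: order.order_iff_strict)
  obtain w where w: "w \<in> NC n" "w ` {1..r} = A"
    "\<And>p. p \<in> P \<Longrightarrow> w p = \<rho> p" "\<And>p. p \<in> P \<Longrightarrow> w (\<rho> p) = p" "\<And>x. x \<notin> P \<Longrightarrow> x \<notin> \<rho> ` P \<Longrightarrow> w x = x"
    by (rule base_family, rule that)
  have s\<rho>: "s < \<rho> q" if "q \<in> P" for q using \<rho>_P_bounds[OF that] s by simp
  let ?u = "Transposition.transpose p s \<circ> w"
  define X where "X q = (if q = p then {p, s, \<rho> p} else {q, \<rho> q})" for q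
  have "rotates_blocks P X ?u"
  proof (rule rotates_blocksI)
    fix q x assume q: "q \<in> P" and x: "x \<in> X q"
    have ws: "w s = s" using w(5)[of s] sP s\<rho> by auto
    show "?u x = block_cycle (X q) x"
    proof (cases "q = p")
      case True
      then show ?thesis
        using x block_cycle_3[OF p(2) s\<rho>[OF p(1)]] w(3,4)[OF p(1)] ws P_facts[OF p(1) p(1)] s\<rho>[OF p(1)]
        by (auto simp: X_def transpose_def)
    next
      case False
      then have X: "X q = {q, \<rho> q}" by (simp add: X_def)
      have "w x = block_cycle (X q) x \<and> w x \<in> {q, \<rho> q}"
        using x block_cycle_2[OF P_facts(1)[OF q q]] w(3,4)[OF q] unfolding X by auto
      moreover have "q \<noteq> p" "q \<noteq> s" "\<rho> q \<noteq> p" "\<rho> q \<noteq> s"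
        using False P_facts(2)[OF p(1) q] s\<rho>[OF q] sP q by auto
      ultimately show ?thesis using transpose_apply_other[of "w x" p s] by auto
    qed
  next
    fix x assume x: "\<And>q. q \<in> P \<Longrightarrow> x \<notin> X q"
    have "x \<noteq> q \<and> x \<noteq> \<rho> q" if "q \<in> P" for q using x[OF that] by (auto simp: X_def split: if_splits)
    then have "x \<notin> P" "x \<notin> \<rho> ` P" by auto
    moreover have "x \<noteq> s" "x \<noteq> p" using x[OF p(1)] by (auto simp: X_def)
    ultimately show "?u x = x" using w(5)[of x] by (auto simp: transpose_def)
  qed
  moreover have "nested_family n P X (\<lambda>q. if q = p then s else q) \<rho>"
    unfolding nested_family_def
  proof (intro conjI ballI impI)
    fix q q' x assume q: "q \<in> P" "q' \<in> P" "q < q'" and x: "x \<in> X q'"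
    show "(if q = p then s else q) < x"
    proof (cases "q = p")
      case True
      then have "\<not> q' \<le> s" using p(3)[OF q(2)] q(3) by auto
      then show ?thesis using True x q P_facts[OF q(2) q(2)] s\<rho>[OF q(2)] by (auto simp: X_def)
    qed (use x q p P_facts[OF q(1) q(2)] in \<open>auto simp: X_def split: if_splits\<close>)
    show "x < \<rho> q" using x q P_facts(7)[OF q] P_facts(1)[OF q(2) q(1)] s\<rho>[OF q(1)] by (auto simp: X_def split: if_splits)
  next
    fix q assume q: "q \<in> P"
    show "X q \<noteq> {}" by (simp add: X_def)
    fix x assume x: "x \<in> X q"
    show "x \<in> {1..n}" using x P_facts[OF q q] s rn a1 by (auto simp: X_def split: if_splits)
    show "x \<le> (if q = p then s else q) \<or> \<rho> q \<le> x" using x p(2) by (auto simp: X_def split: if_splits)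
  qed
  ultimately have "?u \<in> NC n" by (intro nested_family_NC)
  moreover have "p \<notin> A" using p in_A_le[of p] P_bounds(1)[OF p(1)] by auto
  ultimately show ?thesis
    unfolding InvQ_iff[OF A_rsubsets] p_def[symmetric] using w(1,2) p s P_bounds(1)[OF p(1)] by auto
qed

text \<open>The transposition merges the block of p with that of the preceding drop p0. The merged
  block inherits the gap of the inner one; since p0 immediately precedes p among the drops, all
  other blocks remain correctly nested.\<close>

lemma InvQ_adjacent:
  assumes p: "p \<in> P" "a < p" shows "(pp (p - 1), \<rho> p) \<in> InvQ r n A"
proof -
  define p0 where "p0 = pp (p - 1)"
  have p0: "p0 \<in> P" "p0 < p" "\<And>q. q \<in> P \<Longrightarrow> q < p \<Longrightarrow> q \<le> p0"
  proof -
    have *: "p0 \<in> P \<and> p0 \<le> p - 1 \<and> (\<forall>q\<in>P. q \<le> p - 1 \<longrightarrow> q \<le> p0)"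
      unfolding p0_def by (rule pp_greatest) (use p P_bounds(1)[OF p(1)] in auto)
    then show "p0 \<in> P" by blast
    from * show "p0 < p" using p(2) by linarith
    from * show "\<And>q. q \<in> P \<Longrightarrow> q < p \<Longrightarrow> q \<le> p0" by simp
  qed
  obtain w where w: "w \<in> NC n" "w ` {1..r} = A"
    "\<And>p. p \<in> P \<Longrightarrow> w p = \<rho> p" "\<And>p. p \<in> P \<Longrightarrow> w (\<rho> p) = p" "\<And>x. x \<notin> P \<Longrightarrow> x \<notin> \<rho> ` P \<Longrightarrow> w x = x"
    by (rule base_family, rule that)
  note f = P_facts[OF p(1) p(1)] P_facts[OF p0(1) p0(1)] P_facts[OF p(1) p0(1)] P_facts[OF p0(1) p(1)]
  have lt: "p0 < p" "p < \<rho> p" "\<rho> p < \<rho> p0" using f p0(2) by auto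
  let ?u = "Transposition.transpose p0 (\<rho> p) \<circ> w"
  define X where "X q = (if q = p0 then {p0, p, \<rho> p, \<rho> p0} else {q, \<rho> q})" for q
  have "rotates_blocks (P - {p}) X ?u"
  proof (rule rotates_blocksI)
    fix q x assume q': "q \<in> P - {p}" and x: "x \<in> X q"
    then have q: "q \<in> P" "q \<noteq> p" by auto
    show "?u x = block_cycle (X q) x"
    proof (cases "q = p0")
      case True
      then show ?thesis
        using x block_cycle_4[OF lt] w(3,4)[OF p(1)] w(3,4)[OF p0(1)] lt
        by (auto simp: X_def transpose_def)
    next
      case False
      then have X: "X q = {q, \<rho> q}" by (simp add: X_def)
      have "w x = block_cycle (X q) x \<and> w x \<in> {q, \<rho> q}"
        using x block_cycle_2[OF P_facts(1)[OF q(1) q(1)]] w(3,4)[OF q(1)] unfolding X by auto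
      moreover have "q \<noteq> p0" "q \<noteq> \<rho> p" "\<rho> q \<noteq> p0" "\<rho> q \<noteq> \<rho> p"
        using False P_facts(2)[OF q(1) p(1)] P_facts(2)[OF p0(1) q(1)] P_facts(6)[OF q(1) p(1)] q(2) by auto
      ultimately show ?thesis using transpose_apply_other[of "w x" p0 "\<rho> p"] by auto
    qed
  next
    fix x assume x: "\<And>q. q \<in> P - {p} \<Longrightarrow> x \<notin> X q"
    have x0: "x \<notin> {p0, p, \<rho> p, \<rho> p0}" using x[of p0] p0 by (auto simp: X_def)
    have "x \<notin> {q, \<rho> q}" if "q \<in> P" for q
      using x[of q] x0 that by (cases "q = p \<or> q = p0") (auto simp: X_def)
    then have "x \<notin> P" "x \<notin> \<rho> ` P" by auto
    then have "w x = x" by (rule w(5))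
    then show "?u x = x" using x0 by (simp add: transpose_def)
  qed
  moreover have "nested_family n (P - {p}) X (\<lambda>q. if q = p0 then p else q) (\<lambda>q. if q = p0 then \<rho> p else \<rho> q)"
    unfolding nested_family_def
  proof (intro conjI ballI impI)
    fix q q' x assume q0: "q \<in> P - {p}" "q' \<in> P - {p}" "q < q'" and x: "x \<in> X q'"
    then have q: "q \<in> P" "q' \<in> P" "q < q'" "q \<noteq> p" "q' \<noteq> p" by auto
    note lts = P_facts(1)[OF q(1,2)] P_facts(1)[OF q(2,1)] P_facts(7)[OF q(1-3)]
    have "(if q = p0 then p else q) < x \<and> x < (if q = p0 then \<rho> p else \<rho> q)"
    proof (cases "q = p0")
      case True
      then have "p < q'" using p0(3)[OF q(2)] q(3,5) by linarith
      moreover from this have "\<rho> q' < \<rho> p" using P_facts(7)[OF p(1) q(2)] by simp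
      moreover have "x \<in> {q', \<rho> q'}" using x True q(3) by (auto simp: X_def)
      ultimately show ?thesis using True P_facts(1)[OF q(2) p(1)] P_facts(1)[OF p(1) q(2)] by auto
    next
      case q_ne: False
      show ?thesis
      proof (cases "q' = p0")
        case True
        then have "x \<in> {p0, p, \<rho> p, \<rho> p0}" using x by (simp add: X_def)
        moreover have "q < p0" "\<rho> p0 < \<rho> q" using True q(3) lts by auto
        ultimately show ?thesis
          using q_ne lt P_facts(1)[OF p0(1) q(1)] P_facts(1)[OF p(1) q(1)] by auto
      next
        case False
        then have "x \<in> {q', \<rho> q'}" using x by (simp add: X_def)
        then show ?thesis using q_ne lts q(3) by auto
      qed
    qed
    then show "(if q = p0 then p else q) < x" "x < (if q = p0 then \<rho> p else \<rho> q)" by auto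
  next
    fix q assume q: "q \<in> P - {p}"
    show "X q \<noteq> {}" by (simp add: X_def)
    fix x assume x: "x \<in> X q"
    show "x \<in> {1..n}" using x P_facts[of q q] q f by (auto simp: X_def split: if_splits)
    show "x \<le> (if q = p0 then p else q) \<or> (if q = p0 then \<rho> p else \<rho> q) \<le> x"
      using x lt by (auto simp: X_def split: if_splits)
  qed
  ultimately have "?u \<in> NC n" by (intro nested_family_NC)
  moreover have "p0 \<notin> A" "\<rho> p \<in> A" using p0 p in_A_le[of p0] P_bounds(1)[OF p0(1)] by (auto simp: in_A_iff)
  ultimately show ?thesis
    unfolding InvQ_iff[OF A_rsubsets] p0_def[symmetric] using w(1,2) f P_bounds(1)[OF p0(1)] by auto
qed

text \<open>The base permutation does not serve here: multiplied by the transposition it would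
  contain the increasing 3-cycle of p, i, \<open>\<rho> p\<close>. Starting instead from a
  permutation with block {p, i, \<rho> p}, the transposition splits it into {p, i} and a fixed
  point.\<close>

lemma InvQ_high:
  assumes p: "p \<in> P" and i: "\<rho> (p + 1) < i" "i < \<rho> p" shows "(i, \<rho> p) \<in> InvQ r n A"
proof -
  have ir: "r < i" using i(1) \<rho>_anti[of "p + 1" "r + 1"] P_bounds(1)[OF p] \<rho>_last by auto
  have i_less: "\<rho> q < i" if "q \<in> P" "p < q" for q
    using \<rho>_anti[of "p + 1" q] P_bounds(1)[OF p] P_bounds(1)[OF that(1)] that(2) i(1) by auto
  have i\<rho>: "i \<noteq> \<rho> q" "i < \<rho> q \<or> p < q" if "q \<in> P" for q
    using i_less[OF that] P_facts(7)[OF that p] i(2) by (cases q p rule: linorder_cases; auto)+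
  have iP: "i \<notin> P" using P_bounds(1)[of i] ir by auto
  have pi: "p < i" using P_bounds(1)[OF p] ir by simp
  define X where "X q = (if q = p then {p, i, \<rho> p} else {q, \<rho> q})" for q
  have nest: "nested_family n P X (\<lambda>q. q) (\<lambda>q. if q = p then i else \<rho> q)"
    unfolding nested_family_def
  proof (intro conjI ballI impI)
    fix q q' x assume q: "q \<in> P" "q' \<in> P" "q < q'" and x: "x \<in> X q'"
    note g = P_facts[OF q(1,2)] P_facts[OF q(2,1)] P_facts[OF q(2,2)] q(3)
    show "q < x" using x g pi by (auto simp: X_def split: if_splits)
    show "x < (if q = p then i else \<rho> q)"
      using x g i_less[OF q(2)] P_bounds(1)[OF q(2)] ir i\<rho>[OF q(1)] by (auto simp: X_def split: if_splits)
  next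
    fix q assume q: "q \<in> P"
    show "X q \<noteq> {}" by (simp add: X_def)
    fix x assume x: "x \<in> X q"
    show "x \<in> {1..n}" using x P_facts[OF q q] P_facts[OF p p] i pi by (auto simp: X_def split: if_splits)
    show "x \<le> q \<or> (if q = p then i else \<rho> q) \<le> x" using x i by (auto simp: X_def split: if_splits)
  qed
  obtain w where w: "rotates_blocks P X w" using rotates_blocks_exists[OF nest] .
  have wp: "w p = \<rho> p" "w i = p" "w (\<rho> p) = i"
    using w p block_cycle_3[OF pi i(2)] unfolding rotates_blocks_def X_def by (auto dest!: bspec[OF _ p])
  have wq: "w q = \<rho> q" "w (\<rho> q) = q" if "q \<in> P" "q \<noteq> p" for q
    using w that block_cycle_2[OF P_facts(1)[OF that(1) that(1)]] unfolding rotates_blocks_def X_def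
    by (auto dest!: bspec[OF _ that(1)])
  have wx: "w x = x" if "x \<notin> P" "x \<notin> \<rho> ` P" "x \<noteq> i" for x
  proof -
    have "\<forall>q\<in>P. x \<notin> X q" using that p by (auto simp: X_def)
    then show ?thesis using w unfolding rotates_blocks_def by blast
  qed
  have "w ` {1..r} = A"
  proof (rule image_A)
    show "w q = \<rho> q" if "q \<in> P" for q using wp wq that by (cases "q = p") auto
    show "w x = x" if "x \<in> {1..r} - P" for x by (rule wx) (use that ir \<rho>_P_bounds in fastforce)+
  qed
  moreover have "w \<in> NC n" using nest w by (rule nested_family_NC)
  moreover have "Transposition.transpose i (\<rho> p) \<circ> w \<in> NC n"
  proof (rule nested_family_NC)
    define Y where "Y q = (if q = p then {p, i} else {q, \<rho> q})" for q
    show "nested_family n P Y (\<lambda>q. q) (\<lambda>q. if q = p then i else \<rho> q)"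
      using nest unfolding nested_family_def Y_def X_def by auto
    show "rotates_blocks P Y (Transposition.transpose i (\<rho> p) \<circ> w)"
    proof (rule rotates_blocksI)
      fix q x assume q: "q \<in> P" and x: "x \<in> Y q"
      show "(Transposition.transpose i (\<rho> p) \<circ> w) x = block_cycle (Y q) x"
      proof (cases "q = p")
        case True
        then show ?thesis using x block_cycle_2[OF pi] wp P_facts[OF p p] pi i
          by (auto simp: Y_def transpose_def)
      next
        case False
        then have Y: "Y q = {q, \<rho> q}" by (simp add: Y_def)
        have "w x = block_cycle (Y q) x \<and> w x \<in> {q, \<rho> q}"
          using x block_cycle_2[OF P_facts(1)[OF q q]] wq[OF q False] unfolding Y by auto
        moreover have "q \<noteq> i" "q \<noteq> \<rho> p" "\<rho> q \<noteq> i" "\<rho> q \<noteq> \<rho> p"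
          using False P_facts(2)[OF q p] P_facts(6)[OF q p] i\<rho>[OF q] iP q by auto
        ultimately show ?thesis using transpose_apply_other[of "w x" i "\<rho> p"] by auto
      qed
    next
      fix x assume x: "\<And>q. q \<in> P \<Longrightarrow> x \<notin> Y q"
      show "(Transposition.transpose i (\<rho> p) \<circ> w) x = x"
      proof (cases "x = \<rho> p")
        case True
        then show ?thesis using wp by (auto simp: transpose_def)
      next
        case False
        have "x \<noteq> q \<and> x \<noteq> \<rho> q" if "q \<in> P" for q
          using x[OF that] False by (auto simp: Y_def split: if_splits)
        then have "x \<notin> P" "x \<notin> \<rho> ` P" by auto
        moreover have "x \<noteq> i" using x[OF p] by (auto simp: Y_def)
        ultimately show ?thesis using wx[of x] False by (auto simp: transpose_def)
      qed
    qed
  qed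
  moreover have "i \<notin> A" using in_A_gt[OF ir] i\<rho> by auto
  moreover have "\<rho> p \<in> A" using p by (auto simp: in_A_iff)
  ultimately show ?thesis unfolding InvQ_iff[OF A_rsubsets] using i(2) pi P_bounds(1)[OF p] by auto
qed

theorem InvQ_eq_T: "InvQ r n A = T"
proof
  show "InvQ r n A \<subseteq> T" by (rule InvQ_subset_T)
  show "T \<subseteq> InvQ r n A" unfolding T_def
    using InvQ_drop InvQ_low InvQ_adjacent InvQ_high by auto
qed

end

section \<open>Cells as spans of families\<close>

lemma frames_of_colspan:
  assumes "M \<in> frames r n" and "N \<in> carrier_mat n r" and "colspan n N = colspan n M"
  shows "N \<in> frames r n"
  using assms unfolding frames_def vec_space.rank_def vec_space.col_space_def by simp

lemma poly_funs_left_mult: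
  assumes "p \<in> poly_funs r n" and g: "g \<in> carrier_mat n n"
  obtains p' where "p' \<in> poly_funs r n" "\<And>M. M \<in> carrier_mat n r \<Longrightarrow> p' M = p (g * M)"
proof
  let ?\<Phi> = "\<lambda>M. mat n r (\<lambda>(i, j). \<Sum>k<n. g $$ (i, k) * M $$ (k, j))"
  show "(\<lambda>M. p (?\<Phi> M)) \<in> poly_funs r n"
    by (rule poly_funs_comp[OF assms(1)]) (auto intro!: poly_funs_sum intro: poly_funs.intros)
  fix M :: "complex mat" assume "M \<in> carrier_mat n r"
  then have "?\<Phi> M = g * M"
    using g by (intro eq_matI) (auto simp: scalar_prod_def atLeast0LessThan)
  then show "p (?\<Phi> M) = p (g * M)" by simp
qed

lemma poly_expr_mult: "(\<exists>P. \<forall>t. f t = poly P t) \<Longrightarrow> (\<exists>P. \<forall>t. g t = poly P t) \<Longrightarrow> \<exists>P. \<forall>t. f t * g t = poly P (t :: complex)"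
  by (metis poly_mult)

lemma poly_expr_sum: "(\<And>k. k \<in> K \<Longrightarrow> \<exists>P. \<forall>t. f k t = poly P t) \<Longrightarrow> \<exists>P. \<forall>t. (\<Sum>k\<in>K. f k t) = poly P (t :: complex)"
proof (induction K rule: infinite_finite_induct)
  case (insert k K)
  obtain P Q where "\<forall>t. f k t = poly P t" "\<forall>t. (\<Sum>k\<in>K. f k t) = poly Q t"
    using insert by (metis insert_iff)
  then show ?case using insert by (intro exI[of _ "P + Q"]) simp
qed (auto intro: exI[of _ 0])

lemma poly_expr_linear: "\<exists>P. \<forall>t. c + t * d = poly P (t :: complex)"
  by (rule exI[of _ "[:c, d:]"]) simp

text \<open>Moving e_i to the unit vector of \<open>x i\<close> moves the value at i to the place
  \<open>x i\<close>, hence the inverse.\<close>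

lemma perm_matrix_fun_vec:
  assumes x: "x permutes {1..n}"
  shows "perm_matrix n x *\<^sub>v fun_vec n f = fun_vec n (f \<circ> Hilbert_Choice.inv x)"
proof (rule eq_vecI)
  fix k assume "k < dim_vec (fun_vec n (f \<circ> Hilbert_Choice.inv x))"
  then have k: "k < n" by simp
  define i0 where "i0 = Hilbert_Choice.inv x (Suc k)"
  have i0: "i0 \<in> {1..n}" using k permutes_in_image[OF permutes_inv[OF x], of "Suc k"] by (simp add: i0_def)
  have "(perm_matrix n x *\<^sub>v fun_vec n f) $ k = (\<Sum>i<n. (if k + 1 = x (i + 1) then 1 else 0) * f (Suc i))"
    using k by (auto simp: perm_matrix_def fun_vec_def scalar_prod_def atLeast0LessThan intro!: sum.cong)
  also have "\<dots> = (\<Sum>i<n. if i = i0 - 1 then f (Suc i) else 0)"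
  proof (intro sum.cong refl)
    fix i assume "i \<in> {..<n}"
    have "k + 1 = x (i + 1) \<longleftrightarrow> i + 1 = i0"
      unfolding i0_def using permutes_inverses[OF x] by (metis Suc_eq_plus1)
    also have "\<dots> \<longleftrightarrow> i = i0 - 1" using i0 by auto
    finally show "(if k + 1 = x (i + 1) then 1 else 0) * f (Suc i) = (if i = i0 - 1 then f (Suc i) else 0)" by simp
  qed
  also have "\<dots> = f i0" using i0 by auto
  finally show "(perm_matrix n x *\<^sub>v fun_vec n f) $ k = fun_vec n (f \<circ> Hilbert_Choice.inv x) $ k"
    using k by (simp add: fun_vec_def i0_def)
qed (simp add: perm_matrix_def)

lemma perm_matrix_carrier [simp]: "perm_matrix n x \<in> carrier_mat n n"
  by (simp add: perm_matrix_def)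

lemma mat_act_span:
  assumes x: "x permutes {1..n}" and K: "finite K"
  shows "mat_act (perm_matrix n x) (fun_vec n ` fs.span (v ` K)) =
    fun_vec n ` fs.span ((\<lambda>k. v k \<circ> Hilbert_Choice.inv x) ` K)"
proof -
  have eq: "(\<Sum>k\<in>K. fscale (c k) (v k)) \<circ> Hilbert_Choice.inv x =
      (\<Sum>k\<in>K. fscale (c k) (v k \<circ> Hilbert_Choice.inv x))" for c
    by (auto simp: fun_eq_iff fscale_apply)
  have "mat_act (perm_matrix n x) (fun_vec n ` fs.span (v ` K)) =
      (\<lambda>f. fun_vec n (f \<circ> Hilbert_Choice.inv x)) ` fs.span (v ` K)"
    unfolding mat_act_def image_image perm_matrix_fun_vec[OF x] ..
  also have "\<dots> = fun_vec n ` (\<lambda>f. f \<circ> Hilbert_Choice.inv x) ` fs.span (v ` K)" by (simp only: image_image)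
  also have "(\<lambda>f. f \<circ> Hilbert_Choice.inv x) ` fs.span (v ` K) = fs.span ((\<lambda>k. v k \<circ> Hilbert_Choice.inv x) ` K)"
  proof (intro equalityI subsetI)
    fix f assume "f \<in> (\<lambda>f. f \<circ> Hilbert_Choice.inv x) ` fs.span (v ` K)"
    then obtain g where g: "g \<in> fs.span (v ` K)" "f = g \<circ> Hilbert_Choice.inv x" by blast
    from g(1) have "\<exists>c. g = (\<Sum>k\<in>K. fscale (c k) (v k))" unfolding span_image_iff[OF K] .
    then obtain c where "g = (\<Sum>k\<in>K. fscale (c k) (v k))" by (rule exE)
    then have "f = (\<Sum>k\<in>K. fscale (c k) (v k \<circ> Hilbert_Choice.inv x))" using eq g(2) by simp
    then show "f \<in> fs.span ((\<lambda>k. v k \<circ> Hilbert_Choice.inv x) ` K)"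
      unfolding span_image_iff[OF K, of _ "\<lambda>k. v k \<circ> Hilbert_Choice.inv x"] by (intro exI[of _ c])
  next
    fix f assume "f \<in> fs.span ((\<lambda>k. v k \<circ> Hilbert_Choice.inv x) ` K)"
    then have "\<exists>c. f = (\<Sum>k\<in>K. fscale (c k) (v k \<circ> Hilbert_Choice.inv x))"
      unfolding span_image_iff[OF K, of _ "\<lambda>k. v k \<circ> Hilbert_Choice.inv x"] .
    then obtain c where "f = (\<Sum>k\<in>K. fscale (c k) (v k \<circ> Hilbert_Choice.inv x))" by (rule exE)
    then have "f = (\<Sum>k\<in>K. fscale (c k) (v k)) \<circ> Hilbert_Choice.inv x" using eq by simp
    moreover have "(\<Sum>k\<in>K. fscale (c k) (v k)) \<in> fs.span (v ` K)"
      by (intro fs.span_sum fs.span_scale fs.span_base imageI)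
    ultimately show "f \<in> (\<lambda>f. f \<circ> Hilbert_Choice.inv x) ` fs.span (v ` K)" by blast
  qed
  finally show ?thesis .
qed

lemma perm_matrix_frames:
  assumes x: "x permutes {1..n}" and M: "M \<in> frames r n"
  shows "perm_matrix n x * M \<in> frames r n"
    "colspan n (perm_matrix n x * M) = mat_act (perm_matrix n x) (colspan n M)"
proof -
  have Mc: "M \<in> carrier_mat n r" using M by (simp add: frames_def)
  have Pc: "perm_matrix n x * M \<in> carrier_mat n r" by (rule mult_carrier_mat[OF perm_matrix_carrier Mc])
  show "colspan n (perm_matrix n x * M) = mat_act (perm_matrix n x) (colspan n M)"
    using mat_act_colspan[OF perm_matrix_carrier Mc] by simp
  have inj: "w = 0\<^sub>v n" if w: "w \<in> carrier_vec n" and 0: "perm_matrix n x *\<^sub>v w = 0\<^sub>v n" for w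
  proof (rule eq_vecI)
    fix i assume "i < dim_vec (0\<^sub>v n :: complex vec)"
    then have i: "i < n" by simp
    define f where "f j = w $ (j - 1)" for j
    have wf: "w = fun_vec n f" using w by (intro eq_vecI) (auto simp: fun_vec_def f_def)
    have xi: "x (Suc i) \<in> {1..n}" using permutes_in_image[OF x, of "Suc i"] i by simp
    have "fun_vec n (f \<circ> Hilbert_Choice.inv x) $ (x (Suc i) - 1) = 0\<^sub>v n $ (x (Suc i) - 1)"
      using 0 unfolding wf perm_matrix_fun_vec[OF x] by simp
    then show "w $ i = 0\<^sub>v n $ i"
      using xi i permutes_inverses(2)[OF x] by (auto simp: fun_vec_def f_def)
  qed (use w in auto)
  show "perm_matrix n x * M \<in> frames r n" unfolding frames_iff_injective
  proof (intro conjI ballI impI Pc)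
    fix v :: "complex vec" assume v: "v \<in> carrier_vec r" and 0: "perm_matrix n x * M *\<^sub>v v = 0\<^sub>v n"
    have "M *\<^sub>v v \<in> carrier_vec n" using Mc v by (rule mult_mat_vec_carrier)
    moreover have "perm_matrix n x *\<^sub>v (M *\<^sub>v v) = 0\<^sub>v n"
      using 0 unfolding assoc_mult_mat_vec[OF perm_matrix_carrier Mc v] .
    ultimately have "M *\<^sub>v v = 0\<^sub>v n" by (rule inj)
    then show "v = 0\<^sub>v r" using M v unfolding frames_iff_injective by blast
  qed
qed

lemma triangular_span_eq:
  fixes v N :: "nat \<Rightarrow> nat \<Rightarrow> complex"
  assumes "\<And>s. s \<in> {1..k} \<Longrightarrow> \<exists>c. c \<noteq> 0 \<and> v s - fscale c (N s) \<in> fs.span (N ` {1..<s})"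
  shows "fs.span (v ` {1..k}) = fs.span (N ` {1..k})"
  using assms
proof (induction k)
  case (Suc k)
  have upto: "f ` {1..Suc k} = insert (f (Suc k)) (f ` {1..k})" for f :: "nat \<Rightarrow> nat \<Rightarrow> complex"
    by (simp add: atLeastAtMostSuc_conv)
  have IH: "fs.span (v ` {1..k}) = fs.span (N ` {1..k})" using Suc by simp
  have "\<exists>c. c \<noteq> 0 \<and> v (Suc k) - fscale c (N (Suc k)) \<in> fs.span (N ` {1..<Suc k})"
    by (rule Suc.prems) simp
  then obtain c where c: "c \<noteq> 0" "v (Suc k) - fscale c (N (Suc k)) \<in> fs.span (N ` {1..k})"
    unfolding atLeastLessThanSuc_atLeastAtMost by blast
  define d where "d = v (Suc k) - fscale c (N (Suc k))"
  have d: "d \<in> fs.span (N ` {1..k})" "d \<in> fs.span (v ` {1..k})" using c IH by (simp_all add: d_def)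
  have "v (Suc k) = d + fscale c (N (Suc k))" by (simp add: d_def)
  moreover have "d \<in> fs.span (insert (N (Suc k)) (N ` {1..k}))" by (rule span_monoD[OF d(1)]) auto
  ultimately have 1: "v (Suc k) \<in> fs.span (N ` {1..Suc k})"
    unfolding upto by (auto intro!: fs.span_add fs.span_scale intro: fs.span_base)
  have "N (Suc k) = fscale (1 / c) (v (Suc k) - d)" using c(1) by (auto simp: d_def fun_eq_iff fscale_apply)
  moreover have "d \<in> fs.span (insert (v (Suc k)) (v ` {1..k}))" by (rule span_monoD[OF d(2)]) auto
  ultimately have 2: "N (Suc k) \<in> fs.span (v ` {1..Suc k})"
    unfolding upto by (auto intro!: fs.span_diff fs.span_scale intro: fs.span_base)
  have sub: "fs.span (f ` {1..k}) \<subseteq> fs.span (f ` {1..Suc k})" for f :: "nat \<Rightarrow> nat \<Rightarrow> complex"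
    by (intro fs.span_mono) auto
  show ?case
  proof
    have "v ` {1..k} \<subseteq> fs.span (N ` {1..Suc k})" using IH sub[of N] fs.span_superset[of "v ` {1..k}"] by blast
    then show "fs.span (v ` {1..Suc k}) \<subseteq> fs.span (N ` {1..Suc k})"
      using 1 upto[of v] by (intro fs.span_minimal) auto
    have "N ` {1..k} \<subseteq> fs.span (v ` {1..Suc k})" using IH sub[of v] fs.span_superset[of "N ` {1..k}"] by blast
    then show "fs.span (N ` {1..Suc k}) \<subseteq> fs.span (v ` {1..Suc k})"
      using 2 upto[of N] by (intro fs.span_minimal) auto
  qed
qed simp

text \<open>Columns are indexed by their pivots instead of their positions in a sorted list, so that
  permutations can act on the indices.\<close>

lemma cell_iff:
  assumes A: "A \<in> rsubsets r n"
  shows "V \<in> cell r n A I \<longleftrightarrow> (\<exists>m. (\<forall>a\<in>A. m a \<in> supported {1..n} \<and> m a a = 1 \<and>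
    (\<forall>i\<in>{1..n}. i \<noteq> a \<and> (i, a) \<notin> I \<longrightarrow> m a i = 0)) \<and> V = fun_vec n ` fs.span (m ` A))"
proof
  note as = rsubsets_sorted_list[OF A]
  let ?as = "sorted_list_of_set A"
  have AN: "A \<subseteq> {1..n}" using A by (simp add: rsubsets_def)
  have dist: "?as ! k = ?as ! l \<longleftrightarrow> k = l" if "k < r" "l < r" for k l
    using that as(3) by (simp add: nth_eq_iff_index_eq)
  {
    assume "V \<in> cell r n A I"
    then obtain M where M: "M \<in> carrier_mat n r" "V = colspan n M"
      and all: "\<forall>i\<in>{1..n}. \<forall>j\<in>{1..r}. let a = ?as ! (j - 1) in
        (i = a \<longrightarrow> M $$ (i - 1, j - 1) = 1) \<and> (i \<noteq> a \<and> (i, a) \<notin> I \<longrightarrow> M $$ (i - 1, j - 1) = 0)"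
      unfolding cell_def by (elim CollectE exE conjE)
    obtain y where y: "M = fam_mat n r y" "\<And>k. y k \<in> supported {1..n}" using supported_fam[OF M(1)] by blast
    define m where "m a = y (THE k. k < r \<and> ?as ! k = a)" for a
    have my: "m (?as ! k) = y k" if "k < r" for k
    proof -
      have "(THE l. l < r \<and> ?as ! l = ?as ! k) = k" using dist that by (intro the_equality) auto
      then show ?thesis by (simp add: m_def)
    qed
    have ent: "(i = ?as ! k \<longrightarrow> y k i = 1) \<and> (i \<noteq> ?as ! k \<and> (i, ?as ! k) \<notin> I \<longrightarrow> y k i = 0)"
      if "i \<in> {1..n}" "k < r" for i k
    proof -
      have "Suc k \<in> {1..r}" using that by simp
      from bspec[OF bspec[OF all that(1)] this] show ?thesis
        using that by (auto simp: Let_def y(1) fam_mat_def)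
    qed
    show "\<exists>m. (\<forall>a\<in>A. m a \<in> supported {1..n} \<and> m a a = 1 \<and>
      (\<forall>i\<in>{1..n}. i \<noteq> a \<and> (i, a) \<notin> I \<longrightarrow> m a i = 0)) \<and> V = fun_vec n ` fs.span (m ` A)"
    proof (intro exI[of _ m] conjI ballI)
      fix a assume a: "a \<in> A"
      then have "a \<in> set ?as" by (simp only: as(2))
      then obtain k where k: "k < r" "a = ?as ! k" unfolding in_set_conv_nth as(3) by blast
      have an: "a \<in> {1..n}" using a AN by blast
      show "m a \<in> supported {1..n}" using my[OF k(1)] y(2) k(2) by simp
      show "m a a = 1" using my[OF k(1)] ent[OF an k(1)] k(2) by simp
      show "i \<noteq> a \<and> (i, a) \<notin> I \<longrightarrow> m a i = 0" if "i \<in> {1..n}" for i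
        using my[OF k(1)] ent[OF that k(1)] k(2) by simp
    next
      have "m ` A = y ` {..<r}" unfolding image_sorted_list[OF A] using my by (intro image_cong) auto
      then show "V = fun_vec n ` fs.span (m ` A)" using M(2) unfolding y(1) colspan_fam_mat by simp
    qed
  next
    assume "\<exists>m. (\<forall>a\<in>A. m a \<in> supported {1..n} \<and> m a a = 1 \<and>
      (\<forall>i\<in>{1..n}. i \<noteq> a \<and> (i, a) \<notin> I \<longrightarrow> m a i = 0)) \<and> V = fun_vec n ` fs.span (m ` A)"
    then obtain m where mm: "\<forall>a\<in>A. m a \<in> supported {1..n} \<and> m a a = 1 \<and>
      (\<forall>i\<in>{1..n}. i \<noteq> a \<and> (i, a) \<notin> I \<longrightarrow> m a i = 0)" and V: "V = fun_vec n ` fs.span (m ` A)"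
      by (elim exE conjE)
    have m: "m a a = 1" "\<And>i. i \<in> {1..n} \<Longrightarrow> i \<noteq> a \<Longrightarrow> (i, a) \<notin> I \<Longrightarrow> m a i = 0" if "a \<in> A" for a
      using bspec[OF mm that] by blast+
    let ?M = "fam_mat n r (\<lambda>k. m (?as ! k))"
    have "V = colspan n ?M" unfolding colspan_fam_mat V image_sorted_list[OF A] ..
    moreover have "\<forall>i\<in>{1..n}. \<forall>j\<in>{1..r}. let a = ?as ! (j - 1) in
        (i = a \<longrightarrow> ?M $$ (i - 1, j - 1) = 1) \<and> (i \<noteq> a \<and> (i, a) \<notin> I \<longrightarrow> ?M $$ (i - 1, j - 1) = 0)"
    proof (intro ballI)
      fix i j assume ij: "i \<in> {1..n}" "j \<in> {1..r}"
      have "?as ! (j - 1) \<in> A" by (rule as(6)) (use ij in auto)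
      note ma = m[OF this]
      have ent: "?M $$ (i - 1, j - 1) = m (?as ! (j - 1)) i" using ij by (auto simp: fam_mat_def)
      show "let a = ?as ! (j - 1) in
        (i = a \<longrightarrow> ?M $$ (i - 1, j - 1) = 1) \<and> (i \<noteq> a \<and> (i, a) \<notin> I \<longrightarrow> ?M $$ (i - 1, j - 1) = 0)"
        unfolding Let_def ent using ma ij by blast
    qed
    ultimately show "V \<in> cell r n A I" unfolding cell_def by (intro CollectI exI[of _ ?M] conjI) auto
  }
qed

text \<open>Gaussian elimination: each \<open>l k\<close> is cleared at the earlier pivots and
  normalised at its own; at the later ones it vanishes by its support. The reduced family has the
  shape of a cell matrix.\<close>

lemma schubert_cellI:
  assumes C: "C \<in> rsubsets r n"
    and l: "\<And>k. k \<in> {1..r} \<Longrightarrow> l k \<in> supported ({1..n} \<inter> {..sorted_list_of_set C ! (k - 1)})"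
    and nz: "\<And>k. k \<in> {1..r} \<Longrightarrow> l k (sorted_list_of_set C ! (k - 1)) \<noteq> 0"
  shows "fun_vec n ` fs.span (l ` {1..r}) \<in> cell r n C (Inv C)"
proof -
  note cs = rsubsets_sorted_list[OF C]
  define c where "c k = sorted_list_of_set C ! (k - 1)" for k
  have c_less: "c i < c j" if "1 \<le> i" "i < j" "j \<le> r" for i j
    unfolding c_def using that by (intro cs(4)) auto
  have "\<exists>m. \<forall>i\<in>{1..k}. m i \<in> supported ({1..n} \<inter> {..c i}) \<and> (\<forall>j\<in>{1..k}. m i (c j) = (if i = j then 1 else 0)) \<and>
      (\<exists>d. d \<noteq> 0 \<and> l i - fscale d (m i) \<in> fs.span (m ` {1..<i}))" if "k \<le> r" for k
    using that
  proof (induction k)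
    case (Suc k)
    then have "k \<le> r" by simp
    from Suc.IH[OF this] obtain m where mm: "\<forall>i\<in>{1..k}. m i \<in> supported ({1..n} \<inter> {..c i}) \<and>
      (\<forall>j\<in>{1..k}. m i (c j) = (if i = j then 1 else 0)) \<and>
      (\<exists>d. d \<noteq> 0 \<and> l i - fscale d (m i) \<in> fs.span (m ` {1..<i}))" ..
    have m: "m i \<in> supported ({1..n} \<inter> {..c i})"
      "\<And>j. j \<in> {1..k} \<Longrightarrow> m i (c j) = (if i = j then 1 else 0)"
      "\<exists>d. d \<noteq> 0 \<and> l i - fscale d (m i) \<in> fs.span (m ` {1..<i})" if "i \<in> {1..k}" for i
      using bspec[OF mm that] by blast+
    let ?K = "Suc k"
    define h where "h = l ?K - (\<Sum>j\<in>{1..k}. fscale (l ?K (c j)) (m j))"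
    have h_supp: "h \<in> supported ({1..n} \<inter> {..c ?K})"
    proof (rule supportedI)
      fix i assume i: "i \<notin> {1..n} \<inter> {..c ?K}"
      have "m j i = 0" if "j \<in> {1..k}" for j
        using supportedD[OF m(1)[OF that], of i] i c_less[of j ?K] that Suc.prems by auto
      moreover have "l ?K i = 0" using supportedD[OF l[of ?K], of i] i Suc.prems by (auto simp: c_def)
      ultimately show "h i = 0" by (simp add: h_def fscale_apply)
    qed
    have hj: "h (c j) = 0" if j: "j \<in> {1..k}" for j
    proof -
      have "(\<Sum>i\<in>{1..k}. l ?K (c i) * m i (c j)) = (\<Sum>i\<in>{1..k}. if i = j then l ?K (c i) else 0)"
        using m(2)[OF _ j] by (intro sum.cong) auto
      then show ?thesis using j by (simp add: h_def fscale_apply)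
    qed
    have mK: "m j (c ?K) = 0" if "j \<in> {1..k}" for j
      using supportedD[OF m(1)[OF that], of "c ?K"] c_less[of j ?K] that Suc.prems by auto
    define d where "d = l ?K (c ?K)"
    have d0: "d \<noteq> 0" using nz[of ?K] Suc.prems by (simp add: d_def c_def)
    have hK: "h (c ?K) = d" using mK by (simp add: h_def fscale_apply d_def)
    define m' where "m' = m(?K := fscale (1 / d) h)"
    show ?case
    proof (intro exI[of _ m'] ballI conjI)
      fix i assume i: "i \<in> {1..?K}"
      show "m' i \<in> supported ({1..n} \<inter> {..c i})"
        using i m(1) h_supp by (cases "i = ?K") (auto simp: m'_def supported_def fscale_apply)
      show "m' i (c j) = (if i = j then 1 else 0)" if "j \<in> {1..?K}" for j
        using i that m(2) hj mK hK d0 by (auto simp: m'_def fscale_apply le_Suc_eq)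
      have im: "m' ` {1..<i} = m ` {1..<i}" using i by (intro image_cong) (auto simp: m'_def)
      show "\<exists>d. d \<noteq> 0 \<and> l i - fscale d (m' i) \<in> fs.span (m' ` {1..<i})"
      proof (cases "i = ?K")
        case True
        have "l ?K - fscale d (m' ?K) = (\<Sum>j\<in>{1..k}. fscale (l ?K (c j)) (m j))"
          using d0 by (auto simp: m'_def h_def fun_eq_iff fscale_apply)
        also have "\<dots> \<in> fs.span (m ` {1..<?K})"
          by (intro fs.span_sum fs.span_scale fs.span_base imageI) auto
        finally show ?thesis using True im d0 by auto
      next
        case False
        then show ?thesis using m(3)[of i] i unfolding im by (auto simp: m'_def)
      qed
    qed
  qed simp
  from this[OF order_refl] obtain m where mm: "\<forall>i\<in>{1..r}. m i \<in> supported ({1..n} \<inter> {..c i}) \<and>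
      (\<forall>j\<in>{1..r}. m i (c j) = (if i = j then 1 else 0)) \<and>
      (\<exists>d. d \<noteq> 0 \<and> l i - fscale d (m i) \<in> fs.span (m ` {1..<i}))" ..
  have m: "m i \<in> supported ({1..n} \<inter> {..c i})"
    "\<And>j. j \<in> {1..r} \<Longrightarrow> m i (c j) = (if i = j then 1 else 0)"
    "\<exists>d. d \<noteq> 0 \<and> l i - fscale d (m i) \<in> fs.span (m ` {1..<i})" if "i \<in> {1..r}" for i
    using bspec[OF mm that] by blast+
  have span: "fs.span (l ` {1..r}) = fs.span (m ` {1..r})" by (rule triangular_span_eq[OF m(3)])
  define M where "M a = m (THE k. k \<in> {1..r} \<and> c k = a)" for a
  have Mc: "M (c k) = m k" if "k \<in> {1..r}" for k
  proof -
    have "(THE l. l \<in> {1..r} \<and> c l = c k) = k"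
      using that c_less by (intro the_equality) (auto, metis linorder_neqE_nat order_less_irrefl)
    then show ?thesis by (simp add: M_def)
  qed
  have C_eq: "f ` C = (\<lambda>k. f (c k)) ` {1..r}" for f :: "nat \<Rightarrow> nat \<Rightarrow> complex"
    unfolding image_sorted_list[OF C] by (subst image_shift_atLeast) (simp add: c_def)
  have C_set: "\<exists>k\<in>{1..r}. a = c k" if "a \<in> C" for a
  proof -
    have "a \<in> set (sorted_list_of_set C)" using that by (simp only: cs(2))
    then obtain k where "k < r" "a = sorted_list_of_set C ! k" unfolding in_set_conv_nth cs(3) by blast
    then show ?thesis by (intro bexI[of _ "Suc k"]) (auto simp: c_def)
  qed
  show ?thesis unfolding cell_iff[OF C]
  proof (intro exI[of _ M] conjI ballI impI)
    fix a assume "a \<in> C"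
    then obtain k where k: "k \<in> {1..r}" "a = c k" using C_set by blast
    show "M a \<in> supported {1..n}" using m(1)[OF k(1)] Mc[OF k(1)] k(2) by (auto simp: supported_def)
    show "M a a = 1" using m(2)[OF k(1) k(1)] Mc[OF k(1)] k(2) by simp
    fix i assume i: "i \<in> {1..n}" "i \<noteq> a \<and> (i, a) \<notin> Inv C"
    \<comment> \<open>A position that is neither the pivot nor free lies beyond the pivot or in the
      row of another pivot.\<close>
    then consider "a < i" | "i \<in> C" using \<open>a \<in> C\<close> by (force simp: Inv_def)
    then show "M a i = 0"
    proof cases
      case 1
      then show ?thesis using supportedD[OF m(1)[OF k(1)], of i] Mc[OF k(1)] k(2) by auto
    next
      case 2
      then obtain j where "j \<in> {1..r}" "i = c j" using C_set by blast
      then show ?thesis using m(2)[OF k(1), of j] Mc[OF k(1)] k(2) i(2) by auto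
    qed
  next
    have "M ` C = m ` {1..r}" unfolding C_eq using Mc by (intro image_cong) auto
    then show "fun_vec n ` fs.span (l ` {1..r}) = fun_vec n ` fs.span (M ` C)" using span by simp
  qed
qed

text \<open>The vectors \<open>u k\<close> become the columns numbered by B of a square matrix.
  Filling the other columns with unit vectors makes it lower triangular with nonzero
  diagonal.\<close>

lemma lower_orbitI:
  assumes B: "B \<in> rsubsets r n"
    and u: "\<And>k. k \<in> {1..r} \<Longrightarrow> u k \<in> supported ({1..n} \<inter> {sorted_list_of_set B ! (k - 1)..})"
    and nz: "\<And>k. k \<in> {1..r} \<Longrightarrow> u k (sorted_list_of_set B ! (k - 1)) \<noteq> 0"
  shows "fun_vec n ` fs.span (u ` {1..r}) \<in> lower_orbit n B"
proof -
  note bs = rsubsets_sorted_list[OF B]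
  let ?bs = "sorted_list_of_set B"
  have BN: "B \<subseteq> {1..n}" using B by (simp add: rsubsets_def)
  define U where "U b = (if b \<in> B then u (Suc (THE k. k < r \<and> ?bs ! k = b)) else (\<lambda>i. if i = b then 1 else 0))" for b
  have Ub: "U (?bs ! k) = u (Suc k)" if "k < r" for k
  proof -
    have "(THE l. l < r \<and> ?bs ! l = ?bs ! k) = k"
      using that nth_eq_iff_index_eq[of ?bs] bs(3) by (intro the_equality) auto
    then show ?thesis using bs(6)[OF that] by (simp add: U_def)
  qed
  have U: "U b i = 0" "U b b \<noteq> 0" if "i < b" for b i
  proof -
    have *: "(i < b \<longrightarrow> U b i = 0) \<and> U b b \<noteq> 0"
    proof (cases "b \<in> B")
      case True
      then have "b \<in> set ?bs" by (simp only: bs(2))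
      then obtain k where k: "k < r" "b = ?bs ! k" unfolding in_set_conv_nth bs(3) by blast
      have "u (Suc k) i = 0" if "i < b" using supportedD[OF u[of "Suc k"], of i] k that by auto
      moreover have "u (Suc k) b \<noteq> 0" using nz[of "Suc k"] k by simp
      ultimately show ?thesis using Ub[OF k(1)] k(2) by simp
    qed (auto simp: U_def)
    then show "U b i = 0" "U b b \<noteq> 0" using that by auto
  qed
  define g where "g = mat n n (\<lambda>(i, j). U (Suc j) (Suc i))"
  have g: "g \<in> carrier_mat n n" by (simp add: g_def)
  have "det g = prod_list (diag_mat g)"
    by (rule det_lower_triangular[OF _ g]) (auto simp: g_def U)
  moreover have "0 \<notin> set (diag_mat g)" using U(2)[of 0] by (auto simp: diag_mat_def g_def)
  ultimately have "det g \<noteq> 0" by (simp add: prod_list_zero_iff)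
  then obtain h where "h \<in> carrier_mat n n" "g * h = 1\<^sub>m n" "h * g = 1\<^sub>m n"
    using det_non_zero_imp_unit[OF g] by (auto simp: Units_def ring_mat_def)
  then have inv: "invertible_mat g" using g
    unfolding invertible_mat_def inverts_mat_def square_mat.simps by (intro conjI exI[of _ h]) auto
  have ut: "upper_triangular (transpose_mat g)"
    unfolding upper_triangular_def using U(1) by (auto simp: g_def)
  note E = coord_plane_mat[OF B g]
  have "g * mat_of_cols n (map (\<lambda>a. unit_vec n (a - 1)) ?bs) = fam_mat n r (\<lambda>k. u (Suc k))"
  proof (rule eq_matI)
    fix i k assume "i < dim_row (fam_mat n r (\<lambda>k. u (Suc k)))" "k < dim_col (fam_mat n r (\<lambda>k. u (Suc k)))"
    then have ik: "i < n" "k < r" by simp_all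
    have b: "?bs ! k \<in> {1..n}" using bs(6)[OF ik(2)] BN by blast
    show "(g * mat_of_cols n (map (\<lambda>a. unit_vec n (a - 1)) ?bs)) $$ (i, k) = fam_mat n r (\<lambda>k. u (Suc k)) $$ (i, k)"
      unfolding E(3)[OF ik] using ik b Ub[OF ik(2)] by (auto simp: g_def fam_mat_def)
  qed (use E(1) g in auto)
  then have "mat_act g (coord_plane n B) = fun_vec n ` fs.span (u ` {1..r})"
    unfolding E(2) by (simp only: colspan_fam_mat image_shift_atLeast[of u])
  then show ?thesis unfolding lower_orbit_def using g inv ut by (intro CollectI exI[of _ g]) simp
qed

text \<open>Serves to shift a possibly singular coefficient matrix G to G + t I, which is invertible
  for all but finitely many t.\<close>

lemma char_matrix_det_nonzero:
  assumes G: "(G :: complex mat) \<in> carrier_mat r r"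
  shows "finite {t. det (char_matrix G t) = 0}"
proof -
  have "{t. det (char_matrix G t) = 0} = {t. poly (char_poly G) t = 0}"
    using eigenvalue_det[OF G] eigenvalue_root_char_poly[OF G] by auto
  moreover have "char_poly G \<noteq> 0" using degree_monic_char_poly[OF G] by auto
  ultimately show ?thesis using poly_roots_finite by metis
qed

lemma colspan_fam_mat_Suc: "colspan n (fam_mat n r (\<lambda>k. N (Suc k))) = fun_vec n ` fs.span (N ` {1..r})"
  unfolding colspan_fam_mat image_shift_atLeast ..

lemma sorted_list_of_strict_image:
  fixes f :: "nat \<Rightarrow> nat"
  assumes "\<And>i j. 1 \<le> i \<Longrightarrow> i < j \<Longrightarrow> j \<le> r \<Longrightarrow> f i < f j"
  shows "sorted_list_of_set (f ` {1..r}) = map f [1..<Suc r]" "card (f ` {1..r}) = r"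
proof -
  have "sorted_wrt (<) (map f [1..<Suc r])"
    using assms by (auto simp: sorted_wrt_map sorted_wrt_iff_nth_less simp del: upt_Suc)
  then have "sorted_list_of_set (set (map f [1..<Suc r])) = map f [1..<Suc r]"
    by (simp only: strict_sorted_iff sorted_list_of_set.idem_if_sorted_distinct)
  moreover have "set (map f [1..<Suc r]) = f ` {1..r}" by (auto simp: image_iff)
  ultimately show "sorted_list_of_set (f ` {1..r}) = map f [1..<Suc r]" by simp
  have "inj_on f {1..r}" using assms by (intro linorder_inj_onI') (auto simp: less_imp_neq)
  then show "card (f ` {1..r}) = r" by (simp add: card_image)
qed

context staircase
begin

text \<open>
  The columns of the cell of \<open>A\<close> are indexed by \<open>s \<in> {1..r}\<close>: column \<open>s\<close> has its pivot at \<open>src s\<close> and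
  its support in \<open>R s\<close>. The set \<open>S s\<close> is the preimage under \<open>x\<close> of an interval of the chain; it differs
  from \<open>R s\<close> in containing \<open>s - 1\<close> instead of \<open>pp (s - 1)\<close>.
\<close>

definition src :: "nat \<Rightarrow> nat" where "src s = (if s \<in> P then \<rho> s else s)"

definition R :: "nat \<Rightarrow> nat set" where
  "R s = (if s < a then {s} else {s} \<union> (if a < s then {pp (s - 1)} else {}) \<union> {\<rho> (s + 1)<..\<rho> s})"

definition S :: "nat \<Rightarrow> nat set" where
  "S s = (if s < a then {s} else {s} \<union> (if a < s then {s - 1} else {}) \<union> {\<rho> (s + 1)<..\<rho> s})"

text \<open>The preimage under x of the right end of the interval of s; the left end comes from s
  itself (\<open>x_apex\<close> and \<open>x_lo\<close>).\<close>

definition apex :: "nat \<Rightarrow> nat" where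
  "apex s = (if s < a then s else if s = a then \<rho> a else s - 1)"

lemma \<rho>_not_P: "a \<le> s \<Longrightarrow> s \<le> r \<Longrightarrow> s \<notin> P \<Longrightarrow> \<rho> (s + 1) = \<rho> s"
  using \<rho>_anti[of s "s + 1"] by (auto simp: P_def)

lemma \<rho>_ge: "a \<le> s \<Longrightarrow> s \<le> r + 1 \<Longrightarrow> r \<le> \<rho> s \<and> \<rho> s \<le> n"
  using \<rho>_anti[of s "r + 1"] \<rho>_anti[of a s] \<rho>_last \<rho>_first by simp

lemma pp_prev:
  assumes "a < s" "s \<le> r" "s \<notin> P" shows "pp s = pp (s - 1)"
proof (rule ppI)
  have *: "pp (s - 1) \<in> P \<and> pp (s - 1) \<le> s - 1 \<and> (\<forall>p\<in>P. p \<le> s - 1 \<longrightarrow> p \<le> pp (s - 1))"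
    by (rule pp_greatest) (use assms in auto)
  then show "pp (s - 1) \<in> P" "pp (s - 1) \<le> s" by auto
  show "c \<le> pp (s - 1)" if "c \<in> P" "c \<le> s" for c
    using * that assms by (cases "c = s") auto
qed

lemma pp_pred:
  assumes "a < s" "s \<le> r" shows "pp (s - 1) \<in> P" "pp (s - 1) < s" "s - 1 \<in> P \<Longrightarrow> pp (s - 1) = s - 1"
proof -
  have *: "pp (s - 1) \<in> P \<and> pp (s - 1) \<le> s - 1 \<and> (\<forall>p\<in>P. p \<le> s - 1 \<longrightarrow> p \<le> pp (s - 1))"
    by (rule pp_greatest) (use assms in auto)
  then show "pp (s - 1) \<in> P" by blast
  from * show "pp (s - 1) < s" using assms by linarith
  show "pp (s - 1) = s - 1" if "s - 1 \<in> P" by (rule ppI) (use that in auto)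
qed

lemma src_image: "src ` {1..r} = A"
  by (rule image_A) (auto simp: src_def)

lemma inj_src: "inj_on src {1..r}"
proof (rule inj_onI)
  fix s t assume st: "s \<in> {1..r}" "t \<in> {1..r}" "src s = src t"
  show "s = t"
  proof (cases "s \<in> P"; cases "t \<in> P")
    assume "s \<in> P" "t \<in> P"
    then show ?thesis using st(3) inj_\<rho> by (auto simp: src_def dest: inj_onD)
  qed (use st \<rho>_P_bounds[of s] \<rho>_P_bounds[of t] in \<open>auto simp: src_def\<close>)
qed

lemma T_not_A: "(i, j) \<in> T \<Longrightarrow> i \<notin> A"
  unfolding InvQ_eq_T[symmetric] by (auto simp: InvQ_def Inv_def)

text \<open>The set \<open>R s\<close> consists of the pivot and the free rows of column s. For s
  outside P the staircase is flat at s, and the two descriptions agree because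
  \<open>pp s = pp (s - 1)\<close>.\<close>

lemma R_iff_T:
  assumes s: "s \<in> {1..r}"
  shows "i \<in> R s \<longleftrightarrow> i = src s \<or> (i, src s) \<in> T"
proof (cases "s \<in> P")
  case True
  have eq: "\<rho> p = \<rho> s \<longleftrightarrow> p = s" if "p \<in> P" for p using P_facts(6)[OF that True] .
  have "(i, \<rho> s) \<in> T \<longleftrightarrow> (\<rho> (s + 1) < i \<and> i < \<rho> s) \<or> i = s \<or> (a < s \<and> i = pp (s - 1))"
    unfolding T_def using eq True \<rho>_P_bounds[OF True] by fastforce
  then show ?thesis using True P_bounds[OF True] by (auto simp: R_def src_def)
next
  case False
  have "(i, s) \<in> T \<longleftrightarrow> a \<le> s \<and> i = pp s"
    unfolding T_def using s False \<rho>_P_bounds in_A_le[of s] by fastforce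
  moreover have "a \<noteq> s" using a_in_P False s by auto
  ultimately show ?thesis using False s \<rho>_not_P[of s] pp_prev[of s] by (auto simp: R_def src_def)
qed

lemma R_sub: "s \<in> {1..r} \<Longrightarrow> R s \<subseteq> {1..n}"
proof
  fix i assume s: "s \<in> {1..r}" and i: "i \<in> R s"
  show "i \<in> {1..n}"
  proof (cases "s < a")
    case False
    then have "r \<le> \<rho> (s + 1)" "\<rho> s \<le> n" using \<rho>_ge[of "s + 1"] \<rho>_ge[of s] s by auto
    moreover have "a < s \<Longrightarrow> pp (s - 1) \<in> {1..n}" using pp_pred[of s] s P_bounds rn by fastforce
    ultimately show ?thesis using i s rn False by (auto simp: R_def split: if_splits)
  qed (use i s rn in \<open>auto simp: R_def\<close>)
qed

lemma src_R: "s \<in> {1..r} \<Longrightarrow> src s \<in> R s"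
  by (simp add: R_iff_T)

lemma src_S: "s \<in> {1..r} \<Longrightarrow> src s \<in> S s"
  using P_bounds(1)[of s] P_bounds(2)[of s] by (auto simp: src_def S_def)

lemma R_not_P: "a \<le> k \<Longrightarrow> k \<le> r \<Longrightarrow> k \<notin> P \<Longrightarrow> R k = {k, pp k}"
proof -
  assume k: "a \<le> k" "k \<le> r" "k \<notin> P"
  then have "a \<noteq> k" using a_in_P by auto
  then show ?thesis using k \<rho>_not_P[of k] pp_prev[of k] by (auto simp: R_def)
qed

definition cell_family :: "(nat \<Rightarrow> nat \<Rightarrow> complex) \<Rightarrow> bool" where
  "cell_family N \<longleftrightarrow> (\<forall>s\<in>{1..r}. N s \<in> supported (R s) \<and> N s (src s) = 1)"

text \<open>Free rows avoid A, while the pivots of all columns lie in A; so a cell family is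
  automatically in reduced form.\<close>

lemma cell_family_dual:
  assumes N: "cell_family N" and st: "s \<in> {1..r}" "t \<in> {1..r}"
  shows "N s (src t) = (if s = t then 1 else 0)"
proof (cases "s = t")
  case False
  then have ne: "src t \<noteq> src s" using inj_src st by (auto dest: inj_onD)
  have "src t \<in> A" using st src_image by blast
  then have "(src t, src s) \<notin> T" using T_not_A by blast
  then have "src t \<notin> R s" using ne R_iff_T[OF st(1)] by simp
  then show ?thesis using N st False unfolding cell_family_def by (auto dest: supportedD)
qed (use N st in \<open>simp add: cell_family_def\<close>)

lemma cell_family_frame:
  assumes N: "cell_family N"
  shows "fam_mat n r (\<lambda>k. N (Suc k)) \<in> frames r n"
proof (rule fam_mat_frame[of r "\<lambda>k. src (Suc k)"])
  show "src (Suc k) \<in> {1..n}" if "k < r" for k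
    using R_sub[of "Suc k"] src_R[of "Suc k"] that by auto
  show "N (Suc k) (src (Suc l)) = (if k = l then 1 else 0)" if "k < r" "l < r" for k l
    using cell_family_dual[OF N, of "Suc k" "Suc l"] that by simp
qed

lemma in_cell_iff:
  "V \<in> cell r n A (InvQ r n A) \<longleftrightarrow> (\<exists>N. cell_family N \<and> V = fun_vec n ` fs.span (N ` {1..r}))"
proof
  assume "V \<in> cell r n A (InvQ r n A)"
  then obtain m where mm: "\<forall>b\<in>A. m b \<in> supported {1..n} \<and> m b b = 1 \<and>
      (\<forall>i\<in>{1..n}. i \<noteq> b \<and> (i, b) \<notin> T \<longrightarrow> m b i = 0)" and V: "V = fun_vec n ` fs.span (m ` A)"
    unfolding cell_iff[OF A_rsubsets] InvQ_eq_T by (elim exE conjE)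
  have "cell_family (\<lambda>s. m (src s))" unfolding cell_family_def
  proof (intro ballI conjI)
    fix s assume s: "s \<in> {1..r}"
    then have "src s \<in> A" using src_image by blast
    note ms = bspec[OF mm this]
    show "m (src s) (src s) = 1" using ms by blast
    show "m (src s) \<in> supported (R s)"
    proof (rule supportedI)
      fix i assume "i \<notin> R s"
      then show "m (src s) i = 0" using ms R_iff_T[OF s] supportedD[of "m (src s)" "{1..n}" i] by blast
    qed
  qed
  moreover have "m ` A = (\<lambda>s. m (src s)) ` {1..r}" unfolding src_image[symmetric] image_image ..
  ultimately show "\<exists>N. cell_family N \<and> V = fun_vec n ` fs.span (N ` {1..r})"
    using V by (intro exI[of _ "\<lambda>s. m (src s)"]) simp
next
  assume "\<exists>N. cell_family N \<and> V = fun_vec n ` fs.span (N ` {1..r})"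
  then obtain N where N: "cell_family N" and V: "V = fun_vec n ` fs.span (N ` {1..r})" by blast
  define m where "m b = N (inv_into {1..r} src b)" for b
  have m_src: "m (src s) = N s" if "s \<in> {1..r}" for s
    using inv_into_f_f[OF inj_src that] by (simp add: m_def)
  have "m ` A = N ` {1..r}" unfolding src_image[symmetric] image_image using m_src by (intro image_cong) auto
  moreover have "m b \<in> supported {1..n} \<and> m b b = 1 \<and> (\<forall>i\<in>{1..n}. i \<noteq> b \<and> (i, b) \<notin> T \<longrightarrow> m b i = 0)"
    if "b \<in> A" for b
  proof -
    from that obtain s where s: "s \<in> {1..r}" "b = src s" unfolding src_image[symmetric] by blast
    have Ns: "N s \<in> supported (R s)" "N s (src s) = 1" using N s(1) by (auto simp: cell_family_def)
    have "N s \<in> supported {1..n}" using Ns(1) supported_mono[OF R_sub[OF s(1)]] by blast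
    then show ?thesis using Ns R_iff_T[OF s(1)] supportedD[OF Ns(1)] unfolding s(2) m_src[OF s(1)] by blast
  qed
  ultimately show "V \<in> cell r n A (InvQ r n A)"
    unfolding cell_iff[OF A_rsubsets] InvQ_eq_T V by (intro exI[of _ m]) simp
qed

text \<open>If s - 1 is a drop, then \<open>pp (s - 1) = s - 1\<close> and nothing has to be done.
  Otherwise column s - 1 has only the two entries s - 1 and \<open>pp (s - 1)\<close>, and
  subtracting a multiple of it moves the entry of column s from the latter row to the former. The
  multiple is nonzero, which keeps the end \<open>apex s\<close> of the support.\<close>

lemma generic_cell_chain:
  assumes N: "cell_family N" and nz: "\<And>s i. s \<in> {1..r} \<Longrightarrow> i \<in> R s \<Longrightarrow> N s i \<noteq> 0"
  obtains v where "\<And>s. s \<in> {1..r} \<Longrightarrow> v s \<in> supported (S s) \<and> v s s \<noteq> 0 \<and> v s (apex s) \<noteq> 0"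
    "fs.span (v ` {1..r}) = fs.span (N ` {1..r})"
proof -
  define q where "q s = (if a < s \<and> s - 1 \<notin> P then N s (pp (s - 1)) / N (s - 1) (pp (s - 1)) else 0)" for s
  define v where "v s = N s - fscale (q s) (N (s - 1))" for s
  have N_supp: "N s \<in> supported (R s)" if "s \<in> {1..r}" for s using N that by (simp add: cell_family_def)
  have props: "v s \<in> supported (S s) \<and> v s s \<noteq> 0 \<and> v s (apex s) \<noteq> 0" if s: "s \<in> {1..r}" for s
  proof (cases "a < s \<and> s - 1 \<notin> P")
    case True
    then have as: "a < s" "s - 1 \<notin> P" by auto
    have sr: "s \<le> r" "s - 1 \<in> {1..r}" using s as a1 by auto
    note ppd = pp_pred[OF as(1) sr(1)]
    have Rk: "R (s - 1) = {s - 1, pp (s - 1)}" using R_not_P[of "s - 1"] as sr by auto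
    have srck: "src (s - 1) = s - 1" using as(2) by (simp add: src_def)
    have Nk: "N (s - 1) (s - 1) = 1" "N (s - 1) (pp (s - 1)) \<noteq> 0"
      using bspec[OF N[unfolded cell_family_def] sr(2)] unfolding srck
      by (blast, use nz[OF sr(2), of "pp (s - 1)"] Rk in simp)
    have Nk0: "N (s - 1) i = 0" if "i \<noteq> s - 1" "i \<noteq> pp (s - 1)" for i
      using supportedD[OF N_supp[OF sr(2)], of i] that Rk by simp
    have ppR: "pp (s - 1) \<in> R s" using as by (auto simp: R_def)
    have q: "q s = N s (pp (s - 1)) / N (s - 1) (pp (s - 1))" using True by (simp add: q_def)
    have "q s \<noteq> 0" using nz[OF s ppR] Nk by (simp add: q)
    have ne: "pp (s - 1) \<noteq> s - 1" using ppd(1) as(2) by auto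
    have "v s i = 0" if "i \<notin> S s" for i
    proof (cases "i = pp (s - 1)")
      case True
      then show ?thesis using Nk by (simp add: v_def q fscale_apply)
    next
      case False
      then have "i \<notin> R s" "i \<noteq> s - 1" using that as by (auto simp: R_def S_def)
      then show ?thesis using supportedD[OF N_supp[OF s]] Nk0[of i] False by (simp add: v_def fscale_apply)
    qed
    then have 1: "v s \<in> supported (S s)" by (rule supportedI)
    have "N s s \<noteq> 0" using nz[OF s, of s] as by (auto simp: R_def)
    moreover have "N (s - 1) s = 0" using Nk0[of s] ppd(2) as by auto
    ultimately have 2: "v s s \<noteq> 0" by (simp add: v_def fscale_apply)
    have "s - 1 \<notin> R s"
      using ne as sr \<rho>_ge[of "s + 1"] by (auto simp: R_def)
    then have "v s (s - 1) = - q s" using supportedD[OF N_supp[OF s]] Nk by (simp add: v_def fscale_apply)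
    then show ?thesis using 1 2 as \<open>q s \<noteq> 0\<close> by (simp add: apex_def)
  next
    case False
    then have "q s = 0" by (auto simp: q_def)
    then have v: "v s = N s" by (simp add: v_def fun_eq_iff fscale_apply)
    have "R s = S s"
    proof (cases "a < s")
      case True
      then have "s - 1 \<in> P" using False by simp
      then show ?thesis using pp_pred(3)[OF True] s True by (auto simp: R_def S_def)
    qed (auto simp: R_def S_def)
    moreover have "s \<in> S s" "apex s \<in> S s"
      using s \<rho>_drop by (auto simp: S_def apex_def)
    ultimately show ?thesis using N_supp[OF s] nz[OF s] v by simp
  qed
  have "fs.span (v ` {1..r}) = fs.span (N ` {1..r})"
  proof (rule triangular_span_eq)
    fix s assume s: "s \<in> {1..r}"
    have eq: "v s - fscale 1 (N s) = fscale (- q s) (N (s - 1))" by (auto simp: v_def fun_eq_iff fscale_apply)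
    have "fscale (- q s) (N (s - 1)) \<in> fs.span (N ` {1..<s})"
    proof (cases "a < s")
      case True
      then have "N (s - 1) \<in> fs.span (N ` {1..<s})" using a1 by (intro fs.span_base imageI) auto
      then show ?thesis by (rule fs.span_scale)
    next
      case False
      then have "fscale (- q s) (N (s - 1)) = 0" by (auto simp: q_def fun_eq_iff fscale_apply)
      then show ?thesis by (simp only: fs.span_zero)
    qed
    then have "v s - fscale 1 (N s) \<in> fs.span (N ` {1..<s})" unfolding eq .
    then show "\<exists>c. c \<noteq> 0 \<and> v s - fscale c (N s) \<in> fs.span (N ` {1..<s})" by (metis one_neq_zero)
  qed
  with props that show ?thesis by blast
qed

text \<open>The elimination in the opposite direction: the entry of \<open>v s\<close> in row s - 1
  is removed with the already reduced column s - 1, which can bring in only row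
  \<open>pp (s - 1)\<close>. Dividing by the entry at \<open>src s\<close> then normalises the
  pivot.\<close>

lemma chain_cell:
  assumes v: "\<And>s. s \<in> {1..r} \<Longrightarrow> v s \<in> supported (S s) \<and> v s (src s) \<noteq> 0"
  obtains N where "cell_family N" "fs.span (v ` {1..r}) = fs.span (N ` {1..r})"
proof -
  \<comment> \<open>Index 0 is a dummy value that starts the recursion; columns are numbered from
    1.\<close>
  define N where "N = rec_nat (\<lambda>_. 0 :: complex) (\<lambda>k f. fscale (1 / v (Suc k) (src (Suc k)))
     (v (Suc k) - (if a < Suc k \<and> k \<notin> P then fscale (v (Suc k) k) f else 0)))"
  have N_Suc: "N (Suc k) = fscale (1 / v (Suc k) (src (Suc k)))
     (v (Suc k) - (if a < Suc k \<and> k \<notin> P then fscale (v (Suc k) k) (N k) else 0))" for k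
    by (simp add: N_def)
  have props: "N s \<in> supported (R s) \<and> N s (src s) = 1" if "s \<in> {1..r}" for s
    using that
  proof (induction s)
    case (Suc k)
    note vs = v[OF Suc.prems]
    show ?case
    proof (cases "a < Suc k \<and> k \<notin> P")
      case True
      then have as: "a < Suc k" "k \<notin> P" by auto
      have kr: "k \<in> {1..r}" using as a1 Suc.prems by auto
      have Rk: "R k = {k, pp k}" using R_not_P[of k] as kr by auto
      have Nk: "N k \<in> supported {k, pp k}" "N k k = 1" using Suc.IH[OF kr] Rk as by (auto simp: src_def)
      have pk: "pp k < Suc k" "pp k \<in> P" using pp_pred[of "Suc k"] as Suc.prems by auto
      define w where "w = v (Suc k) - fscale (v (Suc k) k) (N k)"
      have NS: "N (Suc k) = fscale (1 / v (Suc k) (src (Suc k))) w" using N_Suc[of k] True by (simp add: w_def)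
      have "w i = 0" if "i \<notin> R (Suc k)" for i
      proof (cases "i = k")
        case True
        then show ?thesis using Nk by (simp add: w_def fscale_apply)
      next
        case False
        then have "i \<notin> S (Suc k)" "i \<noteq> pp k" using that as by (auto simp: R_def S_def)
        then have "v (Suc k) i = 0" "N k i = 0"
          using supportedD[of "v (Suc k)" "S (Suc k)" i] vs supportedD[OF Nk(1), of i] False by auto
        then show ?thesis by (simp add: w_def fscale_apply)
      qed
      moreover have "w (src (Suc k)) = v (Suc k) (src (Suc k))"
      proof -
        have "src (Suc k) \<noteq> k" "src (Suc k) \<noteq> pp k"
          using pk \<rho>_P_bounds[of "Suc k"] kr P_bounds[OF pk(2)] by (auto simp: src_def)
        then have "N k (src (Suc k)) = 0" using supportedD[OF Nk(1)] by simp
        then show ?thesis by (simp add: w_def fscale_apply)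
      qed
      ultimately show ?thesis using vs unfolding NS by (auto simp: supported_def fscale_apply)
    next
      case False
      then have NS: "N (Suc k) = fscale (1 / v (Suc k) (src (Suc k))) (v (Suc k))"
        using N_Suc[of k] by (auto simp: fun_eq_iff fscale_apply)
      have "R (Suc k) = S (Suc k)"
      proof (cases "a < Suc k")
        case True
        then have "k \<in> P" using False by simp
        then show ?thesis using pp_pred(3)[OF True] Suc.prems True by (auto simp: R_def S_def)
      qed (auto simp: R_def S_def)
      then show ?thesis using vs unfolding NS by (auto simp: supported_def fscale_apply)
    qed
  qed simp
  have "fs.span (v ` {1..r}) = fs.span (N ` {1..r})"
  proof (rule triangular_span_eq)
    fix s assume s: "s \<in> {1..r}"
    then obtain k where k: "s = Suc k" by (cases s) auto
    have nz: "v s (src s) \<noteq> 0" using v[OF s] by blast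
    have eq: "v s - fscale (v s (src s)) (N s) = (if a < Suc k \<and> k \<notin> P then fscale (v s k) (N k) else 0)"
      using nz unfolding k N_Suc[of k] by (auto simp: fun_eq_iff fscale_apply)
    have "(if a < Suc k \<and> k \<notin> P then fscale (v s k) (N k) else 0) \<in> fs.span (N ` {1..<s})"
    proof (cases "a < Suc k \<and> k \<notin> P")
      case True
      then have "N k \<in> fs.span (N ` {1..<s})" using a1 k by (intro fs.span_base imageI) auto
      then have "fscale (v s k) (N k) \<in> fs.span (N ` {1..<s})" by (rule fs.span_scale)
      then show ?thesis using True by simp
    qed (auto simp: fs.span_zero)
    then have "v s - fscale (v s (src s)) (N s) \<in> fs.span (N ` {1..<s})" unfolding eq .
    with nz show "\<exists>c. c \<noteq> 0 \<and> v s - fscale c (N s) \<in> fs.span (N ` {1..<s})" by blast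
  qed
  moreover have "cell_family N" unfolding cell_family_def using props by blast
  ultimately show ?thesis using that by blast
qed

end

section \<open>Chains of intervals and the Richardson variety\<close>

context staircase
begin

text \<open>For s > a the value \<open>lo (s - 1)\<close> equals \<open>hi s\<close>: consecutive
  intervals share an end. The points s < a belong to the rows of length zero, below the
  ribbon.\<close>

definition lo :: "nat \<Rightarrow> nat" where "lo s = (if s < a then s else \<rho> (s + 1) + a - s)"

text \<open>The case s = a lacks the summand 1 because it belongs to the top row of the ribbon,
  which shares no column with a row above.\<close>

definition hi :: "nat \<Rightarrow> nat" where "hi s = (if s < a then s else if s = a then \<rho> a else \<rho> s + a - s + 1)"

text \<open>The staircase descends while subsets are listed increasingly, so the indices from a to r
  are reversed. On \<open>{1..r}\<close> this is the permutation \<open>ribbon_perm\<close>.\<close>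

definition flip :: "nat \<Rightarrow> nat" where "flip k = (if k < a then k else r + a - k)"

definition bs :: "nat \<Rightarrow> nat" where "bs k = lo (flip k)"

definition cs :: "nat \<Rightarrow> nat" where "cs k = hi (flip k)"

lemma flip_in: "k \<in> {1..r} \<Longrightarrow> flip k \<in> {1..r}"
  using a1 by (auto simp: flip_def)

lemma flip_flip: "k \<in> {1..r} \<Longrightarrow> flip (flip k) = k"
  by (auto simp: flip_def)

lemma flip_image: "flip ` {1..r} = {1..r}"
proof (intro equalityI subsetI)
  fix k assume "k \<in> {1..r}"
  then show "k \<in> flip ` {1..r}" using flip_in[of k] flip_flip[of k] by (metis imageI)
qed (use flip_in in auto)

lemma lo_hi: "s \<in> {1..r} \<Longrightarrow> lo s \<le> hi s \<and> (a \<le> s \<longrightarrow> lo s < hi s)"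
proof -
  assume s: "s \<in> {1..r}"
  consider "s < a" | "s = a" | "a < s" by linarith
  then show ?thesis
  proof cases
    case 2
    then show ?thesis using \<rho>_drop s by (simp add: lo_def hi_def)
  next
    case 3
    then have "\<rho> (s + 1) \<le> \<rho> s" "s \<le> \<rho> (s + 1)" using \<rho>_anti[of s "s + 1"] \<rho>_ge[of "s + 1"] s by auto
    then show ?thesis using 3 by (auto simp: lo_def hi_def)
  qed (auto simp: lo_def hi_def)
qed

text \<open>For k at least a the two sides are equal, namely \<open>hi s\<close> and
  \<open>lo (s - 1)\<close> for s = r + a - k; before that the intervals are single points.\<close>

lemma cs_le_bs_Suc: "1 \<le> k \<Longrightarrow> k < r \<Longrightarrow> cs k \<le> bs (Suc k)"
proof -
  assume k: "1 \<le> k" "k < r"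
  consider "Suc k < a" | "Suc k = a" | "a \<le> k" by linarith
  then show ?thesis
  proof cases
    case 2
    have "flip (Suc k) = r" using 2 by (simp add: flip_def)
    moreover have "a \<le> r" using 2 k by simp
    then have "lo r = a" using \<rho>_last by (simp add: lo_def)
    ultimately have "bs (Suc k) = a" by (simp add: bs_def)
    moreover have "cs k = k" using 2 by (simp add: cs_def flip_def hi_def)
    ultimately show ?thesis using 2 by simp
  next
    case 3
    have f: "flip k = r + a - k" "flip (Suc k) = r + a - Suc k" using 3 by (auto simp: flip_def)
    have "cs k = \<rho> (r + a - k) + a - (r + a - k) + 1"
      using 3 k unfolding cs_def f hi_def by auto
    moreover have "bs (Suc k) = \<rho> (r + a - k) + a - (r + a - Suc k)"
    proof -
      have "r + a - Suc k + 1 = r + a - k" using k by simp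
      then show ?thesis using 3 k unfolding bs_def f lo_def by auto
    qed
    moreover have "r \<le> \<rho> (r + a - k)" using 3 k \<rho>_ge[of "r + a - k"] by simp
    ultimately show ?thesis using 3 k by linarith
  qed (auto simp: cs_def bs_def flip_def lo_def hi_def)
qed

lemma bs_le_cs: "k \<in> {1..r} \<Longrightarrow> bs k \<le> cs k \<and> (a \<le> k \<longrightarrow> bs k < cs k)"
  unfolding bs_def cs_def using lo_hi[OF flip_in, of k] by (auto simp: flip_def split: if_splits)

lemma step_less:
  assumes "1 \<le> k" "k < r"
  shows "cs k < cs (Suc k)" "bs k < bs (Suc k)"
proof -
  consider "Suc k < a" | "Suc k = a" | "a \<le> k" by linarith
  note c = this
  show "cs k < cs (Suc k)"
    using c
  proof cases
    case 1
    then show ?thesis by (simp add: cs_def flip_def hi_def)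
  qed (use bs_le_cs[of "Suc k"] cs_le_bs_Suc[OF assms] assms in auto)
  show "bs k < bs (Suc k)"
    using c
  proof cases
    case 1
    then show ?thesis by (simp add: bs_def flip_def lo_def)
  next
    case 2
    then have "bs k = k" by (simp add: bs_def flip_def lo_def)
    moreover have "bs (Suc k) = a" using 2 assms \<rho>_last by (simp add: bs_def flip_def lo_def)
    ultimately show ?thesis using 2 by simp
  qed (use bs_le_cs[of k] cs_le_bs_Suc[OF assms] assms in auto)
qed

lemma strict_on_range:
  fixes f :: "nat \<Rightarrow> nat"
  assumes "\<And>k. 1 \<le> k \<Longrightarrow> k < r \<Longrightarrow> f k < f (Suc k)" and "1 \<le> i" "i < j" "j \<le> r"
  shows "f i < f j"
proof -
  have "Suc i \<le> j" using assms(3) by simp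
  then show ?thesis using assms(4)
  proof (induction j rule: dec_induct)
    case (step m)
    then show ?case using assms(1)[of m] assms(2) by (force intro: less_trans)
  qed (use assms in auto)
qed

lemmas cs_less = strict_on_range[of cs, OF step_less(1)]
lemmas bs_less = strict_on_range[of bs, OF step_less(2)]

text \<open>\<open>B\<close> and \<open>C\<close> turn out to be the subsets of \<nu> and
  \<eta>.\<close>

definition B :: "nat set" where "B = bs ` {1..r}"

definition C :: "nat set" where "C = cs ` {1..r}"

lemma bs_cs_range: "k \<in> {1..r} \<Longrightarrow> bs k \<in> {1..n} \<and> cs k \<in> {1..n}"
proof -
  assume k: "k \<in> {1..r}"
  define s where "s = flip k"
  have s: "s \<in> {1..r}" using flip_in[OF k] by (simp add: s_def)
  have "1 \<le> lo s"
  proof (cases "s < a")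
    case False
    then have "r \<le> \<rho> (s + 1)" using \<rho>_ge[of "s + 1"] s by auto
    then show ?thesis using False s a1 by (auto simp: lo_def)
  qed (use s in \<open>auto simp: lo_def\<close>)
  moreover have "hi s \<le> n"
  proof (cases "s < a")
    case False
    then have "\<rho> s \<le> n" "s \<le> \<rho> s" using \<rho>_ge[of s] s by auto
    then show ?thesis using False s by (cases "s = a") (auto simp: hi_def)
  qed (use s rn in \<open>auto simp: hi_def\<close>)
  ultimately show ?thesis using lo_hi[OF s] by (auto simp: bs_def cs_def s_def)
qed

lemma B_sorted: "B \<in> rsubsets r n" "k \<in> {1..r} \<Longrightarrow> sorted_list_of_set B ! (k - 1) = bs k"
proof -
  have sl: "sorted_list_of_set (bs ` {1..r}) = map bs [1..<Suc r]" "card (bs ` {1..r}) = r"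
    using sorted_list_of_strict_image[of r bs] bs_less by blast+
  show "B \<in> rsubsets r n" using bs_cs_range sl(2) by (auto simp: rsubsets_def B_def)
  assume "k \<in> {1..r}"
  then show "sorted_list_of_set B ! (k - 1) = bs k" unfolding B_def sl(1) by (auto simp del: upt_Suc)
qed

lemma C_sorted: "C \<in> rsubsets r n" "k \<in> {1..r} \<Longrightarrow> sorted_list_of_set C ! (k - 1) = cs k"
proof -
  have sl: "sorted_list_of_set (cs ` {1..r}) = map cs [1..<Suc r]" "card (cs ` {1..r}) = r"
    using sorted_list_of_strict_image[of r cs] cs_less by blast+
  show "C \<in> rsubsets r n" using bs_cs_range sl(2) by (auto simp: rsubsets_def C_def)
  assume "k \<in> {1..r}"
  then show "sorted_list_of_set C ! (k - 1) = cs k" unfolding C_def sl(1) by (auto simp del: upt_Suc)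
qed

end

text \<open>The values of x on which the geometry depends, freed from one-line notation: each
  stretch of heights belonging to one drop is shifted rigidly.
  \<open>grassmannian_ribbon_perm\<close> establishes them for the product of the two given
  permutations.\<close>

locale staircase_perm = staircase +
  fixes x :: "nat \<Rightarrow> nat"
  assumes x: "x permutes {1..n}"
    and x_low: "\<And>s. 1 \<le> s \<Longrightarrow> s < a \<Longrightarrow> x s = s"
    and x_mid: "\<And>s. a \<le> s \<Longrightarrow> s \<le> r \<Longrightarrow> x s = \<rho> (s + 1) + a - s"
    and x_high: "\<And>s t. a \<le> s \<Longrightarrow> s \<le> r \<Longrightarrow> \<rho> (s + 1) < t \<Longrightarrow> t \<le> \<rho> s \<Longrightarrow> x t = t + a - s"
begin

lemma x_lo: "s \<in> {1..r} \<Longrightarrow> x s = lo s"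
  using x_low x_mid by (auto simp: lo_def)

lemma x_apex: "s \<in> {1..r} \<Longrightarrow> x (apex s) = hi s"
proof -
  assume s: "s \<in> {1..r}"
  consider "s < a" | "s = a" | "a < s" by linarith
  then show ?thesis
  proof cases
    case 2
    then show ?thesis using x_high[of a "\<rho> a"] \<rho>_drop s by (simp add: apex_def hi_def)
  next
    case 3
    then have "x (s - 1) = \<rho> s + a - (s - 1)" using x_mid[of "s - 1"] s by auto
    then show ?thesis using 3 s \<rho>_ge[of s] by (simp add: apex_def hi_def Suc_diff_le)
  qed (use s x_low in \<open>auto simp: apex_def hi_def\<close>)
qed

text \<open>The left end comes from s, the right end from \<open>apex s\<close>, and the points
  between from the stretch of heights belonging to s; the converse follows by injectivity of
  x.\<close>

lemma x_in_interval_iff: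
  assumes s: "s \<in> {1..r}"
  shows "i \<in> S s \<longleftrightarrow> x i \<in> {lo s..hi s}"
proof
  assume i: "i \<in> S s"
  show "x i \<in> {lo s..hi s}"
  proof (cases "s < a")
    case True
    then show ?thesis using i s x_low[of s] by (auto simp: S_def lo_def hi_def)
  next
    case False
    then have as: "a \<le> s" "s \<le> r" using s by auto
    have \<rho>s: "s \<le> \<rho> (s + 1)" "\<rho> (s + 1) \<le> \<rho> s" using \<rho>_ge[of "s + 1"] \<rho>_anti[of s "s + 1"] as by auto
    from i as consider "i = s" | "a < s" "i = s - 1" | "\<rho> (s + 1) < i" "i \<le> \<rho> s"
      by (auto simp: S_def split: if_splits)
    then show ?thesis
    proof cases
      case 1
      then show ?thesis using x_lo[OF s] lo_hi[OF s] by simp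
    next
      case 2
      then show ?thesis using x_apex[OF s] lo_hi[OF s] by (simp add: apex_def)
    next
      case 3
      then show ?thesis using x_high[OF as 3] as \<rho>s by (auto simp: lo_def hi_def)
    qed
  qed
next
  assume xi: "x i \<in> {lo s..hi s}"
  have inj: "i = j" if "x i = x j" for j using permutes_inj[OF x] that by (auto dest: injD)
  show "i \<in> S s"
  proof (cases "s < a")
    case True
    then have "x i = s" using xi by (auto simp: lo_def hi_def)
    then have "i = s" using inj[of s] x_low[of s] True s by auto
    then show ?thesis using True by (auto simp: S_def)
  next
    case False
    then have as: "a \<le> s" "s \<le> r" using s by auto
    have \<rho>s: "s \<le> \<rho> (s + 1)" "\<rho> (s + 1) \<le> \<rho> s" using \<rho>_ge[of "s + 1"] \<rho>_anti[of s "s + 1"] as by auto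
    have lo: "lo s = \<rho> (s + 1) + a - s" using as by (simp add: lo_def)
    have hi: "hi s \<le> \<rho> s + a - s + 1" "s = a \<Longrightarrow> hi s = \<rho> s" using as by (auto simp: hi_def)
    consider "x i = lo s" | "a < s" "x i = hi s" | "lo s < x i" "x i \<le> \<rho> s + a - s"
      using xi hi lo as by (force simp: hi_def)
    then show ?thesis
    proof cases
      case 1
      then have "i = s" using inj[of s] x_lo[OF s] by simp
      then show ?thesis using as by (simp add: S_def)
    next
      case 2
      then have "i = s - 1" using inj[of "s - 1"] x_apex[OF s] by (simp add: apex_def)
      then show ?thesis using 2 by (simp add: S_def)
    next
      case 3
      define t where "t = x i + s - a"
      have t: "\<rho> (s + 1) < t" "t \<le> \<rho> s" "t + a - s = x i" using 3 as \<rho>s unfolding t_def lo by auto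
      then have "i = t" using inj[of t] x_high[OF as t(1,2)] by simp
      then show ?thesis using t as by (simp add: S_def)
    qed
  qed
qed

text \<open>One family serves both conditions, because it is supported in the intervals and is
  nonzero at both ends of each.\<close>

lemma generic_image:
  assumes N: "cell_family N" and nz: "\<And>s i. s \<in> {1..r} \<Longrightarrow> i \<in> R s \<Longrightarrow> N s i \<noteq> 0"
  shows "mat_act (perm_matrix n x) (fun_vec n ` fs.span (N ` {1..r})) \<in> cell r n C (Inv C) \<inter> lower_orbit n B"
proof -
  obtain v where v: "\<And>s. s \<in> {1..r} \<Longrightarrow> v s \<in> supported (S s) \<and> v s s \<noteq> 0 \<and> v s (apex s) \<noteq> 0"
    and span: "fs.span (v ` {1..r}) = fs.span (N ` {1..r})"
    using generic_cell_chain[OF N nz] by metis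
  define l where "l k = v (flip k) \<circ> Hilbert_Choice.inv x" for k
  have "l ` {1..r} = (\<lambda>s. v s \<circ> Hilbert_Choice.inv x) ` flip ` {1..r}" by (simp add: l_def image_image)
  then have l_im: "l ` {1..r} = (\<lambda>s. v s \<circ> Hilbert_Choice.inv x) ` {1..r}" by (simp only: flip_image)
  have eq: "mat_act (perm_matrix n x) (fun_vec n ` fs.span (N ` {1..r})) = fun_vec n ` fs.span (l ` {1..r})"
    unfolding span[symmetric] mat_act_span[OF x finite_atLeastAtMost] l_im ..
  have l: "l k \<in> supported {bs k..cs k}" "l k (bs k) \<noteq> 0" "l k (cs k) \<noteq> 0" if k: "k \<in> {1..r}" for k
  proof -
    note fk = flip_in[OF k]
    note vf = v[OF fk]
    show "l k \<in> supported {bs k..cs k}"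
    proof (rule supportedI)
      fix j assume "j \<notin> {bs k..cs k}"
      then have "x (Hilbert_Choice.inv x j) \<notin> {lo (flip k)..hi (flip k)}"
        by (simp add: permutes_inverses[OF x] bs_def cs_def)
      then have "Hilbert_Choice.inv x j \<notin> S (flip k)" using x_in_interval_iff[OF fk] by blast
      then show "l k j = 0" using vf by (auto simp: l_def dest: supportedD)
    qed
    have "l k (x s) = v (flip k) s" for s by (simp add: l_def permutes_inverses[OF x])
    then show "l k (bs k) \<noteq> 0" "l k (cs k) \<noteq> 0"
      unfolding bs_def cs_def x_lo[OF fk, symmetric] x_apex[OF fk, symmetric] using vf by simp_all
  qed
  have bc: "{bs k..cs k} \<subseteq> {1..n} \<inter> {..cs k}" "{bs k..cs k} \<subseteq> {1..n} \<inter> {bs k..}" if "k \<in> {1..r}" for k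
    using bs_cs_range[OF that] by auto
  have "fun_vec n ` fs.span (l ` {1..r}) \<in> cell r n C (Inv C)"
  proof (rule schubert_cellI[OF C_sorted(1)])
    fix k assume k: "k \<in> {1..r}"
    show "l k \<in> supported ({1..n} \<inter> {..sorted_list_of_set C ! (k - 1)})"
      unfolding C_sorted(2)[OF k] using l(1)[OF k] supported_mono[OF bc(1)[OF k]] by blast
    show "l k (sorted_list_of_set C ! (k - 1)) \<noteq> 0" unfolding C_sorted(2)[OF k] by (rule l(3)[OF k])
  qed
  moreover have "fun_vec n ` fs.span (l ` {1..r}) \<in> lower_orbit n B"
  proof (rule lower_orbitI[OF B_sorted(1)])
    fix k assume k: "k \<in> {1..r}"
    show "l k \<in> supported ({1..n} \<inter> {sorted_list_of_set B ! (k - 1)..})"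
      unfolding B_sorted(2)[OF k] using l(1)[OF k] supported_mono[OF bc(2)[OF k]] by blast
    show "l k (sorted_list_of_set B ! (k - 1)) \<noteq> 0" unfolding B_sorted(2)[OF k] by (rule l(2)[OF k])
  qed
  ultimately show ?thesis unfolding eq by blast
qed

lemma closure_frame:
  assumes "V \<in> Gr_closure r n Y"
  obtains F where "F \<in> frames r n" "colspan n F = V"
proof -
  have "V \<in> Gr r n"
    using assms Abstract_Topology.closure_of_subset_topspace[of "Gr_topology r n" Y] topspace_Gr_topology by blast
  then show ?thesis using that by (auto simp: Gr_def)
qed

text \<open>Each space of the cell is a limit of spaces with nonzero free entries: add t to all free
  entries at once. The frame at hand differs from the matrix of the cell family by some g in GL_r,
  which is carried along the curve.\<close>

lemma cell_closure_image:
  assumes V: "V \<in> Gr_closure r n (cell r n A (InvQ r n A))"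
    and Y: "\<And>N. cell_family N \<Longrightarrow> (\<And>s i. s \<in> {1..r} \<Longrightarrow> i \<in> R s \<Longrightarrow> N s i \<noteq> 0) \<Longrightarrow>
       mat_act (perm_matrix n x) (fun_vec n ` fs.span (N ` {1..r})) \<in> Y"
  shows "mat_act (perm_matrix n x) V \<in> Gr_closure r n Y"
proof -
  obtain F where F: "F \<in> frames r n" "colspan n F = V" using closure_frame[OF V] .
  note xF = perm_matrix_frames[OF x F(1)]
  have "colspan n (perm_matrix n x * F) \<in> Gr_closure r n Y"
  proof (rule closure_of_GrI[OF xF(1)])
    fix p assume p: "p \<in> poly_funs r n" and pY: "\<And>N. N \<in> frames r n \<Longrightarrow> colspan n N \<in> Y \<Longrightarrow> p N = 0"
    obtain p' where p': "p' \<in> poly_funs r n" "\<And>M. M \<in> carrier_mat n r \<Longrightarrow> p' M = p (perm_matrix n x * M)"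
      using poly_funs_left_mult[OF p perm_matrix_carrier[of n x]] by blast
    have "p' F = 0"
    proof (rule closure_of_GrD[OF V p'(1) _ F])
      fix L assume L: "L \<in> frames r n" "colspan n L \<in> cell r n A (InvQ r n A)"
      obtain N where N: "cell_family N" "colspan n L = fun_vec n ` fs.span (N ` {1..r})"
        using L(2) unfolding in_cell_iff by blast
      obtain g where g: "g \<in> carrier_mat r r" "det g \<noteq> 0" "L = fam_mat n r (\<lambda>k. N (Suc k)) * g"
        using frames_same_colspan[OF cell_family_frame[OF N(1)] L(1)] N(2) unfolding colspan_fam_mat_Suc by metis
      define Nt where "Nt t s i = N s i + t * (if i \<in> R s - {src s} then 1 else 0)" for t s i
      have fam: "cell_family (Nt t)" for t
        unfolding cell_family_def
      proof (intro ballI conjI)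
        fix s assume s: "s \<in> {1..r}"
        have Ns: "N s \<in> supported (R s)" "N s (src s) = 1" using N(1) s by (auto simp: cell_family_def)
        show "Nt t s (src s) = 1" using Ns by (simp add: Nt_def)
        show "Nt t s \<in> supported (R s)" using Ns by (auto simp: Nt_def supported_def)
      qed
      have fin_R: "finite (R s)" if "s \<in> {1..r}" for s using R_sub[OF that] finite_subset by blast
      let ?\<Phi> = "\<lambda>t. fam_mat n r (\<lambda>k. Nt t (Suc k)) * g"
      have "p' (?\<Phi> 0) = 0"
      proof (rule vanishes_along_curve[OF p'(1), of ?\<Phi> "\<Union>s\<in>{1..r}. (\<lambda>i. - N s i) ` R s"])
        show "finite (\<Union>s\<in>{1..r}. (\<lambda>i. - N s i) ` R s)" using fin_R by blast
        show "\<exists>P. \<forall>t. ?\<Phi> t $$ (i, j) = poly P t" if ij: "i < n" "j < r" for i j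
        proof -
          \<comment> \<open>The summand t * 0 brings the constant factor into the linear form
            required by \<open>poly_expr_linear\<close>.\<close>
          have eq: "?\<Phi> t $$ (i, j) = (\<Sum>k<r. (N (Suc k) (Suc i) + t * (if Suc i \<in> R (Suc k) - {src (Suc k)} then 1 else 0)) *
              (g $$ (k, j) + t * 0))" for t
            using ij g(1) by (auto simp: fam_mat_def scalar_prod_def Nt_def atLeast0LessThan intro!: sum.cong)
          show ?thesis unfolding eq by (intro poly_expr_sum poly_expr_mult poly_expr_linear)
        qed
        fix t assume t: "t \<notin> (\<Union>s\<in>{1..r}. (\<lambda>i. - N s i) ` R s)"
        have nz: "Nt t s i \<noteq> 0" if s: "s \<in> {1..r}" and i: "i \<in> R s" for s i
        proof (cases "i = src s")
          case True
          then show ?thesis using fam[of t] s by (simp add: cell_family_def)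
        next
          case False
          have "- N s i \<noteq> t" using t s i by blast
          then have "N s i + t \<noteq> 0" by (metis add_eq_0_iff)
          then show ?thesis using False i by (simp add: Nt_def)
        qed
        note fr = frames_mult[OF cell_family_frame[OF fam[of t]] g(1,2)]
        have "colspan n (perm_matrix n x * ?\<Phi> t) \<in> Y"
          unfolding perm_matrix_frames(2)[OF x fr(1)] fr(2) colspan_fam_mat_Suc by (rule Y[OF fam nz])
        then have "p (perm_matrix n x * ?\<Phi> t) = 0" by (rule pY[OF perm_matrix_frames(1)[OF x fr(1)]])
        moreover have "?\<Phi> t \<in> carrier_mat n r" using fr(1) by (simp add: frames_def)
        ultimately show "p' (?\<Phi> t) = 0" using p'(2) by simp
      qed
      moreover have "Nt 0 = N" by (auto simp: Nt_def fun_eq_iff)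
      ultimately show "p' L = 0" using g(3) by simp
    qed
    then show "p (perm_matrix n x * F) = 0" using p'(2) F(1) by (simp add: frames_def)
  qed
  then show ?thesis using xF(2) F(2) by simp
qed

text \<open>Pulled back by x, the intervals become the sets \<open>S s\<close>, which contain the
  pivots \<open>src s\<close>; a chain without zeros on its intervals is therefore accepted by
  \<open>chain_cell\<close>.\<close>

lemma chain_image_in_cell:
  assumes s: "\<And>k. k \<in> {1..r} \<Longrightarrow> s k \<in> supported {bs k..cs k} \<and> (\<forall>i\<in>{bs k..cs k}. s k i \<noteq> 0)"
  defines "M \<equiv> perm_matrix n (Hilbert_Choice.inv x) * fam_mat n r (\<lambda>k. s (Suc k))"
  shows "M \<in> frames r n" "colspan n M \<in> cell r n A (InvQ r n A)"
proof -
  have M: "M \<in> carrier_mat n r" unfolding M_def by (rule mult_carrier_mat[OF perm_matrix_carrier fam_mat_carrier(1)])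
  define v where "v t = s (flip t) \<circ> x" for t
  have v: "v t \<in> supported (S t) \<and> v t (src t) \<noteq> 0" if t: "t \<in> {1..r}" for t
  proof -
    have ft: "flip t \<in> {1..r}" "bs (flip t) = lo t" "cs (flip t) = hi t"
      using flip_in[OF t] flip_flip[OF t] by (auto simp: bs_def cs_def)
    note sf = s[OF ft(1), unfolded ft(2,3)]
    have "v t \<in> supported (S t)"
      by (rule supportedI) (use sf x_in_interval_iff[OF t] in \<open>auto simp: v_def dest: supportedD\<close>)
    moreover have "x (src t) \<in> {lo t..hi t}" using x_in_interval_iff[OF t] src_S[OF t] by blast
    ultimately show ?thesis using sf by (auto simp: v_def)
  qed
  obtain N where N: "cell_family N" "fs.span (v ` {1..r}) = fs.span (N ` {1..r})"
    using chain_cell[of v] v by blast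
  have inv_inv: "Hilbert_Choice.inv (Hilbert_Choice.inv x) = x" using permutes_inv_inv[OF x] .
  have "colspan n M = mat_act (perm_matrix n (Hilbert_Choice.inv x)) (fun_vec n ` fs.span (s ` {1..r}))"
    unfolding M_def mat_act_colspan[OF perm_matrix_carrier fam_mat_carrier(1), symmetric] colspan_fam_mat_Suc ..
  also have "\<dots> = fun_vec n ` fs.span ((\<lambda>k. s k \<circ> x) ` {1..r})"
    unfolding mat_act_span[OF permutes_inv[OF x] finite_atLeastAtMost] inv_inv ..
  also have "(\<lambda>k. s k \<circ> x) ` {1..r} = (\<lambda>k. s k \<circ> x) ` flip ` {1..r}" by (simp only: flip_image)
  also have "\<dots> = v ` {1..r}" by (simp add: v_def image_image)
  finally have col: "colspan n M = fun_vec n ` fs.span (N ` {1..r})" using N(2) by simp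
  show "M \<in> frames r n"
    by (rule frames_of_colspan[OF cell_family_frame[OF N(1)] M]) (simp only: col colspan_fam_mat_Suc)
  show "colspan n M \<in> cell r n A (InvQ r n A)" unfolding in_cell_iff col using N(1) by blast
qed

text \<open>A polynomial vanishing on the cell is transported by the permutation matrix and fed to
  \<open>vanishes_on_chain\<close>. There the chain vectors may have zeros in their intervals and
  the families in their span may be dependent; one further curve repairs both defects.\<close>

lemma richardson_image:
  assumes V: "V \<in> Gr_closure r n (cell r n C (Inv C))"
    "V \<in> Gr_closure r n (lower_orbit n B)"
  shows "mat_act (perm_matrix n (Hilbert_Choice.inv x)) V \<in>
    Gr_closure r n (cell r n A (InvQ r n A))"
proof -
  let ?Q = "perm_matrix n (Hilbert_Choice.inv x)"
  obtain F where F: "F \<in> frames r n" "colspan n F = V" using closure_frame[OF V(1)] .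
  then obtain y where y: "F = fam_mat n r y" "\<And>k. y k \<in> supported {1..n}"
    using supported_fam[of F n r] by (auto simp: frames_def)
  obtain l where l: "V = fun_vec n ` fs.span (l ` {1..r})"
    "\<And>k. k \<in> {1..r} \<Longrightarrow> l k \<in> supported ({1..n} \<inter> {..cs k})"
    "\<And>k. k \<in> {1..r} \<Longrightarrow> l k \<notin> fs.span (l ` {1..<k})"
    using schubert_adapted[OF C_sorted(1) V(1)] C_sorted(2) by metis
  obtain u where u: "V = fun_vec n ` fs.span (u ` {1..r})"
    "\<And>k. k \<in> {1..r} \<Longrightarrow> u k \<in> supported ({1..n} \<inter> {bs k..})"
    using opposite_adapted[OF B_sorted(1) V(2)] B_sorted(2) by metis
  have in_n: "fs.span (y ` {..<r}) \<subseteq> supported {1..n}" "fs.span (l ` {1..r}) \<subseteq> supported {1..n}"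
    "fs.span (u ` {1..r}) \<subseteq> supported {1..n}"
  proof -
    have "l k \<in> supported {1..n}" "u k \<in> supported {1..n}" if "k \<in> {1..r}" for k
      using l(2)[OF that] u(2)[OF that] by (auto simp: supported_def)
    then show "fs.span (y ` {..<r}) \<subseteq> supported {1..n}" "fs.span (l ` {1..r}) \<subseteq> supported {1..n}"
      "fs.span (u ` {1..r}) \<subseteq> supported {1..n}"
      using y(2) by (intro span_supported; blast)+
  qed
  have span_lu: "fs.span (l ` {1..r}) = fs.span (u ` {1..r})"
    using inj_on_image_eq_iff[OF fun_vec_inj in_n(2,3)] l(1) u(1) by simp
  have span_y: "fs.span (y ` {..<r}) = fs.span (l ` {1..r})"
    using inj_on_image_eq_iff[OF fun_vec_inj in_n(1,2)] F(2) l(1) unfolding y(1) colspan_fam_mat by simp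
  note invx = permutes_inv[OF x]
  note xF = perm_matrix_frames[OF invx F(1)]
  have "colspan n (?Q * F) \<in> Gr_closure r n (cell r n A (InvQ r n A))"
  proof (rule closure_of_GrI[OF xF(1)])
    fix p assume p: "p \<in> poly_funs r n"
      and pY: "\<And>N. N \<in> frames r n \<Longrightarrow> colspan n N \<in> cell r n A (InvQ r n A) \<Longrightarrow> p N = 0"
    obtain p' where p': "p' \<in> poly_funs r n" "\<And>M. M \<in> carrier_mat n r \<Longrightarrow> p' M = p (?Q * M)"
      using poly_funs_left_mult[OF p perm_matrix_carrier] by blast
    have chain: "vanishes_on n r p' (fs.span (s ` {1..r}))"
      if s: "\<And>k. k \<in> {1..r} \<Longrightarrow> s k \<in> supported {bs k..cs k}" for s
      unfolding vanishes_on_def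
    proof (intro allI impI)
      fix y assume y: "\<forall>k<r. y k \<in> fs.span (s ` {1..r})"
      have "\<exists>c. y k = (\<Sum>j\<in>{1..r}. fscale (c j) (s j))" if "k < r" for k
        using y[rule_format, OF that] unfolding span_image_iff[OF finite_atLeastAtMost] .
      then obtain c where c: "\<And>k. k < r \<Longrightarrow> y k = (\<Sum>j\<in>{1..r}. fscale (c k j) (s j))" by metis
      \<comment> \<open>G expresses y in terms of s and may be singular. It is shifted to G + t I
        while t is added to every entry of \<open>s k\<close> on its interval; outside a finite set
        of t the product is then a frame of a space that is mapped into the cell.\<close>
      define G where "G = mat r r (\<lambda>(j, k). c k (Suc j))"
      have Gc: "G \<in> carrier_mat r r" by (simp add: G_def)
      define Gt where "Gt t = char_matrix G (- t)" for t
      have Gtc: "Gt t \<in> carrier_mat r r" for t using Gc by (simp add: Gt_def)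
      define st where "st t k i = s k i + t * (if i \<in> {bs k..cs k} then 1 else 0)" for t k i
      let ?\<Phi> = "\<lambda>t. fam_mat n r (\<lambda>k. st t (Suc k)) * Gt t"
      let ?Z = "(\<Union>k\<in>{1..r}. (\<lambda>i. - s k i) ` {bs k..cs k}) \<union> uminus ` {t. det (char_matrix G t) = 0}"
      have "p' (?\<Phi> 0) = 0"
      proof (rule vanishes_along_curve[OF p'(1), of ?\<Phi> ?Z])
        show "finite ?Z" using char_matrix_det_nonzero[OF Gc] by blast
        show "\<exists>P. \<forall>t. ?\<Phi> t $$ (i, j) = poly P t" if ij: "i < n" "j < r" for i j
        proof -
          have eq: "?\<Phi> t $$ (i, j) = (\<Sum>k<r. (s (Suc k) (Suc i) + t * (if Suc i \<in> {bs (Suc k)..cs (Suc k)} then 1 else 0)) *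
              (G $$ (k, j) + t * (if k = j then 1 else 0)))" for t
            using ij Gc Gtc[of t]
            by (auto simp: fam_mat_def scalar_prod_def st_def atLeast0LessThan Gt_def char_matrix_def intro!: sum.cong)
          show ?thesis unfolding eq by (intro poly_expr_sum poly_expr_mult poly_expr_linear)
        qed
        fix t assume t: "t \<notin> ?Z"
        have st_ok: "st t k \<in> supported {bs k..cs k} \<and> (\<forall>i\<in>{bs k..cs k}. st t k i \<noteq> 0)" if k: "k \<in> {1..r}" for k
        proof (intro conjI ballI)
          show "st t k \<in> supported {bs k..cs k}"
            by (rule supportedI) (use supportedD[OF s[OF k]] in \<open>auto simp: st_def\<close>)
          fix i assume i: "i \<in> {bs k..cs k}"
          have "- s k i \<noteq> t" using t k i by blast
          then have "s k i + t \<noteq> 0" by (metis add_eq_0_iff)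
          then show "st t k i \<noteq> 0" using i by (simp add: st_def)
        qed
        have fr: "?Q * fam_mat n r (\<lambda>k. st t (Suc k)) \<in> frames r n"
          "colspan n (?Q * fam_mat n r (\<lambda>k. st t (Suc k))) \<in> cell r n A (InvQ r n A)"
          using chain_image_in_cell[of "st t"] st_ok by blast+
        have "det (Gt t) \<noteq> 0"
        proof
          assume "det (Gt t) = 0"
          then have "t \<in> uminus ` {t. det (char_matrix G t) = 0}"
            unfolding Gt_def by (intro image_eqI[of _ _ "- t"]) auto
          then show False using t by blast
        qed
        note fm = frames_mult[OF fr(1) Gtc this]
        have assoc: "?Q * fam_mat n r (\<lambda>k. st t (Suc k)) * Gt t = ?Q * ?\<Phi> t"
          by (rule assoc_mult_mat[OF perm_matrix_carrier fam_mat_carrier(1) Gtc])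
        have "p (?Q * ?\<Phi> t) = 0"
          unfolding assoc[symmetric] by (rule pY[OF fm(1)], unfold fm(2), rule fr(2))
        moreover have "?\<Phi> t \<in> carrier_mat n r" by (rule mult_carrier_mat[OF fam_mat_carrier(1) Gtc])
        ultimately show "p' (?\<Phi> t) = 0" using p'(2) by simp
      qed
      moreover have "?\<Phi> 0 = fam_mat n r y"
      proof (rule eq_matI)
        fix i k assume "i < dim_row (fam_mat n r y)" "k < dim_col (fam_mat n r y)"
        then have ik: "i < n" "k < r" by simp_all
        have "?\<Phi> 0 $$ (i, k) = (\<Sum>j<r. s (Suc j) (Suc i) * c k (Suc j))"
          using ik Gc Gtc[of 0]
          by (auto simp: fam_mat_def scalar_prod_def st_def atLeast0LessThan Gt_def char_matrix_def G_def intro!: sum.cong)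
        also have "\<dots> = (\<Sum>j\<in>{1..r}. c k j * s j (Suc i))"
          by (rule sum.reindex_bij_witness[of _ "\<lambda>j. j - 1" Suc]) auto
        also have "\<dots> = fam_mat n r y $$ (i, k)" using ik by (simp add: fam_mat_def c fscale_apply)
        finally show "?\<Phi> 0 $$ (i, k) = fam_mat n r y $$ (i, k)" .
      qed (use Gtc[of 0] in auto)
      ultimately show "p' (fam_mat n r y) = 0" by simp
    qed
    have bs_mono: "bs i \<le> bs j" if "1 \<le> i" "i \<le> j" "j \<le> r" for i j
      using bs_less[of i j] that by (cases "i = j") auto
    \<comment> \<open>All intervals are still untreated here, so the range r < k \<le> r is empty
      and the zero family is a placeholder.\<close>
    have "vanishes_on n r p' (fs.span (l ` {1..r} \<union> (\<lambda>_. 0) ` {r<..r}))"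
    proof (rule vanishes_on_chain[OF p'(1), of bs cs r l u "\<lambda>_. 0"])
      show "vanishes_on n r p' (fs.span (s ` {1..r}))" if "\<And>k. k \<in> {1..r} \<Longrightarrow> s k \<in> supported {bs k..cs k}" for s
        by (rule chain[OF that])
      show "l k \<notin> fs.span (l ` {1..<k})" if "k \<in> {1..r}" for k by (rule l(3)[OF that])
      show "l k \<in> supported {..cs k}" if "k \<in> {1..r}" for k
        using l(2)[OF that] supported_mono[of "{1..n} \<inter> {..cs k}" "{..cs k}"] by auto
      show "u k \<in> supported {bs k..}" if "k \<in> {1..r}" for k
        using u(2)[OF that] supported_mono[of "{1..n} \<inter> {bs k..}" "{bs k..}"] by auto
    qed (use cs_less bs_mono cs_le_bs_Suc span_lu in \<open>auto simp: supported_def\<close>)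
    then have "vanishes_on n r p' (fs.span (l ` {1..r}))" by simp
    moreover have "\<forall>k<r. y k \<in> fs.span (l ` {1..r})"
      unfolding span_y[symmetric] by (auto intro: fs.span_base)
    ultimately have "p' F = 0" unfolding vanishes_on_def y(1) by blast
    then show "p (?Q * F) = 0" using p'(2) F(1) by (simp add: frames_def)
  qed
  then show ?thesis using xF(2) F(2) by simp
qed

lemma mat_act_inverse:
  assumes "V \<subseteq> carrier_vec n" and z: "z permutes {1..n}"
  shows "mat_act (perm_matrix n (Hilbert_Choice.inv z)) (mat_act (perm_matrix n z) V) = V"
proof -
  have "perm_matrix n (Hilbert_Choice.inv z) *\<^sub>v (perm_matrix n z *\<^sub>v v) = v" if v: "v \<in> carrier_vec n" for v
  proof -
    define f where "f j = v $ (j - 1)" for j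
    have vf: "v = fun_vec n f" using v by (intro eq_vecI) (auto simp: fun_vec_def f_def)
    have "(f \<circ> Hilbert_Choice.inv z) \<circ> Hilbert_Choice.inv (Hilbert_Choice.inv z) = f"
      using permutes_inverses[OF z] permutes_inv_inv[OF z] by (auto simp: fun_eq_iff)
    then show ?thesis
      unfolding vf perm_matrix_fun_vec[OF z] perm_matrix_fun_vec[OF permutes_inv[OF z]] by simp
  qed
  then have "\<And>v. v \<in> V \<Longrightarrow> perm_matrix n (Hilbert_Choice.inv z) *\<^sub>v (perm_matrix n z *\<^sub>v v) = v"
    using assms(1) by blast
  then show ?thesis unfolding mat_act_def image_image by simp
qed

lemma closure_carrier:
  assumes "V \<in> Gr_closure r n Y" shows "V \<subseteq> carrier_vec n"
proof -
  obtain F where "F \<in> frames r n" "colspan n F = V" using closure_frame[OF assms] .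
  then show ?thesis using colspan_alt[of F n r] by (auto simp: frames_def)
qed

theorem closure_eq_translate:
  "Gr_closure r n (cell r n A (InvQ r n A)) =
   translate n (Hilbert_Choice.inv x)
     (Gr_closure r n (cell r n C (Inv C)) \<inter>
      Gr_closure r n (lower_orbit n B))" (is "?L = translate n _ (?X \<inter> ?Y)")
proof
  show "?L \<subseteq> translate n (Hilbert_Choice.inv x) (?X \<inter> ?Y)"
  proof
    fix V assume V: "V \<in> ?L"
    have "mat_act (perm_matrix n x) V \<in> ?X" by (rule cell_closure_image[OF V]) (use generic_image in blast)
    moreover have "mat_act (perm_matrix n x) V \<in> ?Y" by (rule cell_closure_image[OF V]) (use generic_image in blast)
    moreover have "V = mat_act (perm_matrix n (Hilbert_Choice.inv x)) (mat_act (perm_matrix n x) V)"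
      using mat_act_inverse[OF closure_carrier[OF V] x] by simp
    ultimately show "V \<in> translate n (Hilbert_Choice.inv x) (?X \<inter> ?Y)" unfolding translate_def by blast
  qed
  show "translate n (Hilbert_Choice.inv x) (?X \<inter> ?Y) \<subseteq> ?L"
    unfolding translate_def using richardson_image by blast
qed

end

section \<open>The permutation of a ribbon\<close>

lemma one_line_permutes:
  assumes "distinct xs" and "set xs = {1..n}"
  shows "one_line xs permutes {1..n}"
proof -
  have len: "length xs = n" using distinct_card[OF assms(1)] assms(2) by simp
  have "bij_betw (one_line xs) {1..n} {1..n}"
  proof (rule bij_betw_imageI)
    show "inj_on (one_line xs) {1..n}"
      using assms(1) len by (auto simp: inj_on_def one_line_def nth_eq_iff_index_eq)
    show "one_line xs ` {1..n} = {1..n}"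
    proof (intro equalityI subsetI)
      fix y assume "y \<in> one_line xs ` {1..n}"
      then obtain i where "i \<in> {1..n}" "y = xs ! (i - 1)" using len by (auto simp: one_line_def)
      then have "y \<in> set xs" using len nth_mem[of "i - 1" xs] by auto
      then show "y \<in> {1..n}" using assms(2) by simp
    next
      fix y assume "y \<in> {1..n}"
      then have "y \<in> set xs" using assms(2) by simp
      then obtain i where "i < n" "y = xs ! i" unfolding in_set_conv_nth len by blast
      then show "y \<in> one_line xs ` {1..n}" using len by (intro image_eqI[of _ _ "Suc i"]) (auto simp: one_line_def)
    qed
  qed
  then show ?thesis using len by (intro bij_imp_permutes) (auto simp: one_line_def)
qed

context staircase
begin

definition step :: "nat \<Rightarrow> nat" where "step t = Max {s \<in> {a..r + 1}. t \<le> \<rho> s}"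

text \<open>For t > r, element number t - r of the complement of B is t - r plus the number of
  elements of B below it. These are the \<open>lo s\<close> with s < a or s \<ge>
  \<open>step t\<close>, which makes r + a - step t of them; above \<open>\<rho> a\<close> all r
  elements are below.\<close>

definition comp_enum :: "nat \<Rightarrow> nat" where
  "comp_enum t = (if t \<le> \<rho> a then t + a - step t else t)"

lemma step_eq:
  assumes "a \<le> s" "s \<le> r" "\<rho> (s + 1) < t" "t \<le> \<rho> s"
  shows "step t = s"
  unfolding step_def
proof (rule Max_eqI)
  show "y \<le> s" if "y \<in> {s \<in> {a..r + 1}. t \<le> \<rho> s}" for y
    using that assms \<rho>_anti[of "s + 1" y] by (cases "y \<le> s") auto
qed (use assms in auto)

lemma step_props:
  assumes "r < t" "t \<le> \<rho> a"
  shows "a \<le> step t" "step t \<le> r" "\<rho> (step t + 1) < t" "t \<le> \<rho> (step t)"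
proof -
  obtain p where p: "p \<in> P" "a \<le> p" "\<rho> (p + 1) < t" "t \<le> \<rho> p"
    using step_exists[of a t] assms a_le by auto
  have "step t = p" using step_eq[of p t] p P_bounds(1)[OF p(1)] by simp
  then show "a \<le> step t" "step t \<le> r" "\<rho> (step t + 1) < t" "t \<le> \<rho> (step t)"
    using p P_bounds(1)[OF p(1)] by auto
qed

lemma comp_enum_less:
  assumes "r < t" "t < t'" shows "comp_enum t < comp_enum t'"
proof (cases "t' \<le> \<rho> a")
  case True
  note p = step_props[of t] step_props[of t']
  have "step t' \<le> step t"
  proof (rule ccontr)
    assume "\<not> step t' \<le> step t"
    then have "\<rho> (step t') \<le> \<rho> (step t + 1)" using p assms True by (intro \<rho>_anti) auto
    then show False using p assms True by auto
  qed
  then show ?thesis using True assms p by (auto simp: comp_enum_def)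
next
  case False
  then show ?thesis using assms step_props[of t] by (auto simp: comp_enum_def)
qed

lemma comp_enum_range:
  assumes "r < t" "t \<le> n" shows "comp_enum t \<in> {1..n} - B"
proof -
  have ge: "a \<le> comp_enum t" "1 \<le> comp_enum t" "comp_enum t \<le> n"
    using assms a_le a1 step_props[of t] by (auto simp: comp_enum_def)
  have "comp_enum t \<noteq> lo s" if s: "s \<in> {1..r}" for s
  proof (cases "s < a")
    case True
    then show ?thesis using ge by (simp add: lo_def)
  next
    case False
    then have lo: "lo s = \<rho> (s + 1) + a - s" and \<rho>s: "r \<le> \<rho> (s + 1)" using \<rho>_ge[of "s + 1"] s by (auto simp: lo_def)
    show ?thesis
    proof (cases "t \<le> \<rho> a")
      case True
      note p = step_props[OF assms(1) True]
      have c: "comp_enum t = t + a - step t" using True by (simp add: comp_enum_def)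
      show ?thesis
      proof (cases "step t \<le> s")
        case True
        then have "\<rho> (s + 1) \<le> \<rho> (step t + 1)" using p s by (intro \<rho>_anti) auto
        then show ?thesis using p True s \<rho>s unfolding c lo by auto
      next
        case False
        then have "\<rho> (step t) \<le> \<rho> (s + 1)" using p s \<open>\<not> s < a\<close> by (intro \<rho>_anti) auto
        then show ?thesis using p False s \<rho>s unfolding c lo by auto
      qed
    next
      case False
      have "\<rho> (s + 1) \<le> \<rho> a" using \<rho>_anti[of a "s + 1"] \<open>\<not> s < a\<close> s by auto
      then show ?thesis using False \<open>\<not> s < a\<close> unfolding lo by (auto simp: comp_enum_def)
    qed
  qed
  then have "comp_enum t \<noteq> bs k" if "k \<in> {1..r}" for k using flip_in[OF that] by (simp add: bs_def)
  then have "comp_enum t \<notin> B" unfolding B_def by blast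
  with ge show ?thesis by auto
qed

text \<open>The values increase and lie in the complement, and there are n - r of them.\<close>

lemma sorted_complement_B: "sorted_list_of_set ({1..n} - B) = map comp_enum [Suc r..<Suc n]"
proof -
  let ?xs = "map comp_enum [Suc r..<Suc n]"
  have sorted: "sorted_wrt (<) ?xs"
    using comp_enum_less by (auto simp: sorted_wrt_map sorted_wrt_iff_nth_less simp del: upt_Suc)
  then have "distinct ?xs" by (simp only: strict_sorted_iff)
  then have card: "card (set ?xs) = n - r" using distinct_card by fastforce
  have BN: "B \<subseteq> {1..n}" "card B = r" using B_sorted(1) by (auto simp: rsubsets_def)
  have "card ({1..n} - B) = n - r" using BN finite_subset[of B "{1..n}"] by (simp add: card_Diff_subset)
  moreover have "set ?xs \<subseteq> {1..n} - B"
  proof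
    fix y assume "y \<in> set ?xs"
    then obtain t where "t \<in> {Suc r..<Suc n}" "y = comp_enum t" by (auto simp del: upt_Suc)
    then show "y \<in> {1..n} - B" using comp_enum_range[of t] by simp
  qed
  ultimately have "set ?xs = {1..n} - B" using card by (intro card_subset_eq) auto
  then show ?thesis using sorted
    by (metis strict_sorted_iff sorted_list_of_set.idem_if_sorted_distinct)
qed

text \<open>On \<open>{1..r}\<close> the inner permutation is \<open>flip\<close> and the outer one
  lists B increasingly, which gives \<open>lo\<close>. Beyond r the inner one is the identity and
  the outer one lists the complement of B.\<close>

lemma grassmannian_ribbon_perm:
  fixes nu
  assumes B: "subset_of_part r n nu = B" and l: "a + l = r + 1"
  defines "x \<equiv> grassmannian_perm r n nu \<circ> ribbon_perm r n l"
  shows "staircase_perm r n a \<rho> x"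
proof -
  note bs = rsubsets_sorted_list[OF B_sorted(1)]
  have BN: "B \<subseteq> {1..n}" using B_sorted(1) by (auto simp: rsubsets_def)
  let ?gl = "sorted_list_of_set B @ sorted_list_of_set ({1..n} - B)"
  have g: "grassmannian_perm r n nu = one_line ?gl"
    by (simp add: grassmannian_perm_def B Let_def)
  have gp: "grassmannian_perm r n nu permutes {1..n}" unfolding g
    by (rule one_line_permutes) (use bs(1) BN in auto)
  have gl_len: "length ?gl = n"
    using bs(3) rn unfolding sorted_complement_B by (simp del: upt_Suc)
  let ?rl = "[1..<r - l + 1] @ rev [r - l + 1..<r + 1] @ [r + 1..<n + 1]"
  have rlen: "length ?rl = n" using l a1 rn by (simp del: upt_Suc)
  have rp: "ribbon_perm r n l permutes {1..n}" unfolding ribbon_perm_def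
    by (rule one_line_permutes) (use l a1 rn in auto)
  have x: "x permutes {1..n}" unfolding x_def using permutes_compose[OF rp gp] .
  have a_eq: "r - l + 1 = a" using l a1 by simp
  have rl: "ribbon_perm r n l s = ?rl ! (s - 1)" if "s \<in> {1..n}" for s
    unfolding ribbon_perm_def one_line_def using that rlen by simp
  have r_low: "ribbon_perm r n l s = flip s" if "s \<in> {1..r}" for s
  proof (cases "s < a")
    case True
    then have "?rl ! (s - 1) = s" using that unfolding a_eq by (auto simp: nth_append simp del: upt_Suc)
    then show ?thesis using rl[of s] that rn True by (simp add: flip_def)
  next
    case False
    have "?rl ! (s - 1) = rev [a..<r + 1] ! (s - a)"
      unfolding a_eq using that False a1 by (auto simp: nth_append simp del: upt_Suc)
    also have "\<dots> = r + a - s" using that False by (subst rev_nth) (auto simp del: upt_Suc)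
    finally show ?thesis using rl[of s] that rn False by (simp add: flip_def)
  qed
  have r_high: "ribbon_perm r n l t = t" if "r < t" "t \<le> n" for t
  proof -
    have "?rl ! (t - 1) = [r + 1..<n + 1] ! (t - 1 - r)"
      unfolding a_eq using that l a1 by (auto simp: nth_append simp del: upt_Suc)
    also have "\<dots> = t" using that by (auto simp del: upt_Suc)
    finally show ?thesis using rl[of t] that by simp
  qed
  have x_lo: "x s = lo s" if s: "s \<in> {1..r}" for s
  proof -
    note fs = flip_in[OF s]
    have "x s = ?gl ! (flip s - 1)"
      unfolding x_def comp_def r_low[OF s] g one_line_def using fs gl_len rn by auto
    also have "\<dots> = sorted_list_of_set B ! (flip s - 1)" using fs bs(3) by (auto simp: nth_append)
    also have "\<dots> = bs (flip s)" by (rule B_sorted(2)[OF fs])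
    also have "\<dots> = lo s" using flip_flip[OF s] by (simp add: bs_def)
    finally show ?thesis .
  qed
  have x_hi: "x t = comp_enum t" if t: "r < t" "t \<le> n" for t
  proof -
    have "x t = ?gl ! (t - 1)"
      unfolding x_def comp_def r_high[OF t] g one_line_def using t gl_len by auto
    also have "\<dots> = sorted_list_of_set ({1..n} - B) ! (t - 1 - r)" using t bs(3) by (auto simp: nth_append)
    also have "\<dots> = comp_enum t" unfolding sorted_complement_B using t by (subst nth_map) (auto simp del: upt_Suc)
    finally show ?thesis .
  qed
  show ?thesis
  proof (unfold_locales)
    show "x permutes {1..n}" by (rule x)
    show "x s = s" if "1 \<le> s" "s < a" for s
      using x_lo[of s] that a_le by (simp add: lo_def)
    show "x s = \<rho> (s + 1) + a - s" if "a \<le> s" "s \<le> r" for s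
      using x_lo[of s] that a1 by (simp add: lo_def)
    show "x t = t + a - s" if "a \<le> s" "s \<le> r" "\<rho> (s + 1) < t" "t \<le> \<rho> s" for s t
    proof -
      have "r < t" "t \<le> \<rho> a" "t \<le> n"
        using that \<rho>_ge[of "s + 1"] \<rho>_anti[of a s] \<rho>_first by auto
      then show ?thesis using x_hi[of t] step_eq[OF that] by (simp add: comp_enum_def)
    qed
  qed
qed

end

lemma subset_of_part_eq:
  assumes "r \<le> n" "J \<in> rsubsets r n" "part_of_subset J = lam"
  shows "subset_of_part r n lam = J"
  unfolding subset_of_part_def
  using bij_betw_imp_inj_on[OF bij_betw_part_of_subset[OF assms(1)]] assms(3,2) by (rule the_inv_into_f_eq)

lemma part_of_subset_rows:
  assumes J: "J \<in> rsubsets r n" and len: "length lam = r"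
    and rows: "\<And>i. i \<in> {1..r} \<Longrightarrow> part_row lam i = sorted_list_of_set J ! (r - i) - (r + 1 - i)"
  shows "part_of_subset J = lam"
proof (rule nth_equalityI)
  have card: "card J = r" using J by (simp add: rsubsets_def)
  show "length (part_of_subset J) = length lam" by (simp add: part_of_subset_def card len)
  fix i assume "i < length (part_of_subset J)"
  then have i: "i < r" by (simp add: part_of_subset_def card)
  have "part_of_subset J ! i = sorted_list_of_set J ! (r - Suc i) - (r - Suc i + 1)"
    unfolding part_of_subset_def card using i by (subst rev_nth) auto
  also have "\<dots> = part_row lam (Suc i)" using rows[of "Suc i"] i by (simp add: Suc_diff_Suc)
  also have "\<dots> = lam ! i" using i len by (simp add: part_row_def)
  finally show "part_of_subset J ! i = lam ! i" .
qed

section \<open>Ribbons and compositions\<close>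

lemma part_row_antimono:
  assumes "lam \<in> Part r n" "1 \<le> i" "i \<le> j"
  shows "part_row lam j \<le> part_row lam i"
proof (cases "i < j \<and> j \<le> length lam")
  case True
  then have "lam ! (j - 1) \<le> lam ! (i - 1)"
    using assms sorted_wrt_nth_less[of "(\<ge>)" lam "i - 1" "j - 1"] by (auto simp: Part_def)
  then show ?thesis using True assms by (simp add: part_row_def)
next
  case False
  then show ?thesis using assms by (cases "i = j") (auto simp: part_row_def)
qed

lemma part_row_le: "lam \<in> Part r n \<Longrightarrow> part_row lam i \<le> n - r"
  by (auto simp: Part_def part_row_def)

text \<open>Every row of the ribbon except the top one shares its last column with the row above;
  this column is not counted, hence the subtraction.\<close>

definition inc :: "nat list \<Rightarrow> nat \<Rightarrow> nat" where
  "inc al i = (if i = 0 then al ! 0 else al ! i - 1)"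

text \<open>The staircase \<rho> of \<alpha>: its height above r is the first row of \<eta> at a,
  and row i of \<nu> at a + i.\<close>

definition steps :: "nat \<Rightarrow> nat \<Rightarrow> nat list \<Rightarrow> nat \<Rightarrow> nat" where
  "steps r a al s = r + (\<Sum>i\<in>{s - a..<length al}. inc al i)"

lemma sum_minus_one:
  assumes "\<forall>x\<in>set xs. 1 \<le> x"
  shows "(\<Sum>i<length xs. xs ! i - 1) + length xs = sum_list xs"
  using assms by (induction xs) (auto simp: sum.lessThan_Suc_shift simp del: sum.lessThan_Suc)

lemma sum_inc:
  assumes "\<forall>x\<in>set al. 1 \<le> x" "al \<noteq> []"
  shows "(\<Sum>i<length al. inc al i) + length al = sum_list al + 1"
proof -
  obtain y ys where al: "al = y # ys" using assms(2) by (cases al) auto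
  have "(\<Sum>i<length al. inc al i) = y + (\<Sum>i<length ys. ys ! i - 1)"
    unfolding al by (simp add: sum.lessThan_Suc_shift inc_def del: sum.lessThan_Suc)
  then show ?thesis using sum_minus_one[of ys] assms(1) al by simp
qed

text \<open>For nonempty \<alpha> the size condition in \<open>Comp\<close> says exactly that \<rho>
  a is at most n, by \<open>sum_inc\<close>; the first drop occurs because the first part is
  positive.\<close>

lemma staircase_steps:
  assumes "r \<le> n" "al \<in> Comp r n" "a + length al = r + 1" "1 \<le> a"
  shows "staircase r n a (steps r a al)"
proof
  have al: "\<forall>x\<in>set al. 1 \<le> x" using assms(2) by (auto simp: Comp_def)
  show "1 \<le> a" "a \<le> r + 1" using assms by auto
  show "steps r a al j \<le> steps r a al i" if "a \<le> i" "i \<le> j" "j \<le> r + 1" for i j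
    unfolding steps_def using that by (intro add_left_mono sum_mono2) auto
  have "r + 1 - a = length al" using assms by simp
  then show "steps r a al (r + 1) = r" by (simp add: steps_def)
  show "steps r a al a \<le> n"
  proof (cases "al = []")
    case False
    then have "sum_list al - length al + 1 \<le> n - r" using assms(2) by (auto simp: Comp_def)
    moreover have "length al \<le> sum_list al" using sum_minus_one[OF al] by simp
    ultimately show ?thesis using sum_inc[OF al False] assms(1) by (simp add: steps_def atLeast0LessThan)
  qed (use assms in \<open>simp add: steps_def\<close>)
  show "steps r a al (a + 1) < steps r a al a" if "a \<le> r"
  proof -
    have "al \<noteq> []" using that assms by auto
    then have "{0..<length al} = insert 0 {1..<length al}" "1 \<le> al ! 0" using al by auto
    then show ?thesis by (simp add: steps_def inc_def)
  qed
qed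

lemma steps_rec: "i < length al \<Longrightarrow> steps r a al (a + i) = steps r a al (a + i + 1) + inc al i"
  by (simp add: steps_def sum.atLeast_Suc_lessThan)

text \<open>A path between boxes that leads from row i or above to a lower row contains a vertical
  step out of row i.\<close>

lemma adjacent_path_crosses:
  assumes "(b, c) \<in> {(x, y). x \<in> S \<and> y \<in> S \<and> box_adjacent x y}\<^sup>*" and "fst b \<le> i" "i < fst c"
  shows "\<exists>j. (i, j) \<in> S \<and> (i + 1, j) \<in> S"
  using assms(1,3)
proof (induction rule: rtrancl_induct)
  case base
  then show ?case using assms(2) by simp
next
  case (step y z)
  show ?case
  proof (cases "i < fst y")
    case False
    then have "fst y = i" "z = (i + 1, snd y)" using step by (auto simp: box_adjacent_def)
    then show ?thesis using step by (metis (mono_tags, lifting) case_prodD mem_Collect_eq prod.collapse)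
  qed (use step in blast)
qed

lemma ribbon_rows:
  assumes nu: "nu \<in> Part r n" and eta: "eta \<in> Part r n" and al: "al \<in> Comp r n"
    and rs: "ribbon_shape al eta nu"
  defines "l \<equiv> length al"
  shows "\<And>i. i \<in> {1..l} \<Longrightarrow> part_row nu i = (\<Sum>j\<in>{i..<l}. inc al j)"
    and "\<And>i. i \<in> {1..l} \<Longrightarrow> part_row eta i = part_row nu i + al ! (i - 1)"
    and "\<And>i. l < i \<Longrightarrow> part_row nu i = 0 \<and> part_row eta i = 0"
proof -
  define S where "S = diagram eta - diagram nu"
  have sub: "diagram nu \<subseteq> diagram eta" and conn: "box_connected S"
    and no22: "\<And>i j. \<not> {(i, j), (i + 1, j), (i, j + 1), (i + 1, j + 1)} \<subseteq> S"
    and diff: "\<And>i. i \<in> {1..l} \<Longrightarrow> part_row eta i - part_row nu i = al ! (i - 1)"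
    and sw: "al \<noteq> [] \<Longrightarrow> \<exists>b. southwest_end S b \<and> snd b = 1"
    and rows: "{i. part_row eta i \<noteq> 0} = {1..l}"
    using rs unfolding ribbon_shape_def Let_def ribbon_def S_def l_def by blast+
  have S_iff: "(i, j) \<in> S \<longleftrightarrow> 1 \<le> i \<and> part_row nu i < j \<and> j \<le> part_row eta i" for i j
    by (auto simp: S_def diagram_def)
  have pos: "1 \<le> al ! (i - 1)" if "i \<in> {1..l}" for i
  proof -
    have "al ! (i - 1) \<in> set al" using that by (auto simp: l_def)
    then show ?thesis using al by (auto simp: Comp_def)
  qed
  show eta_eq: "part_row eta i = part_row nu i + al ! (i - 1)" if "i \<in> {1..l}" for i
    using diff[OF that] pos[OF that] by simp
  show zero: "part_row nu i = 0 \<and> part_row eta i = 0" if "l < i" for i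
  proof -
    have e: "part_row eta i = 0" using rows that by (metis (mono_tags) atLeastAtMost_iff leD mem_Collect_eq)
    have "\<not> 1 \<le> part_row nu i"
    proof
      assume "1 \<le> part_row nu i"
      then have "(i, part_row nu i) \<in> diagram nu" using that by (auto simp: diagram_def)
      then have "(i, part_row nu i) \<in> diagram eta" using sub by blast
      then show False using e \<open>1 \<le> part_row nu i\<close> by (simp add: diagram_def)
    qed
    with e show ?thesis by simp
  qed
  have end_S: "(i, part_row eta i) \<in> S" if "i \<in> {1..l}" for i
    using eta_eq[OF that] pos[OF that] that by (auto simp: S_iff)
  have next_row: "part_row eta (i + 1) = part_row nu i + 1" if i: "1 \<le> i" "i < l" for i
  proof (rule antisym)
    have "((i, part_row eta i), (i + 1, part_row eta (i + 1))) \<in> {(x, y). x \<in> S \<and> y \<in> S \<and> box_adjacent x y}\<^sup>*"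
      using conn end_S[of i] end_S[of "i + 1"] i unfolding box_connected_def by auto
    then obtain j where "(i, j) \<in> S" "(i + 1, j) \<in> S" using adjacent_path_crosses[of _ _ S i] by force
    then show "part_row nu i + 1 \<le> part_row eta (i + 1)" by (simp add: S_iff)
    show "part_row eta (i + 1) \<le> part_row nu i + 1"
    proof (rule ccontr)
      assume "\<not> part_row eta (i + 1) \<le> part_row nu i + 1"
      moreover have "part_row eta (i + 1) \<le> part_row eta i" "part_row nu (i + 1) \<le> part_row nu i"
        using part_row_antimono[OF eta, of i "i + 1"] part_row_antimono[OF nu, of i "i + 1"] i by auto
      \<comment> \<open>Two shared columns would produce the square whose upper left corner is the
        first box of row i of the ribbon.\<close>
      ultimately have "{(i, part_row nu i + 1), (i + 1, part_row nu i + 1), (i, part_row nu i + 1 + 1),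
          (i + 1, part_row nu i + 1 + 1)} \<subseteq> S"
        using i by (auto simp: S_iff)
      then show False using no22 by blast
    qed
  qed
  have last: "part_row nu l = 0" if "1 \<le> l"
  proof -
    have "al \<noteq> []" using that by (auto simp: l_def)
    then obtain i0 where b: "southwest_end S (i0, 1)" using sw by (metis prod.collapse)
    then have i0: "(i0, 1) \<in> S" and "\<forall>c\<in>S. fst c \<le> i0" by (auto simp: southwest_end_def)
    then have "l \<le> i0" using end_S[of l] that by force
    moreover have "part_row eta i0 \<noteq> 0" using i0 by (auto simp: S_iff)
    then have "i0 \<in> {1..l}" using rows by blast
    ultimately show ?thesis using i0 by (auto simp: S_iff)
  qed
  show "part_row nu i = (\<Sum>j\<in>{i..<l}. inc al j)" if "i \<in> {1..l}" for i
  proof -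
    have "i \<le> l" "1 \<le> i" using that by auto
    then show ?thesis
    proof (induction i rule: inc_induct)
      case base
      then show ?case using last by simp
    next
      case (step m)
      have "part_row nu m + 1 = part_row nu (Suc m) + al ! m"
        using next_row[of m] eta_eq[of "Suc m"] step by simp
      then have "part_row nu m = part_row nu (Suc m) + inc al m"
        using pos[of "Suc m"] step by (auto simp: inc_def)
      also have "part_row nu (Suc m) = (\<Sum>j\<in>{Suc m..<l}. inc al j)" using step by simp
      finally show ?case using step by (simp add: sum.atLeast_Suc_lessThan)
    qed
  qed
qed

text \<open>The Frobenius data of a composition whose first part has been raised by one: a suffix
  starting with a part above 1 starts a block, and its length and its excess over a list of ones are
  leg + 1 and arm + 1 of a diagonal box.\<close>

fun descents :: "nat list \<Rightarrow> (nat \<times> nat) set" where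
  "descents [] = {}"
| "descents (x # xs) = (if 1 < x then {(length (x # xs), sum_list (map (\<lambda>y. y - 1) (x # xs)))} else {}) \<union> descents xs"

lemma sum_list_map_nth: "sum_list (map f zs) = (\<Sum>j\<in>{0..<length zs}. f (zs ! j))"
  by (simp add: sum_list_sum_nth)

lemma descents_iff:
  "(u, v) \<in> descents xs \<longleftrightarrow>
    (\<exists>i<length xs. 1 < xs ! i \<and> u = length xs - i \<and> v = (\<Sum>j\<in>{i..<length xs}. xs ! j - 1))"
proof (induction xs)
  case (Cons x xs)
  have sum0: "sum_list (map (\<lambda>y. y - 1) (x # xs)) = (\<Sum>j\<in>{0..<length (x # xs)}. (x # xs) ! j - 1)"
    by (simp only: sum_list_map_nth)
  have shift: "(\<Sum>j\<in>{Suc i..<Suc (length xs)}. (x # xs) ! j - 1) = (\<Sum>j\<in>{i..<length xs}. xs ! j - 1)" for i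
    by (simp add: sum.shift_bounds_Suc_ivl del: sum.op_ivl_Suc)
  have "(\<exists>i<length (x # xs). 1 < (x # xs) ! i \<and> u = length (x # xs) - i \<and>
        v = (\<Sum>j\<in>{i..<length (x # xs)}. (x # xs) ! j - 1)) \<longleftrightarrow>
      (1 < x \<and> u = length (x # xs) \<and> v = (\<Sum>j\<in>{0..<length (x # xs)}. (x # xs) ! j - 1)) \<or>
      (\<exists>i<length xs. 1 < xs ! i \<and> u = length xs - i \<and> v = (\<Sum>j\<in>{i..<length xs}. xs ! j - 1))"
    (is "(\<exists>i<_. ?Q i) \<longleftrightarrow> ?A \<or> (\<exists>i<_. ?B i)")
  proof -
    have "?Q 0 \<longleftrightarrow> ?A" by simp
    moreover have "?Q (Suc i) \<longleftrightarrow> ?B i" for i using shift[of i] by (simp del: sum.op_ivl_Suc)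
    ultimately show ?thesis by (simp only: length_Cons Ex_less_Suc2)
  qed
  then show ?case using Cons sum0 by (auto simp del: sum.op_ivl_Suc)
qed simp

lemma descents_replicate: "descents (replicate m 1 @ ys) = descents ys"
  by (induction m) auto

text \<open>In \<open>suf\<close> every block, the first included, starts with its d + 1. So each
  block contributes exactly one part above 1, and the ones behind it contribute to the length
  only.\<close>

lemma comp_of_blocks_descents:
  fixes ds es :: "nat list"
  defines "K \<equiv> length ds"
  defines "suf \<equiv> \<lambda>j. concat (map (\<lambda>j. (ds ! j + 1) # replicate (es ! j - 1) 1) [j..<K])"
  assumes len: "length es = K" and d: "\<And>j. j < K \<Longrightarrow> 1 \<le> ds ! j" and e: "\<And>j. j < K \<Longrightarrow> 1 \<le> es ! j"
  shows "j \<le> K \<Longrightarrow> length (suf j) = (\<Sum>i\<in>{j..<K}. es ! i) \<and>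
      sum_list (map (\<lambda>y. y - 1) (suf j)) = (\<Sum>i\<in>{j..<K}. ds ! i) \<and>
      descents (suf j) = (\<lambda>j'. (\<Sum>i\<in>{j'..<K}. es ! i, \<Sum>i\<in>{j'..<K}. ds ! i)) ` {j..<K}"
proof (induction j rule: inc_induct)
  case base
  show ?case by (simp add: suf_def)
next
  case (step m)
  have suf: "suf m = (ds ! m + 1) # replicate (es ! m - 1) 1 @ suf (Suc m)"
    unfolding suf_def using step by (simp add: upt_conv_Cons)
  have len: "length (suf m) = (\<Sum>i\<in>{m..<K}. es ! i)"
    unfolding suf using step e[of m] by (simp add: sum.atLeast_Suc_lessThan)
  have sum: "sum_list (map (\<lambda>y. y - 1) (suf m)) = (\<Sum>i\<in>{m..<K}. ds ! i)"
    unfolding suf using step by (simp add: sum.atLeast_Suc_lessThan sum_list_replicate)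
  have "descents (suf m) = insert (length (suf m), sum_list (map (\<lambda>y. y - 1) (suf m))) (descents (suf (Suc m)))"
    unfolding suf descents.simps descents_replicate using d[of m] step by simp
  also have "\<dots> = (\<lambda>j'. (\<Sum>i\<in>{j'..<K}. es ! i, \<Sum>i\<in>{j'..<K}. ds ! i)) ` {m..<K}"
  proof -
    have "{m..<K} = insert m {Suc m..<K}" using step by auto
    then show ?thesis unfolding len sum using step.IH by simp
  qed
  finally show ?case using len sum by simp
qed

text \<open>Raising the first part of \<open>al\<close> by one gives \<beta>, and the exception in
  \<open>inc\<close> is made for exactly this: \<open>inc al i = \<beta> ! i - 1\<close> holds at
  every position.\<close>

lemma comp_of_blocks_inc:
  assumes len: "length es = length ds" and d: "\<And>j. j < length ds \<Longrightarrow> 1 \<le> ds ! j"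
    and e: "\<And>j. j < length ds \<Longrightarrow> 1 \<le> es ! j" and al: "al = comp_of_blocks ds es"
  shows "(\<lambda>i. (length al - i, \<Sum>j\<in>{i..<length al}. inc al j)) ` {i. i < length al \<and> 0 < inc al i} =
    (\<lambda>j. (\<Sum>i=j..length ds. es ! (i - 1), \<Sum>i=j..length ds. ds ! (i - 1))) ` {1..length ds}"
proof -
  define K where "K = length ds"
  define \<beta> where "\<beta> = concat (map (\<lambda>j. (ds ! j + 1) # replicate (es ! j - 1) 1) [0..<K])"
  have desc: "descents \<beta> = (\<lambda>j'. (\<Sum>i\<in>{j'..<K}. es ! i, \<Sum>i\<in>{j'..<K}. ds ! i)) ` {0..<K}"
    using comp_of_blocks_descents[of es ds 0] len d e unfolding \<beta>_def K_def by auto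
  have same: "length al = length \<beta> \<and> (\<forall>i<length \<beta>. inc al i = \<beta> ! i - 1)"
  proof (cases "K = 0")
    case True
    then show ?thesis by (simp add: al comp_of_blocks_def \<beta>_def K_def)
  next
    case False
    define X where "X = concat (map (\<lambda>j. (ds ! j + 1) # replicate (es ! j - 1) 1) [1..<K])"
    have upt: "[0..<K] = 0 # [1..<K]" using False by (simp add: upt_conv_Cons)
    have \<beta>: "\<beta> = (ds ! 0 + 1) # replicate (es ! 0 - 1) 1 @ X" unfolding \<beta>_def X_def upt by simp
    define F where "F j = (if j = 0 then ds ! j else ds ! j + 1) # replicate (es ! j - 1) 1" for j
    have X: "concat (map F [1..<K]) = X"
      unfolding X_def F_def by (intro arg_cong[of _ _ concat] map_cong) auto
    have "al = concat (map F (0 # [1..<K]))" unfolding al comp_of_blocks_def K_def[symmetric] upt F_def ..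
    also have "\<dots> = F 0 @ X" unfolding X[symmetric] by (simp only: list.map concat.simps)
    finally have al': "al = ds ! 0 # replicate (es ! 0 - 1) 1 @ X" by (simp add: F_def)
    show ?thesis unfolding al' \<beta> by (auto simp: inc_def nth_Cons split: nat.split)
  qed
  have "(\<lambda>i. (length al - i, \<Sum>j\<in>{i..<length al}. inc al j)) ` {i. i < length al \<and> 0 < inc al i} = descents \<beta>"
  proof (rule Set.set_eqI)
    fix uv :: "nat \<times> nat"
    obtain u v where uv: "uv = (u, v)" by (cases uv)
    have "(\<Sum>j\<in>{i..<length \<beta>}. inc al j) = (\<Sum>j\<in>{i..<length \<beta>}. \<beta> ! j - 1)" for i
      using same by (intro sum.cong) auto
    then show "uv \<in> (\<lambda>i. (length al - i, \<Sum>j\<in>{i..<length al}. inc al j)) ` {i. i < length al \<and> 0 < inc al i} \<longleftrightarrow>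
        uv \<in> descents \<beta>"
      unfolding uv descents_iff using same by auto
  qed
  also have "descents \<beta> = (\<lambda>j. (\<Sum>i=j..K. es ! (i - 1), \<Sum>i=j..K. ds ! (i - 1))) ` {1..K}"
  proof -
    have shift: "(\<Sum>i=Suc m..K. f (i - 1)) = (\<Sum>i\<in>{m..<K}. f i)" for m and f :: "nat \<Rightarrow> nat"
      by (rule sum.reindex_bij_witness[of _ Suc "\<lambda>i. i - 1"]) auto
    have "{1..K} = Suc ` {0..<K}" by (simp add: image_Suc_atLeastLessThan atLeastLessThanSuc_atLeastAtMost)
    then show ?thesis unfolding desc by (simp only: image_image shift)
  qed
  finally show ?thesis by (simp add: K_def)
qed

text \<open>The boundary of \<lambda> is read on both sides of the diagonal. Rows meeting the
  diagonal give the elements r + D j above r; the other rows give elements of \<open>{1..r}\<close>,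
  where the columns j occupy the complementary places r + 1 - E j. Inclusion in A suffices, since
  both sets have r elements.\<close>

lemma subset_of_comp_part:
  assumes rn: "r \<le> n" and lam: "lam \<in> Part r n" and al: "al \<in> Comp r n" and cp: "comp_part al lam"
    and a: "a + length al = r + 1" "1 \<le> a"
  shows "subset_of_part r n lam = staircase.A r a (steps r a al)"
proof -
  interpret staircase r n a "steps r a al" by (rule staircase_steps[OF rn al a])
  have len: "length lam = r" using lam by (simp add: Part_def)
  obtain ds es where lde: "length es = length ds" and dse: "\<forall>d\<in>set ds. 1 \<le> d" "\<forall>e\<in>set es. 1 \<le> e"
    and al_eq: "al = comp_of_blocks ds es" and diag: "{j. (j, j) \<in> diagram lam} = {1..length ds}"
    and arms: "\<And>j. j \<in> {1..length ds} \<Longrightarrow> arm lam (j, j) = (\<Sum>i=j..length ds. ds ! (i - 1)) - 1"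
    and legs: "\<And>j. j \<in> {1..length ds} \<Longrightarrow> leg lam (j, j) = (\<Sum>i=j..length ds. es ! (i - 1)) - 1"
  proof (cases "al = []")
    case True
    then have "diagram lam = {}" using cp by (simp add: comp_part_def)
    then show ?thesis using that[of "[]" "[]"] True by (simp add: comp_of_blocks_def)
  next
    case False
    then obtain ds es where "length ds = length es" "\<forall>d\<in>set ds. 1 \<le> d" "\<forall>e\<in>set es. 1 \<le> e"
      "al = comp_of_blocks ds es" "{j. (j, j) \<in> diagram lam} = {1..length ds}"
      "\<forall>j\<in>{1..length ds}. arm lam (j, j) = (\<Sum>i=j..length ds. ds ! (i - 1)) - 1 \<and>
         leg lam (j, j) = (\<Sum>i=j..length ds. es ! (i - 1)) - 1"
      using cp unfolding comp_part_def by auto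
    then show ?thesis by (intro that[of es ds]) auto
  qed
  \<comment> \<open>K is the side of the Durfee square, and E and D are leg + 1 and arm + 1 of its
    diagonal boxes.\<close>
  define K where "K = length ds"
  define E where "E j = (\<Sum>i=j..K. es ! (i - 1))" for j
  define D where "D j = (\<Sum>i=j..K. ds ! (i - 1))" for j
  have d1: "1 \<le> ds ! j" "1 \<le> es ! j" if "j < K" for j
    using dse that nth_mem[of j ds] nth_mem[of j es] lde by (auto simp: K_def)
  have ED1: "1 \<le> E j" "1 \<le> D j" if "j \<in> {1..K}" for j
  proof -
    have split: "{j..K} = insert j {Suc j..K}" using that by auto
    have "1 \<le> es ! (j - 1)" "1 \<le> ds ! (j - 1)" using d1[of "j - 1"] that by auto
    then show "1 \<le> E j" "1 \<le> D j" unfolding E_def D_def split by auto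
  qed
  have blocks: "(\<lambda>i. (length al - i, \<Sum>j\<in>{i..<length al}. inc al j)) ` {i. i < length al \<and> 0 < inc al i} =
    (\<lambda>j. (E j, D j)) ` {1..K}"
    unfolding E_def D_def K_def by (rule comp_of_blocks_inc[OF lde _ _ al_eq]) (use d1 in \<open>auto simp: K_def\<close>)
  have P_iff: "s \<in> P \<longleftrightarrow> (\<exists>i<length al. 0 < inc al i \<and> s = a + i)" for s
  proof
    assume "s \<in> P"
    then have s: "a \<le> s" "s \<le> r" "steps r a al (s + 1) < steps r a al s" by (auto simp: P_def)
    then have "s - a < length al" using a by simp
    then show "\<exists>i<length al. 0 < inc al i \<and> s = a + i"
      using s steps_rec[of "s - a" al r a] by (intro exI[of _ "s - a"]) auto
  next
    assume "\<exists>i<length al. 0 < inc al i \<and> s = a + i"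
    then show "s \<in> P" using steps_rec[of "s - a" al r a] a by (auto simp: P_def)
  qed
  have P_E: "\<exists>j\<in>{1..K}. s + E j = r + 1" if "s \<in> P" for s
  proof -
    from that obtain i where i: "i < length al" "0 < inc al i" "s = a + i" using P_iff by blast
    then have "(length al - i, \<Sum>j\<in>{i..<length al}. inc al j) \<in> (\<lambda>j. (E j, D j)) ` {1..K}"
      unfolding blocks[symmetric] by blast
    then obtain j where "j \<in> {1..K}" "length al - i = E j" by auto
    then show ?thesis using i a by (intro bexI[of _ j]) auto
  qed
  have D_\<rho>: "r + D j \<in> steps r a al ` P" if "j \<in> {1..K}" for j
  proof -
    have "(E j, D j) \<in> (\<lambda>i. (length al - i, \<Sum>j\<in>{i..<length al}. inc al j)) ` {i. i < length al \<and> 0 < inc al i}"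
      unfolding blocks using that by blast
    then obtain i where i: "i < length al" "0 < inc al i" "D j = (\<Sum>j\<in>{i..<length al}. inc al j)" by blast
    then have "steps r a al (a + i) = r + D j" by (simp add: steps_def)
    moreover have "a + i \<in> P" using P_iff i by blast
    ultimately show ?thesis by (metis imageI)
  qed
  have diag_iff: "1 \<le> i \<and> i \<le> part_row lam i \<longleftrightarrow> i \<in> {1..K}" for i
  proof -
    have "i \<in> {j. (j, j) \<in> diagram lam} \<longleftrightarrow> i \<in> {1..K}" unfolding diag K_def ..
    then show ?thesis by (auto simp: diagram_def)
  qed
  have KD: "part_row lam j = j + D j - 1" if j: "j \<in> {1..K}" for j
  proof -
    have "{j'. j < j' \<and> (j, j') \<in> diagram lam} = {j<..part_row lam j}" using j by (auto simp: diagram_def)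
    then have "part_row lam j - j = D j - 1" using arms[of j] j by (simp add: arm_def D_def K_def)
    then show ?thesis using diag_iff[of j] j ED1[OF j] by simp
  qed
  \<comment> \<open>Inverts the definition of \<lambda>_A: element number k of the subset belongs to
    row r + 1 - k.\<close>
  define f where "f k = part_row lam (r + 1 - k) + k" for k
  have f_less: "f i < f j" if "1 \<le> i" "i < j" "j \<le> r" for i j
  proof -
    have "part_row lam (r + 1 - i) \<le> part_row lam (r + 1 - j)"
      by (rule part_row_antimono[OF lam]) (use that in auto)
    then show ?thesis using that unfolding f_def by linarith
  qed
  have sl: "sorted_list_of_set (f ` {1..r}) = map f [1..<Suc r]" "card (f ` {1..r}) = r"
    using sorted_list_of_strict_image[of r f] f_less by blast+
  have f_sub: "f ` {1..r} \<in> rsubsets r n"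
  proof -
    have "f k \<in> {1..n}" if "k \<in> {1..r}" for k
      using part_row_le[OF lam, of "r + 1 - k"] that rn unfolding f_def by auto
    then show ?thesis using sl(2) by (auto simp: rsubsets_def)
  qed
  have "subset_of_part r n lam = f ` {1..r}"
  proof (rule subset_of_part_eq[OF rn f_sub part_of_subset_rows[OF f_sub len]])
    fix i assume "i \<in> {1..r}"
    then show "part_row lam i = sorted_list_of_set (f ` {1..r}) ! (r - i) - (r + 1 - i)"
      unfolding sl(1) by (auto simp: f_def simp del: upt_Suc)
  qed
  moreover have "f ` {1..r} \<subseteq> A"
  proof
    fix y assume "y \<in> f ` {1..r}"
    then obtain k where k: "k \<in> {1..r}" "y = f k" by blast
    define i where "i = r + 1 - k"
    have i: "i \<in> {1..r}" "y = part_row lam i + (r + 1 - i)" using k by (auto simp: i_def f_def)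
    show "y \<in> A"
    proof (cases "i \<in> {1..K}")
      case True
      then have "y = r + D i" using KD[OF True] i ED1[OF True] by auto
      then show ?thesis using D_\<rho>[OF True] unfolding A_def by simp
    next
      case False
      then have lt: "part_row lam i < i" using diag_iff[of i] i by auto
      \<comment> \<open>If y = r + 1 - E j, then row i of \<lambda> and E j add up to i. But E j - 1
        is the leg of (j, j): the sum is larger than i if column j reaches row i, and smaller than i
        if it does not.\<close>
      have "y \<notin> P"
      proof
        assume "y \<in> P"
        then obtain j where j: "j \<in> {1..K}" "y + E j = r + 1" using P_E by blast
        then have ij: "part_row lam i + E j = i" using i by auto
        define L where "L = {i'. j < i' \<and> (i', j) \<in> diagram lam}"
        have L: "card L = E j - 1" using legs[of j] j by (simp add: L_def leg_def E_def K_def)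
        have L_iff: "i' \<in> L \<longleftrightarrow> j < i' \<and> j \<le> part_row lam i'" for i' using j by (auto simp: L_def diagram_def)
        have "finite L"
          by (rule finite_subset[of _ "{1..r}"]) (use j len in \<open>auto simp: L_iff part_row_def split: if_splits\<close>)
        show False
        proof (cases "j \<le> part_row lam i")
          case True
          have "{j<..i} \<subseteq> L"
          proof
            fix i' assume i': "i' \<in> {j<..i}"
            then have "part_row lam i \<le> part_row lam i'" by (intro part_row_antimono[OF lam]) auto
            then show "i' \<in> L" using i' True by (simp add: L_iff)
          qed
          then have "card {j<..i} \<le> card L" using \<open>finite L\<close> by (intro card_mono)
          then show False using L True ij ED1[OF j(1)] by simp
        next
          case False
          have "j < i"
          proof (rule ccontr)
            assume "\<not> j < i"
            then have "part_row lam j \<le> part_row lam i" using i by (intro part_row_antimono[OF lam]) auto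
            then show False using diag_iff[of j] j False by simp
          qed
          have "L \<subseteq> {j<..<i}"
          proof
            fix i' assume i': "i' \<in> L"
            have "i' < i"
            proof (rule ccontr)
              assume "\<not> i' < i"
              then have "part_row lam i' \<le> part_row lam i" using i by (intro part_row_antimono[OF lam]) auto
              then show False using i' False by (simp add: L_iff)
            qed
            then show "i' \<in> {j<..<i}" using i' by (simp add: L_iff)
          qed
          then have "card L \<le> card {j<..<i}" by (intro card_mono) auto
          then show False using L False ij ED1[OF j(1)] \<open>j < i\<close> by simp
        qed
      qed
      then show ?thesis using i lt by (auto simp: A_def)
    qed
  qed
  then have "f ` {1..r} = A"
    using f_sub A_rsubsets finite_subset[of A "{1..n}"] by (intro card_subset_eq) (auto simp: rsubsets_def)
  ultimately show ?thesis by simp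
qed

theorem theorem6p7:
  fixes r n :: nat and lam al nu eta :: "nat list" and w x :: "nat \<Rightarrow> nat"
  assumes "r \<le> n"
    and "lam \<in> Part r n"
    and "al \<in> Comp r n" and "comp_part al lam"
    and "nu \<in> Part r n" and "eta \<in> Part r n" and "ribbon_shape al eta nu"
    and "w = ribbon_perm r n (length al)"
    and "x = grassmannian_perm r n nu \<circ> w"
  shows "X_NC r n lam = translate n (Hilbert_Choice.inv x) (richardson r n eta nu)"
proof -
  define l where "l = length al"
  have l: "l \<le> r" using assms(3) by (auto simp: Comp_def l_def)
  define a where "a = r + 1 - l"
  have a: "a + length al = r + 1" "1 \<le> a" using l by (auto simp: a_def l_def)
  have al': "a + l = r + 1" using l by (simp add: a_def)
  interpret staircase r n a "steps r a al" by (rule staircase_steps[OF assms(1,3) a])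
  note rows = ribbon_rows[OF assms(5,6,3,7), folded l_def]
  have nu_i: "steps r a al (a + i) = r + part_row nu i" if "i \<in> {1..l}" for i
    using rows(1)[OF that] by (simp add: steps_def l_def)
  have A: "subset_of_part r n lam = A" by (rule subset_of_comp_part[OF assms(1-4) a])
  \<comment> \<open>Row i belongs to element number r + 1 - i of the subset, and inside the ribbon
    this is index a + i - 1 of the staircase.\<close>
  have flip: "flip (r + 1 - i) = (if l < i then r + 1 - i else a + i - 1)" if "i \<in> {1..r}" for i
    using that al' unfolding flip_def by auto
  have B: "subset_of_part r n nu = B"
  proof (rule subset_of_part_eq[OF assms(1) B_sorted(1) part_of_subset_rows[OF B_sorted(1)]])
    show "length nu = r" using assms(5) by (simp add: Part_def)
    fix i assume i: "i \<in> {1..r}"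
    then have "r + 1 - i \<in> {1..r}" by auto
    then have s: "sorted_list_of_set B ! (r - i) = bs (r + 1 - i)" using B_sorted(2)[of "r + 1 - i"] by simp
    show "part_row nu i = sorted_list_of_set B ! (r - i) - (r + 1 - i)"
    proof (cases "l < i")
      case True
      then have "lo (r + 1 - i) = r + 1 - i" using i al' by (auto simp: lo_def)
      then show ?thesis using s True rows(3)[OF True] flip[OF i] by (simp add: bs_def)
    next
      case False
      then have "i \<in> {1..l}" using i by simp
      moreover have "\<not> a + i - 1 < a" "a + i - 1 + 1 = a + i" using i by auto
      then have "lo (a + i - 1) = steps r a al (a + i) + a - (a + i - 1)" by (simp only: lo_def if_False)
      ultimately show ?thesis using s False nu_i[of i] flip[OF i] i by (simp add: bs_def)
    qed
  qed
  have C: "subset_of_part r n eta = C"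
  proof (rule subset_of_part_eq[OF assms(1) C_sorted(1) part_of_subset_rows[OF C_sorted(1)]])
    show "length eta = r" using assms(6) by (simp add: Part_def)
    fix i assume i: "i \<in> {1..r}"
    then have "r + 1 - i \<in> {1..r}" by auto
    then have s: "sorted_list_of_set C ! (r - i) = cs (r + 1 - i)" using C_sorted(2)[of "r + 1 - i"] by simp
    show "part_row eta i = sorted_list_of_set C ! (r - i) - (r + 1 - i)"
    proof (cases "l < i")
      case True
      then have "hi (r + 1 - i) = r + 1 - i" using i al' by (auto simp: hi_def)
      then show ?thesis using s True rows(3)[OF True] flip[OF i] by (simp add: cs_def)
    next
      case False
      then have il: "i \<in> {1..l}" using i by simp
      have rec: "steps r a al (a + i - 1) = r + part_row nu i + inc al (i - 1)"
        using steps_rec[of "i - 1" al r a] nu_i[OF il] il by (auto simp: l_def)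
      have pos: "1 \<le> al ! (i - 1)"
      proof -
        have "al ! (i - 1) \<in> set al" using il by (auto simp: l_def)
        then show ?thesis using assms(3) by (auto simp: Comp_def)
      qed
      have cs: "cs (r + 1 - i) = hi (a + i - 1)" using flip[OF i] False by (simp add: cs_def)
      have eta: "part_row eta i = part_row nu i + al ! (i - 1)" by (rule rows(2)[OF il])
      \<comment> \<open>In the top row neither \<open>hi\<close> nor \<open>inc\<close> has its
        correction by one; in the other rows the two corrections cancel.\<close>
      show ?thesis
      proof (cases "i = 1")
        case True
        then show ?thesis unfolding s cs eta using rec by (simp add: hi_def inc_def)
      next
        case False
        then have "hi (a + i - 1) = steps r a al (a + i - 1) + a - (a + i - 1) + 1" using il by (auto simp: hi_def)
        then show ?thesis unfolding s cs eta rec using pos False il i by (auto simp: inc_def)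
      qed
    qed
  qed
  interpret staircase_perm r n a "steps r a al" x
    unfolding assms(8,9) l_def[symmetric] by (rule grassmannian_ribbon_perm[OF B]) (use a in \<open>simp add: l_def\<close>)
  show ?thesis
    using closure_eq_translate by (simp add: X_NC_def richardson_def schubert_def opposite_schubert_def A B C Let_def)
qed

end
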